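(* Let $\mu$ be a probability measure on $\mathsf{Shuffler}(\mathbb{Z})=\mathrm{FSym}(\mathbb{Z})\rtimes\mathbb{Z}$ with a finite first moment that induces a transient random walk on $\mathbb{Z}$. Let $F_\infty:\mathbb{Z}\to\mathbb{Z}$ be the (almost surely defined) pointwise limit of the permutation coordinate of the $\mu$-random walk, and let $\lambda$ be the hitting measure, i.e. the law of $F_\infty$ under $\mathbb{P}$ on the space $\mathcal{F}(\mathbb{Z})$ of injective functions $\mathbb{Z}\to\mathbb{Z}$. Then the Poisson boundary of $(\mathsf{Shuffler}(\mathbb{Z}),\mu)$ coincides with $(\mathcal{F}(\mathbb{Z}),\lambda)$, the space of limit functions $F_\infty$ endowed with the hitting measure; that is, the $\sigma$-algebra of shift-invariant events of the space of trajectories equals, modulo $\mathbb{P}$-null sets, the $\sigma$-algebra generated by $F_\infty$.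
   Context: Lampshuffler group. For a countable group $H$, $\mathrm{FSym}(H)$ is the group (under composition) of bijections $f:H\to H$ with finite support $\mathrm{supp}(f)=\{h: f(h)\ne h\}$. $H$ acts on functions $f:H\to H$ by $(h\cdot f)(x)=hf(h^{-1}x)$, and $\mathsf{Shuffler}(H):=\mathrm{FSym}(H)\rtimes H$, with product $(f,x)(g,y)=(f\circ(x\cdot g),xy)$. For $H$ finitely generated, $\mathsf{Shuffler}(H)$ is finitely generated. Here $H=\mathbb{Z}$ (written additively). Random walk. For a probability measure $\mu$ on a countable group $G$, the $\mu$-random walk is $x_n=g_1g_2\cdots g_n$ with $g_i$ i.i.d. of law $\mu$, started at $e_G$; $\mathbb{P}$ is the law of the trajectory $(x_1,x_2,\dots)$ on $G^\infty$. For $G=\mathsf{Shuffler}(H)$ write $x_n=(F_n,S_n)$ with $F_n\in\mathrm{FSym}(H)$ (the permutation coordinate) and $S_n\in H$. The random walk induced on $H$ is $\{S_n\}$, i.e. the random walk driven by the push-forward of $\mu$ under the projection $\mathsf{Shuffler}(H)\to H$; it is transient if almost surely it visits $e_H$ only finitely many times. $\mu$ has a finite first moment if $\sum_{g}\ell(g)\mu(g)<\infty$ for some (equivalently, any) word length $\ell$ on the finitely generated group $G$. Limit functions. Under the hypotheses of the claim, almost surely for every $h\in\mathbb{Z}$ the sequence $F_n(h)$ is eventually constant, with value denoted $F_\infty(h)$; $F_\infty$ is injective. $\mathcal{F}(\mathbb{Z})=\{f:\mathbb{Z}\to\mathbb{Z}\text{ injective}\}$ carries the $\sigma$-algebra generated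 by evaluations at points, and the $\mathsf{Shuffler}(\mathbb{Z})$-action $(f,x)\cdot F=f\circ(x\cdot F)$. Poisson boundary. The shift is $T(x_1,x_2,\dots)=(x_2,x_3,\dots)$ on $G^\infty$; $\mathcal{I}$ is the $\sigma$-algebra of shift-invariant events. The Poisson boundary of $(G,\mu)$ is the measure $G$-space $(B,\mathcal{A},\nu)$ with a $G$-equivariant measurable map $\mathbf{bnd}:G^\infty\to B$ such that $\mathcal{I}=\mathbf{bnd}^{-1}(\mathcal{A})$ modulo $\mathbb{P}$-null sets and $\nu=\mathbf{bnd}_*\mathbb{P}$ is $\mu$-stationary ($\nu=\sum_g\mu(g)\,g\nu$); it is unique up to $G$-equivariant measurable isomorphism. *)

theory Defs
  imports "HOL-Probability.Probability" "HOL-Algebra.Group_Action" "HOL-Algebra.Generated_Groups"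
begin

section \<open>Random walks on discrete groups\<close>

text \<open>Trajectories are indexed from 0, so \<open>x n\<close> is the position after \<open>n + 1\<close> steps; the
  starting point \<open>\<one>\<close> is not part of the trajectory.\<close>

definition trajectory_space :: "('a, 'b) monoid_scheme \<Rightarrow> (nat \<Rightarrow> 'a) measure" where
  "trajectory_space G = PiM UNIV (\<lambda>_. count_space (carrier G))"

primrec walk_path :: "('a, 'b) monoid_scheme \<Rightarrow> (nat \<Rightarrow> 'a) \<Rightarrow> nat \<Rightarrow> 'a" where
  "walk_path G g 0 = g 0"
| "walk_path G g (Suc n) = walk_path G g n \<otimes>\<^bsub>G\<^esub> g (Suc n)"

definition walk_law :: "('a, 'b) monoid_scheme \<Rightarrow> 'a measure \<Rightarrow> (nat \<Rightarrow> 'a) measure" where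
  "walk_law G \<mu> = distr (PiM UNIV (\<lambda>_. \<mu>)) (trajectory_space G) (walk_path G)"

definition word_length :: "('a, 'b) monoid_scheme \<Rightarrow> 'a set \<Rightarrow> 'a \<Rightarrow> nat" where
  "word_length G S g =
     (LEAST n. \<exists>ws. length ws = n \<and> set ws \<subseteq> S \<union> (\<lambda>s. inv\<^bsub>G\<^esub> s) ` S \<and>
        foldr (\<lambda>a b. a \<otimes>\<^bsub>G\<^esub> b) ws \<one>\<^bsub>G\<^esub> = g)"

definition finite_first_moment :: "('a, 'b) monoid_scheme \<Rightarrow> 'a measure \<Rightarrow> bool" where
  "finite_first_moment G \<mu> \<longleftrightarrow>
     (\<exists>S. finite S \<and> S \<subseteq> carrier G \<and> generate G S = carrier G \<and>
        integrable \<mu> (\<lambda>g. real (word_length G S g)))"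

section \<open>The Poisson boundary\<close>

definition invariant_events :: "('a, 'b) monoid_scheme \<Rightarrow> (nat \<Rightarrow> 'a) set set" where
  "invariant_events G =
     {A \<in> sets (trajectory_space G).
        (\<lambda>x n. x (Suc n)) -` A \<inter> space (trajectory_space G) = A}"

definition equal_mod_null :: "'a measure \<Rightarrow> 'a set set \<Rightarrow> 'a set set \<Rightarrow> bool" where
  "equal_mod_null M \<A> \<B> \<longleftrightarrow>
     (\<forall>A\<in>\<A>. \<exists>B\<in>\<B>. sym_diff A B \<in> null_sets M) \<and>
     (\<forall>B\<in>\<B>. \<exists>A\<in>\<A>. sym_diff A B \<in> null_sets M)"

definition stationary_measure :: "'g measure \<Rightarrow> ('g \<Rightarrow> 'b \<Rightarrow> 'b) \<Rightarrow> 'b measure \<Rightarrow> bool" where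
  "stationary_measure \<mu> act \<nu> \<longleftrightarrow>
     (\<forall>A\<in>sets \<nu>. emeasure \<nu> A = (\<integral>\<^sup>+ g. emeasure (distr \<nu> \<nu> (act g)) A \<partial>\<mu>))"

text \<open>The measure \<open>G\<close>-space \<open>\<nu>\<close>, with action \<open>act\<close>, is the Poisson boundary of \<open>(G, \<mu>)\<close> via the
  boundary map \<open>bnd\<close>.\<close>

definition poisson_boundary ::
  "('a, 'c) monoid_scheme \<Rightarrow> 'a measure \<Rightarrow> 'b measure \<Rightarrow> ('a \<Rightarrow> 'b \<Rightarrow> 'b) \<Rightarrow> ((nat \<Rightarrow> 'a) \<Rightarrow> 'b) \<Rightarrow> bool"
  where
  "poisson_boundary G \<mu> \<nu> act bnd \<longleftrightarrow>
     group_action G (space \<nu>) act \<and>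
     (\<forall>g\<in>carrier G. act g \<in> measurable \<nu> \<nu>) \<and>
     bnd \<in> measurable (trajectory_space G) \<nu> \<and>
     (\<forall>g\<in>carrier G. \<forall>x\<in>space (trajectory_space G).
        bnd (\<lambda>n. g \<otimes>\<^bsub>G\<^esub> x n) = act g (bnd x)) \<and>
     equal_mod_null (walk_law G \<mu>) (invariant_events G)
       (sets (vimage_algebra (space (trajectory_space G)) bnd \<nu>)) \<and>
     \<nu> = distr (walk_law G \<mu>) \<nu> bnd \<and>
     stationary_measure \<mu> act \<nu>"

section \<open>Lampshuffler groups\<close>

text \<open>The base group \<open>H\<close> is written additively, as a type of class \<^class>\<open>group_add\<close>.\<close>

definition FSym :: "('h \<Rightarrow> 'h) set" where
  "FSym = {f. bij f \<and> finite {h. f h \<noteq> h}}"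

definition translate :: "'h::group_add \<Rightarrow> ('h \<Rightarrow> 'h) \<Rightarrow> 'h \<Rightarrow> 'h" where
  "translate x f = (\<lambda>h. x + f (- x + h))"

definition shuffler :: "(('h::group_add \<Rightarrow> 'h) \<times> 'h) monoid" where
  "shuffler = \<lparr>carrier = FSym \<times> UNIV,
     mult = (\<lambda>(f, x) (g, y). (f \<circ> translate x g, x + y)),
     one = (id, 0)\<rparr>"

definition inj_space :: "('h \<Rightarrow> 'h) measure" where
  "inj_space = restrict_space (PiM UNIV (\<lambda>_. count_space UNIV)) {F. inj F}"

text \<open>\<^const>\<open>group_action\<close> requires the action maps to be extensional, hence the restriction.\<close>

definition shuffler_action :: "('h::group_add \<Rightarrow> 'h) \<times> 'h \<Rightarrow> ('h \<Rightarrow> 'h) \<Rightarrow> 'h \<Rightarrow> 'h" where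
  "shuffler_action = (\<lambda>(f, x). \<lambda>F\<in>{F. inj F}. f \<circ> translate x F)"

text \<open>The limit function \<open>F\<^sub>\<infinity>\<close>. On trajectories whose permutation coordinates do not stabilise
  pointwise, the first permutation is taken as a default value: it is injective and makes
  \<open>F\<^sub>\<infinity>\<close> equivariant everywhere, not just almost everywhere.\<close>

definition limit_function :: "(nat \<Rightarrow> ('h \<Rightarrow> 'h) \<times> 'h) \<Rightarrow> 'h \<Rightarrow> 'h" where
  "limit_function x =
     (if \<forall>h. \<exists>k. \<forall>\<^sub>F n in sequentially. fst (x n) h = k
      then (\<lambda>h. THE k. \<forall>\<^sub>F n in sequentially. fst (x n) h = k)
      else fst (x 0))"

definition hitting_measure ::
  "(('h::group_add \<Rightarrow> 'h) \<times> 'h) measure \<Rightarrow> ('h \<Rightarrow> 'h) measure" where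
  "hitting_measure \<mu> = distr (walk_law shuffler \<mu>) inj_space limit_function"

end

theory Submission
  imports Defs
begin

text \<open>
  Transience and the first moment force a nonzero drift on \<open>\<int>\<close>. Hence, with probability close to 1
  and uniformly in \<open>n\<close>, the permutation \<open>F\<^sub>n\<close> agrees with \<open>F\<^sub>\<infinity>\<close> behind a window of fixed width around
  \<open>S\<^sub>n\<close> and is the identity ahead of it, so \<open>F\<^sub>\<infinity>\<close> and \<open>S\<^sub>n\<close> leave boundedly many possibilities for
  \<open>F\<^sub>n\<close>. Up to time \<open>N\<close> the walk therefore mostly stays in a strip of \<open>O(N)\<close> group elements determined
  by \<open>F\<^sub>\<infinity>\<close>. Counting visits shows that, conditionally on \<open>F\<^sub>\<infinity>\<close>, its position is typically an element
  that is visited with probability bounded below. As the walk determines the invariant events in the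
  limit, the cell of a finite invariant partition containing a typical trajectory has conditional
  probability given \<open>F\<^sub>\<infinity>\<close> bounded below, uniformly over all such partitions.

  Define the energy of a finite invariant partition as the expected sum of the squares of the
  conditional probabilities of its cells given \<open>F\<^sub>\<infinity>\<close>. Conditioning also on the first \<open>n\<close> steps turns it
  into an average of energies of translated partitions, by stationarity of the law of \<open>F\<^sub>\<infinity>\<close>, so along
  partitions of nearly minimal energy it hardly increases: the conditional probabilities of the cells
  hardly change. By the uniform lower bound this passes to unions of cells, hence invariant events are
  independent of the first \<open>n\<close> steps given \<open>F\<^sub>\<infinity>\<close>. Since they are approximated by events depending on
  finitely many steps, they are determined by \<open>F\<^sub>\<infinity>\<close>. No entropy is used.
\<close>

section \<open>Random walks and the Markov property\<close>

text \<open>The lower bound on conditional probabilities of cells rests on a comparison that holds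
  for every invariant event A: the expected number of visits to q on A is at most the Green function
  times P(A). So if q is visited often enough given \<open>F\<^sub>\<infinity>\<close>, at least
  \<delta> times on average, then for a walk standing at q the chance that A occurs although its
  conditional probability is below \<delta>' is at most of order \<delta>'/\<delta>. For large n the
  first n steps decide A up to a small error, so the walk seldom ends in such an A. The errors are
  weighted by the probabilities of the cells, hence the number of cells does not enter.

  Conditional independence is wanted for a single event, but the energy only controls partitions
  that are nearly minimal, and its infimum need not be attained. The event is therefore written as a
  union of cells of such a partition, and square errors are turned into absolute ones cell by cell.
  This conversion is affordable only because cells of small conditional probability carry little
  mass.

  For the walk on the integers, almost sure one-sided bounds on partial sums take the place of the
  law of large numbers.\<close>

locale random_walk = group G + sequence_space \<mu>
  for G :: "('a, 'c) monoid_scheme" (structure) and \<mu> :: "'a measure" +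
  assumes sets_mu: "sets \<mu> = Pow (carrier G)"
    and countable_carrier: "countable (carrier G)"
begin

abbreviation "\<Omega> \<equiv> PiM (UNIV :: nat set) (\<lambda>_. \<mu>)"
abbreviation "T \<equiv> trajectory_space G"

text \<open>Unlike the trajectories, \<open>pos\<close> contains the starting point, so that the
  position at index n depends on exactly the n increments with index below n.\<close>

primrec pos :: "(nat \<Rightarrow> 'a) \<Rightarrow> nat \<Rightarrow> 'a" where
  "pos \<omega> 0 = \<one>"
| "pos \<omega> (Suc n) = pos \<omega> n \<otimes> \<omega> n"

definition path :: "(nat \<Rightarrow> 'a) \<Rightarrow> nat \<Rightarrow> 'a" where
  "path \<omega> n = pos \<omega> (Suc n)"

definition shift :: "nat \<Rightarrow> (nat \<Rightarrow> 'a) \<Rightarrow> nat \<Rightarrow> 'a" where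
  "shift n \<omega> = (\<lambda>i. \<omega> (i + n))"

text \<open>Dependence on the first n increments is stated pointwise instead of through a
  filtration. It then applies alike to events, positions and real functions, and measurability is
  tracked separately.\<close>

definition past :: "nat \<Rightarrow> ((nat \<Rightarrow> 'a) \<Rightarrow> 'd) \<Rightarrow> bool" where
  "past n f \<longleftrightarrow> (\<forall>\<omega>\<in>space \<Omega>. \<forall>\<omega>'\<in>space \<Omega>. (\<forall>i<n. \<omega> i = \<omega>' i) \<longrightarrow> f \<omega> = f \<omega>')"

definition lmult :: "'a \<Rightarrow> (nat \<Rightarrow> 'a) \<Rightarrow> nat \<Rightarrow> 'a" where
  "lmult g x = (\<lambda>n. g \<otimes> x n)"

text \<open>The translate of A by the inverse of g: the event that a walk restarted at g has its
  trajectory in A.\<close>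

definition pull :: "'a \<Rightarrow> (nat \<Rightarrow> 'a) set \<Rightarrow> (nat \<Rightarrow> 'a) set" where
  "pull g A = {x \<in> space T. lmult g x \<in> A}"

definition ev :: "(nat \<Rightarrow> 'a) set \<Rightarrow> (nat \<Rightarrow> 'a) set" where
  "ev A = {\<omega> \<in> space \<Omega>. path \<omega> \<in> A}"

lemma space_mu: "space \<mu> = carrier G"
  using sets_mu sets_eq_imp_space_eq[of \<mu> "count_space (carrier G)"] by simp

lemma sets_mu_count [measurable_cong]: "sets \<mu> = sets (count_space (carrier G))"
  by (simp add: sets_mu)

lemma sets_T: "sets T = sets \<Omega>"
  unfolding trajectory_space_def by (intro sets_PiM_cong) (simp_all add: sets_mu)

lemma space_\<Omega>: "space \<Omega> = {\<omega>. \<forall>n. \<omega> n \<in> carrier G}"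
  by (auto simp: space_PiM space_mu PiE_iff)

lemma space_T: "space T = {x. \<forall>n. x n \<in> carrier G}"
  using sets_eq_imp_space_eq[OF sets_T] space_\<Omega> by simp

lemma coord_carrier [intro]: "\<omega> \<in> space \<Omega> \<Longrightarrow> \<omega> n \<in> carrier G"
  by (simp add: space_\<Omega>)

lemma pos_carrier [simp, intro]: "\<omega> \<in> space \<Omega> \<Longrightarrow> pos \<omega> n \<in> carrier G"
  by (induction n) auto

lemma path_space [simp, intro]: "\<omega> \<in> space \<Omega> \<Longrightarrow> path \<omega> \<in> space T"
  by (auto simp: space_T path_def)

lemma shift_space [simp, intro]: "\<omega> \<in> space \<Omega> \<Longrightarrow> shift n \<omega> \<in> space \<Omega>"
  by (simp add: space_\<Omega> shift_def)

lemma lmult_space [simp, intro]: "g \<in> carrier G \<Longrightarrow> x \<in> space T \<Longrightarrow> lmult g x \<in> space T"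
  by (auto simp: space_T lmult_def)

lemma comb_space [simp, intro]: "\<omega> \<in> space \<Omega> \<Longrightarrow> \<omega>' \<in> space \<Omega> \<Longrightarrow> comb_seq n \<omega> \<omega>' \<in> space \<Omega>"
  by (auto simp: space_\<Omega> comb_seq_def)

lemma measurable_coord [measurable]: "(\<lambda>\<omega>. \<omega> n) \<in> measurable \<Omega> (count_space (carrier G))"
proof -
  have "(\<lambda>\<omega>. \<omega> n) \<in> measurable \<Omega> \<mu>" by measurable
  also have "measurable \<Omega> \<mu> = measurable \<Omega> (count_space (carrier G))"
    by (rule measurable_cong_sets) (simp_all add: sets_mu)
  finally show ?thesis .
qed

lemma measurable_mult [measurable (raw)]:
  assumes "f \<in> measurable M (count_space (carrier G))" "g \<in> measurable M (count_space (carrier G))"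
  shows "(\<lambda>x. f x \<otimes> g x) \<in> measurable M (count_space (carrier G))"
proof -
  have "(\<lambda>x. (f x, g x)) \<in> measurable M (count_space (carrier G) \<Otimes>\<^sub>M count_space (carrier G))"
    using assms by measurable
  also have "count_space (carrier G) \<Otimes>\<^sub>M count_space (carrier G) = count_space (carrier G \<times> carrier G)"
    by (rule pair_measure_countable) (simp_all add: countable_carrier)
  finally have 1: "(\<lambda>x. (f x, g x)) \<in> measurable M (count_space (carrier G \<times> carrier G))" .
  have 2: "(\<lambda>(a, b). a \<otimes> b) \<in> measurable (count_space (carrier G \<times> carrier G)) (count_space (carrier G))"
    by auto
  show ?thesis using measurable_compose[OF 1 2] by simp
qed

lemma measurable_pos [measurable]: "(\<lambda>\<omega>. pos \<omega> n) \<in> measurable \<Omega> (count_space (carrier G))"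
  by (induction n) simp_all

lemma measurable_path [measurable]: "path \<in> measurable \<Omega> T"
  unfolding trajectory_space_def
  by (rule measurable_PiM_single') (auto simp: path_def)

lemma measurable_shift [measurable]: "shift n \<in> measurable \<Omega> \<Omega>"
  unfolding shift_def
  by (rule measurable_PiM_single') (auto simp: space_mu)

lemma measurable_lmult [measurable]:
  assumes "g \<in> carrier G"
  shows "lmult g \<in> measurable T T"
  unfolding trajectory_space_def
  unfolding lmult_def
proof (rule measurable_PiM_single')
  fix i :: nat
  have "(\<lambda>x. x i) \<in> measurable (PiM UNIV (\<lambda>_. count_space (carrier G))) (count_space (carrier G))"
    by measurable
  moreover have "(\<lambda>y. g \<otimes> y) \<in> measurable (count_space (carrier G)) (count_space (carrier G))"
    using assms by auto
  ultimately show "(\<lambda>x. g \<otimes> x i) \<in> measurable (PiM UNIV (\<lambda>_. count_space (carrier G))) (count_space (carrier G))"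
    by (rule measurable_compose)
qed (use assms in \<open>auto simp: space_PiM PiE_iff\<close>)

lemma sets_pull [measurable (raw)]: "g \<in> carrier G \<Longrightarrow> A \<in> sets T \<Longrightarrow> pull g A \<in> sets T"
  unfolding pull_def using measurable_sets[OF measurable_lmult, of g A]
  by (simp add: vimage_def Int_def conj_commute)

lemma sets_ev [measurable (raw), intro]: "A \<in> sets T \<Longrightarrow> ev A \<in> sets \<Omega>"
  unfolding ev_def using measurable_sets[OF measurable_path, of A]
  by (simp add: vimage_def Int_def conj_commute)

lemma walk_path_eq: "\<omega> \<in> space \<Omega> \<Longrightarrow> walk_path G \<omega> n = path \<omega> n"
  by (induction n) (simp_all add: path_def coord_carrier)

lemma walk_law_eq: "walk_law G \<mu> = distr \<Omega> T path"
  unfolding walk_law_def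
  by (rule distr_cong) (auto simp: walk_path_eq fun_eq_iff)

lemma shift_comb [simp]: "shift n (comb_seq n \<omega> \<omega>') = \<omega>'"
  by (simp add: shift_def comb_seq_add)

lemma pos_shift: "\<omega> \<in> space \<Omega> \<Longrightarrow> pos \<omega> (k + n) = pos \<omega> n \<otimes> pos (shift n \<omega>) k"
  by (induction k) (simp_all add: m_assoc shift_def space_\<Omega> pos_carrier[unfolded space_\<Omega>])

lemma path_shift: "\<omega> \<in> space \<Omega> \<Longrightarrow> (\<lambda>k. path \<omega> (k + n)) = lmult (pos \<omega> n) (path (shift n \<omega>))"
  using pos_shift[of \<omega> "Suc _" n] by (auto simp: path_def lmult_def simp del: pos.simps)

lemma pastD:
  assumes "past n f" "\<omega> \<in> space \<Omega>" "\<omega>' \<in> space \<Omega>" "\<And>i. i < n \<Longrightarrow> \<omega> i = \<omega>' i"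
  shows "f \<omega> = f \<omega>'"
  using assms unfolding past_def by blast

lemma past_comb:
  "past n f \<Longrightarrow> \<omega> \<in> space \<Omega> \<Longrightarrow> \<omega>' \<in> space \<Omega> \<Longrightarrow> f (comb_seq n \<omega> \<omega>') = f \<omega>"
  by (rule pastD) (auto simp: comb_seq_less)

lemma past_pos:
  assumes "k \<le> n"
  shows "past n (\<lambda>\<omega>. pos \<omega> k)"
  unfolding past_def
proof (intro ballI impI)
  fix \<omega> \<omega>' :: "nat \<Rightarrow> 'a" assume eq: "\<forall>i<n. \<omega> i = \<omega>' i"
  show "pos \<omega> k = pos \<omega>' k"
    using assms by (induction k) (auto simp: eq)
qed

lemma past_mono: "past m f \<Longrightarrow> m \<le> n \<Longrightarrow> past n f"
  unfolding past_def by (meson less_le_trans)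

lemma past_compose: "past n f \<Longrightarrow> past n (\<lambda>\<omega>. h (f \<omega>))"
  unfolding past_def by metis

lemma past_compose2: "past n f \<Longrightarrow> past n g \<Longrightarrow> past n (\<lambda>\<omega>. h (f \<omega>) (g \<omega>))"
  unfolding past_def by metis

lemma past_const: "past n (\<lambda>_. c)"
  by (simp add: past_def)

text \<open>The Markov property at a fixed time. Replacing the increments from index n on by those
  of an independent copy preserves the law (\<open>PiM_comb_seq\<close>), and h sees only the
  retained increments in its first argument.\<close>

lemma nn_integral_split:
  assumes [measurable]: "case_prod h \<in> borel_measurable (\<Omega> \<Otimes>\<^sub>M \<Omega>)"
    and past: "\<And>\<omega>'. \<omega>' \<in> space \<Omega> \<Longrightarrow> past n (\<lambda>\<omega>. h \<omega> \<omega>')"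
  shows "(\<integral>\<^sup>+\<omega>. h \<omega> (shift n \<omega>) \<partial>\<Omega>) = (\<integral>\<^sup>+\<omega>. \<integral>\<^sup>+\<omega>'. h \<omega> \<omega>' \<partial>\<Omega> \<partial>\<Omega>)"
proof -
  have sf: "sigma_finite_measure \<Omega>" by unfold_locales
  have "(\<integral>\<^sup>+\<omega>. h \<omega> (shift n \<omega>) \<partial>\<Omega>) =
      (\<integral>\<^sup>+\<omega>. h \<omega> (shift n \<omega>) \<partial>distr (\<Omega> \<Otimes>\<^sub>M \<Omega>) \<Omega> (\<lambda>(\<omega>, \<omega>'). comb_seq n \<omega> \<omega>'))"
    by (simp only: PiM_comb_seq)
  also have "\<dots> = (\<integral>\<^sup>+p. h (comb_seq n (fst p) (snd p)) (snd p) \<partial>(\<Omega> \<Otimes>\<^sub>M \<Omega>))"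
    by (subst nn_integral_distr) (auto simp: split_beta' intro!: nn_integral_cong)
  also have "\<dots> = (\<integral>\<^sup>+p. h (fst p) (snd p) \<partial>(\<Omega> \<Otimes>\<^sub>M \<Omega>))"
    by (intro nn_integral_cong) (auto simp: space_pair_measure past_comb[OF past])
  also have "\<dots> = (\<integral>\<^sup>+\<omega>. \<integral>\<^sup>+\<omega>'. h \<omega> \<omega>' \<partial>\<Omega> \<partial>\<Omega>)"
    using sigma_finite_measure.nn_integral_fst[OF sf, of "case_prod h" \<Omega>]
    by (simp add: split_beta')
  finally show ?thesis .
qed

lemma nn_integral_split_mult:
  assumes [measurable]: "f \<in> borel_measurable \<Omega>" "g \<in> borel_measurable \<Omega>" and "past n f"
  shows "(\<integral>\<^sup>+\<omega>. f \<omega> * g (shift n \<omega>) \<partial>\<Omega>) = (\<integral>\<^sup>+\<omega>. f \<omega> \<partial>\<Omega>) * (\<integral>\<^sup>+\<omega>. g \<omega> \<partial>\<Omega>)"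
proof -
  have "(\<integral>\<^sup>+\<omega>. f \<omega> * g (shift n \<omega>) \<partial>\<Omega>) = (\<integral>\<^sup>+\<omega>. \<integral>\<^sup>+\<omega>'. f \<omega> * g \<omega>' \<partial>\<Omega> \<partial>\<Omega>)"
    by (intro nn_integral_split past_compose[OF assms(3)]) measurable
  also have "\<dots> = (\<integral>\<^sup>+\<omega>. f \<omega> * (\<integral>\<^sup>+\<omega>'. g \<omega>' \<partial>\<Omega>) \<partial>\<Omega>)"
    by (simp add: nn_integral_cmult)
  also have "\<dots> = (\<integral>\<^sup>+\<omega>. f \<omega> \<partial>\<Omega>) * (\<integral>\<^sup>+\<omega>. g \<omega> \<partial>\<Omega>)"
    by (simp add: nn_integral_multc)
  finally show ?thesis .
qed

lemma nn_integral_shift: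
  assumes [measurable]: "g \<in> borel_measurable \<Omega>"
  shows "(\<integral>\<^sup>+\<omega>. g (shift n \<omega>) \<partial>\<Omega>) = (\<integral>\<^sup>+\<omega>. g \<omega> \<partial>\<Omega>)"
  using nn_integral_split_mult[of "\<lambda>_. 1" g n] by (simp add: past_const P.emeasure_space_1)

lemma prob_split:
  assumes [measurable]: "C \<in> sets \<Omega>" "B \<in> sets \<Omega>" and "past n (\<lambda>\<omega>. \<omega> \<in> C)"
  shows "P.prob {\<omega> \<in> space \<Omega>. \<omega> \<in> C \<and> shift n \<omega> \<in> B} = P.prob C * P.prob B"
proof -
  have "emeasure \<Omega> {\<omega> \<in> space \<Omega>. \<omega> \<in> C \<and> shift n \<omega> \<in> B} =
      (\<integral>\<^sup>+\<omega>. indicator C \<omega> * indicator B (shift n \<omega>) \<partial>\<Omega>)"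
    by (subst nn_integral_indicator[symmetric], measurable, rule nn_integral_cong)
      (auto split: split_indicator)
  also have "\<dots> = (\<integral>\<^sup>+\<omega>. indicator C \<omega> \<partial>\<Omega>) * (\<integral>\<^sup>+\<omega>. indicator B \<omega> \<partial>\<Omega>)"
    using past_compose[OF assms(3), of of_bool]
    by (intro nn_integral_split_mult) (auto simp: indicator_def[abs_def] of_bool_def)
  also have "\<dots> = emeasure \<Omega> C * emeasure \<Omega> B" by simp
  finally show ?thesis
    by (simp add: P.emeasure_eq_measure ennreal_mult[symmetric])
qed

lemma invariant_shift:
  assumes "A \<in> invariant_events G" "x \<in> space T"
  shows "(\<lambda>k. x (k + n)) \<in> A \<longleftrightarrow> x \<in> A"
proof (induction n)
  case (Suc n)
  have sp: "(\<lambda>k. x (k + n)) \<in> space T" using assms(2) by (auto simp: space_T)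
  have "(\<lambda>k. x (k + Suc n)) \<in> A \<longleftrightarrow> (\<lambda>k. x (k + n)) \<in> (\<lambda>x n. x (Suc n)) -` A \<inter> space T"
    using sp by simp
  also have "(\<lambda>x n. x (Suc n)) -` A \<inter> space T = A"
    using assms(1) by (simp add: invariant_events_def)
  finally show ?case using Suc by simp
qed simp

lemma invariant_eventI:
  assumes "A \<in> sets T" "\<And>x. x \<in> space T \<Longrightarrow> (\<lambda>n. x (Suc n)) \<in> A \<longleftrightarrow> x \<in> A"
  shows "A \<in> invariant_events G"
  using assms sets.sets_into_space[OF assms(1)] by (auto simp: invariant_events_def)

lemma invariant_sets: "A \<in> invariant_events G \<Longrightarrow> A \<in> sets T"
  by (simp add: invariant_events_def)

lemma invariant_Int: "A \<in> invariant_events G \<Longrightarrow> B \<in> invariant_events G \<Longrightarrow> A \<inter> B \<in> invariant_events G"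
  by (auto simp: invariant_events_def)

lemma invariant_pull:
  assumes "A \<in> invariant_events G" "g \<in> carrier G"
  shows "pull g A \<in> invariant_events G"
proof (rule invariant_eventI)
  show "pull g A \<in> sets T" using assms by (intro sets_pull) (auto intro: invariant_sets)
  fix x assume x: "x \<in> space T"
  then have "(\<lambda>n. x (Suc n)) \<in> space T" by (auto simp: space_T)
  moreover have "lmult g (\<lambda>n. x (Suc n)) = (\<lambda>k. lmult g x (k + 1))" by (simp add: lmult_def)
  ultimately show "(\<lambda>n. x (Suc n)) \<in> pull g A \<longleftrightarrow> x \<in> pull g A"
    using x assms invariant_shift[OF assms(1), of "lmult g x" 1] by (simp add: pull_def)
qed

text \<open>Deleting the first n positions does not affect an invariant event, and what remains is
  the trajectory of the shifted increments translated by the position at time n.\<close>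

lemma ev_shift:
  assumes "A \<in> invariant_events G" "\<omega> \<in> space \<Omega>"
  shows "\<omega> \<in> ev A \<longleftrightarrow> shift n \<omega> \<in> ev (pull (pos \<omega> n) A)"
  using assms invariant_shift[OF assms(1), of "path \<omega>" n]
  by (simp add: ev_def pull_def path_shift)

text \<open>Given C the walk stands at the fixed element q at time n, so an invariant event
  remembers the past only through q.\<close>

lemma prob_past_invariant:
  assumes A: "A \<in> invariant_events G" and [measurable]: "C \<in> sets \<Omega>" and past: "past n (\<lambda>\<omega>. \<omega> \<in> C)"
    and pos: "\<And>\<omega>. \<omega> \<in> C \<Longrightarrow> pos \<omega> n = q" and q: "q \<in> carrier G"
  shows "P.prob (C \<inter> ev A) = P.prob C * P.prob (ev (pull q A))"
proof -
  have "C \<inter> ev A = {\<omega> \<in> space \<Omega>. \<omega> \<in> C \<and> shift n \<omega> \<in> ev (pull q A)}"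
    using ev_shift[OF A, of _ n] pos sets.sets_into_space[OF assms(2)]
    by (auto simp: ev_def)
  also have "P.prob \<dots> = P.prob C * P.prob (ev (pull q A))"
    by (intro prob_split past) (auto intro: invariant_sets invariant_pull A q)
  finally show ?thesis .
qed

lemma past_Diff:
  assumes "past n (\<lambda>\<omega>. \<omega> \<in> A)" "past n (\<lambda>\<omega>. \<omega> \<in> B)"
  shows "past n (\<lambda>\<omega>. \<omega> \<in> A - B)"
  using past_compose2[OF assms, of "\<lambda>x y. x \<and> \<not> y"] by simp

lemma past_UN:
  assumes "\<And>i. i \<in> I \<Longrightarrow> past n (\<lambda>\<omega>. \<omega> \<in> A i)"
  shows "past n (\<lambda>\<omega>. \<omega> \<in> (\<Union>i\<in>I. A i))"
  unfolding past_def
proof (intro ballI impI)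
  fix \<omega> \<omega>' assume *: "\<omega> \<in> space \<Omega>" "\<omega>' \<in> space \<Omega>" "\<forall>i<n. \<omega> i = \<omega>' i"
  have "\<omega> \<in> A i \<longleftrightarrow> \<omega>' \<in> A i" if "i \<in> I" for i
    using pastD[OF assms[OF that] *(1,2)] *(3) by blast
  then show "(\<omega> \<in> (\<Union>i\<in>I. A i)) = (\<omega>' \<in> (\<Union>i\<in>I. A i))" by blast
qed

text \<open>The events that can be approximated by events of finitely many steps form a
  \<sigma>-algebra containing the one-coordinate cylinders.\<close>

lemma past_approx:
  assumes "A \<in> sets \<Omega>" "0 < e"
  shows "\<exists>n C. C \<in> sets \<Omega> \<and> past n (\<lambda>\<omega>. \<omega> \<in> C) \<and> P.prob (sym_diff A C) < e"
proof -
  let ?gen = "{{f \<in> \<Pi>\<^sub>E i\<in>UNIV. space \<mu>. f i \<in> A} | (i::nat) A. i \<in> UNIV \<and> A \<in> sets \<mu>}"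
  have sets_eq: "sets \<Omega> = sigma_sets (\<Pi>\<^sub>E i\<in>UNIV. space \<mu>) ?gen"
    by (rule sets_PiM_single)
  have sp: "space \<Omega> = (\<Pi>\<^sub>E i\<in>UNIV. space \<mu>)" by (simp add: space_PiM)
  have "A \<in> sigma_sets (\<Pi>\<^sub>E i\<in>UNIV. space \<mu>) ?gen" using assms(1) sets_eq by simp
  then show ?thesis using \<open>0 < e\<close>
  proof (induction arbitrary: e rule: sigma_sets.induct)
    case (Basic a)
    then obtain i E where a: "a = {f \<in> \<Pi>\<^sub>E i\<in>UNIV. space \<mu>. f i \<in> E}" "E \<in> sets \<mu>" by auto
    have "a \<in> sets \<Omega>" using Basic(1) unfolding sets_eq by (rule sigma_sets.Basic)
    moreover have "past (Suc i) (\<lambda>\<omega>. \<omega> \<in> a)" unfolding past_def a(1) sp by auto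
    ultimately show ?case using Basic(2) by (intro exI[of _ "Suc i"] exI[of _ a]) auto
  next
    case Empty
    then show ?case by (intro exI[of _ 0] exI[of _ "{}"]) (auto simp: past_def)
  next
    case (Compl a)
    then obtain n C where C: "C \<in> sets \<Omega>" "past n (\<lambda>\<omega>. \<omega> \<in> C)" "P.prob (sym_diff a C) < e" by blast
    have a: "a \<in> sets \<Omega>" using Compl(1) sets_eq by simp
    have "past n (\<lambda>\<omega>. \<omega> \<in> space \<Omega> - C)"
      using C(2) unfolding past_def by blast
    moreover have "sym_diff (space \<Omega> - a) (space \<Omega> - C) = sym_diff a C"
      using sets.sets_into_space[OF a] sets.sets_into_space[OF C(1)] by auto
    moreover have "space \<Omega> - C \<in> sets \<Omega>" using C(1) by auto
    ultimately show ?case unfolding sp[symmetric] using C(3)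
      by (intro exI[of _ n] exI[of _ "space \<Omega> - C"]) simp
  next
    case (Union a)
    have a [measurable]: "a i \<in> sets \<Omega>" for i using Union(1) sets_eq by simp
    have "(\<lambda>n. P.prob (\<Union>i\<le>n. a i)) \<longlonglongrightarrow> P.prob (\<Union>i. \<Union>j\<le>i. a j)"
      by (intro P.finite_Lim_measure_incseq) (auto simp: incseq_def intro: order_trans)
    moreover have "(\<Union>i. \<Union>j\<le>i. a j) = (\<Union>i. a i)" by auto
    ultimately have "(\<lambda>n. P.prob (\<Union>i\<le>n. a i)) \<longlonglongrightarrow> P.prob (\<Union>i. a i)" by simp
    from LIMSEQ_D[OF this, of "e/2"] Union(3) obtain N
      where N: "\<bar>P.prob (\<Union>i\<le>N. a i) - P.prob (\<Union>i. a i)\<bar> < e/2" by auto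
    have sub: "(\<Union>i\<le>N. a i) \<subseteq> (\<Union>i. a i)" by auto
    have diff: "P.prob ((\<Union>i. a i) - (\<Union>i\<le>N. a i)) < e/2"
    proof -
      have "P.prob ((\<Union>i. a i) - (\<Union>i\<le>N. a i)) = P.prob (\<Union>i. a i) - P.prob (\<Union>i\<le>N. a i)"
        by (intro P.finite_measure_Diff) (auto simp: sub)
      then show ?thesis using N by linarith
    qed
    \<comment> \<open>Half of e pays for cutting the union after N; the other half is shared by the
      N + 1 approximations.\<close>
    define d where "d = e / (2 * (real N + 1))"
    have "0 < d" using Union(3) by (simp add: d_def)
    then have "\<forall>i. \<exists>n C. C \<in> sets \<Omega> \<and> past n (\<lambda>\<omega>. \<omega> \<in> C) \<and> P.prob (sym_diff (a i) C) < d"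
      using Union(2) by blast
    then obtain n C where C: "\<And>i. C i \<in> sets \<Omega>" "\<And>i. past (n i) (\<lambda>\<omega>. \<omega> \<in> C i)"
      "\<And>i. P.prob (sym_diff (a i) (C i)) < d" by metis
    note [measurable] = C(1)
    define m where "m = Max (n ` {..N})"
    have "past m (\<lambda>\<omega>. \<omega> \<in> (\<Union>i\<le>N. C i))"
      by (intro past_UN past_mono[OF C(2)]) (simp add: m_def)
    moreover have "P.prob (sym_diff (\<Union>i. a i) (\<Union>i\<le>N. C i)) < e"
    proof -
      have "P.prob (sym_diff (\<Union>i. a i) (\<Union>i\<le>N. C i)) \<le>
          P.prob (((\<Union>i. a i) - (\<Union>i\<le>N. a i)) \<union> (\<Union>i\<le>N. sym_diff (a i) (C i)))"
        by (intro P.finite_measure_mono) auto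
      also have "\<dots> \<le> P.prob ((\<Union>i. a i) - (\<Union>i\<le>N. a i)) + P.prob (\<Union>i\<le>N. sym_diff (a i) (C i))"
        by (intro measure_Un_le) auto
      also have "P.prob (\<Union>i\<le>N. sym_diff (a i) (C i)) \<le> (\<Sum>i\<le>N. P.prob (sym_diff (a i) (C i)))"
        by (intro measure_UNION_le) auto
      also have "\<dots> \<le> (\<Sum>i\<le>N. d)" using C(3) by (intro sum_mono) (simp add: less_imp_le)
      also have "\<dots> = e/2" by (simp add: d_def field_simps)
      finally show ?thesis using diff by simp
    qed
    ultimately show ?case
      by (intro exI[of _ m] exI[of _ "\<Union>i\<le>N. C i"]) auto
  qed
qed

section \<open>Expected numbers of visits, by decomposition at the first and at the last
  visit\<close>

lemma first_visit_bound:
  fixes V R :: "nat \<Rightarrow> (nat \<Rightarrow> 'a) set"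
  assumes V [measurable]: "\<And>n. V n \<in> sets \<Omega>" and pV: "\<And>n. past n (\<lambda>\<omega>. \<omega> \<in> V n)"
    and R [measurable]: "\<And>n. R n \<in> sets \<Omega>"
    and VR: "\<And>m k \<omega>. \<omega> \<in> V m \<Longrightarrow> \<omega> \<in> V (m + k) \<longleftrightarrow> shift m \<omega> \<in> R k"
    and b [measurable]: "b \<in> sets \<Omega>"
    and indep: "\<And>n C. C \<in> sets \<Omega> \<Longrightarrow> past n (\<lambda>\<omega>. \<omega> \<in> C) \<Longrightarrow> C \<subseteq> V n \<Longrightarrow>
      emeasure \<Omega> (C \<inter> b) = emeasure \<Omega> C * p"
  shows "(\<Sum>n. emeasure \<Omega> (V n \<inter> b)) \<le> (\<Sum>k. emeasure \<Omega> (R k)) * emeasure \<Omega> b"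
proof -
  \<comment> \<open>\<open>D m\<close> says that the first visit happens at time m. It is decided by
    the first m steps, and later visits are returns (events \<open>R k\<close>) of the shifted
    sequence, an independent copy. So the expected number of visits is at most P(some visit) times
    the sum of the P(R k).\<close>
  define D where D_disj: "D = disjointed V"
  have D_def: "D m = V m - (\<Union>i<m. V i)" for m
    by (simp add: D_disj disjointed_def lessThan_atLeast0)
  have D [measurable]: "D m \<in> sets \<Omega>" for m by (simp add: D_def)
  have pD: "past m (\<lambda>\<omega>. \<omega> \<in> D m)" for m
    unfolding D_def by (intro past_Diff past_UN past_mono[OF pV]) auto
  have disj: "disjoint_family D"
    unfolding D_disj by (rule disjoint_family_disjointed)
  define W where "W m \<omega> = (\<Sum>k. indicator (R k) (shift m \<omega>) :: ennreal)" for m \<omega>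
  have point: "(\<Sum>n. indicator (V n) \<omega>) \<le> (\<Sum>m. indicator (D m) \<omega> * W m \<omega>)" for \<omega>
  proof (cases "\<exists>n. \<omega> \<in> V n")
    case True
    define m where "m = (LEAST n. \<omega> \<in> V n)"
    have m: "\<omega> \<in> V m" using True unfolding m_def by (rule LeastI_ex)
    have nm: "\<omega> \<notin> V i" if "i < m" for i using that not_less_Least unfolding m_def by blast
    have "(\<Sum>n. indicator (V n) \<omega>) = (\<Sum>k. indicator (V (k + m)) \<omega>) + (\<Sum>n<m. indicator (V n) \<omega> :: ennreal)"
      by (rule suminf_offset) simp
    also have "(\<Sum>n<m. indicator (V n) \<omega> :: ennreal) = 0" using nm by simp
    also have "(\<Sum>k. indicator (V (k + m)) \<omega>) = W m \<omega>"
      unfolding W_def using VR[OF m] by (intro suminf_cong) (simp add: indicator_def add.commute)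
    also have "W m \<omega> + 0 = indicator (D m) \<omega> * W m \<omega>" using m nm by (simp add: D_def)
    also have "\<dots> \<le> (\<Sum>j. indicator (D j) \<omega> * W j \<omega>)"
      using sum_le_suminf[OF summableI, of "{m}" "\<lambda>j. indicator (D j) \<omega> * W j \<omega>"]
      by (simp only: sum.insert sum.empty finite.intros empty_iff not_False_eq_True zero_le add_0_right)
    finally show ?thesis .
  next
    case False
    then have "(\<Sum>n. indicator (V n) \<omega>) = (0 :: ennreal)" by simp
    then show ?thesis by (simp only: zero_le)
  qed
  define \<Gamma> where "\<Gamma> = (\<Sum>k. emeasure \<Omega> (R k))"
  have "(\<Sum>n. emeasure \<Omega> (V n)) = (\<integral>\<^sup>+\<omega>. (\<Sum>n. indicator (V n) \<omega>) \<partial>\<Omega>)"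
    by (subst nn_integral_suminf) auto
  also have "\<dots> \<le> (\<integral>\<^sup>+\<omega>. (\<Sum>m. indicator (D m) \<omega> * W m \<omega>) \<partial>\<Omega>)"
    by (intro nn_integral_mono point)
  also have "\<dots> = (\<Sum>m. \<integral>\<^sup>+\<omega>. indicator (D m) \<omega> * W m \<omega> \<partial>\<Omega>)"
    unfolding W_def by (subst nn_integral_suminf) auto
  also have "\<dots> = (\<Sum>m. emeasure \<Omega> (D m) * \<Gamma>)"
  proof (intro suminf_cong)
    fix m
    have "past m (\<lambda>\<omega>. indicator (D m) \<omega> :: ennreal)"
      using past_compose[OF pD[of m], of of_bool] by (simp add: indicator_def of_bool_def)
    then have "(\<integral>\<^sup>+\<omega>. indicator (D m) \<omega> * W m \<omega> \<partial>\<Omega>) =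
        (\<integral>\<^sup>+\<omega>. indicator (D m) \<omega> \<partial>\<Omega>) * (\<integral>\<^sup>+\<omega>. (\<Sum>k. indicator (R k) \<omega>) \<partial>\<Omega>)"
      unfolding W_def
      using nn_integral_split_mult[of "indicator (D m)" "\<lambda>\<omega>. \<Sum>k. indicator (R k) \<omega>" m] by simp
    also have "(\<integral>\<^sup>+\<omega>. (\<Sum>k. indicator (R k) \<omega>) \<partial>\<Omega>) = \<Gamma>"
      unfolding \<Gamma>_def by (subst nn_integral_suminf) auto
    finally show "(\<integral>\<^sup>+\<omega>. indicator (D m) \<omega> * W m \<omega> \<partial>\<Omega>) = emeasure \<Omega> (D m) * \<Gamma>" by simp
  qed
  finally have le: "(\<Sum>n. emeasure \<Omega> (V n)) \<le> (\<Sum>m. emeasure \<Omega> (D m)) * \<Gamma>" by simp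
  \<comment> \<open>At every visit b has the same conditional probability p. The factor p is
    extracted from the events \<open>V n\<close> and absorbed again by the disjoint events
    \<open>D m\<close>, whose intersections with b have total mass at most P(b).\<close>
  have "(\<Sum>n. emeasure \<Omega> (V n \<inter> b)) = (\<Sum>n. emeasure \<Omega> (V n)) * p"
    using indep[OF V pV] by simp
  also have "\<dots> \<le> (\<Sum>m. emeasure \<Omega> (D m)) * \<Gamma> * p"
    using le by (rule mult_right_mono) simp
  also have "\<dots> = \<Gamma> * (\<Sum>m. emeasure \<Omega> (D m) * p)" by (simp add: ac_simps)
  also have "(\<Sum>m. emeasure \<Omega> (D m) * p) = (\<Sum>m. emeasure \<Omega> (D m \<inter> b))"
  proof (intro suminf_cong)
    show "emeasure \<Omega> (D m) * p = emeasure \<Omega> (D m \<inter> b)" for m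
      by (rule indep[OF D pD, symmetric]) (auto simp: D_def)
  qed
  also have "\<dots> = emeasure \<Omega> (\<Union>m. D m \<inter> b)"
    using disj by (intro suminf_emeasure) (auto simp: disjoint_family_on_def)
  also have "\<dots> \<le> emeasure \<Omega> b" by (intro emeasure_mono) auto
  finally show ?thesis by (simp add: \<Gamma>_def mult_left_mono)
qed

text \<open>Decomposing according to the last visit gives \<open>1 = (\<Sum>n. P (R n)) \<cdot> P (no return)\<close>.\<close>

lemma last_visit_finite:
  fixes R :: "nat \<Rightarrow> (nat \<Rightarrow> 'a) set"
  assumes R [measurable]: "\<And>n. R n \<in> sets \<Omega>" and pR: "\<And>n. past n (\<lambda>\<omega>. \<omega> \<in> R n)"
    and R0: "R 0 = space \<Omega>"
    and RR: "\<And>m k \<omega>. \<omega> \<in> R m \<Longrightarrow> \<omega> \<in> R (m + k) \<longleftrightarrow> shift m \<omega> \<in> R k"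
    and fin: "AE \<omega> in \<Omega>. finite {n. \<omega> \<in> R n}"
  shows "(\<Sum>n. emeasure \<Omega> (R n)) < \<top>"
proof -
  define NR where "NR = {\<omega> \<in> space \<Omega>. \<forall>k. \<omega> \<notin> R (Suc k)}"
  have NR [measurable]: "NR \<in> sets \<Omega>" by (simp add: NR_def)
  define L where "L n = {\<omega> \<in> space \<Omega>. \<omega> \<in> R n \<and> shift n \<omega> \<in> NR}" for n
  have L [measurable]: "L n \<in> sets \<Omega>" for n by (simp add: L_def)
  have Lalt: "\<omega> \<in> L n \<longleftrightarrow> \<omega> \<in> R n \<and> (\<forall>k>n. \<omega> \<notin> R k)" if "\<omega> \<in> space \<Omega>" for \<omega> n
  proof -
    have "(\<forall>k. shift n \<omega> \<notin> R (Suc k)) \<longleftrightarrow> (\<forall>k>n. \<omega> \<notin> R k)" if "\<omega> \<in> R n"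
      using RR[OF that] by (metis add_Suc_right less_iff_Suc_add)
    then show ?thesis using that by (auto simp: L_def NR_def)
  qed
  have disj: "disjoint_family L"
    unfolding disjoint_family_on_def
  proof (intro ballI impI)
    fix m n :: nat assume "m \<noteq> n"
    then have "m < n \<or> n < m" by linarith
    moreover have "\<omega> \<in> space \<Omega>" if "\<omega> \<in> L k" for \<omega> k using that by (simp add: L_def)
    ultimately show "L m \<inter> L n = {}" using Lalt by blast
  qed
  have "AE \<omega> in \<Omega>. \<omega> \<in> (\<Union>n. L n)"
    using fin AE_space
  proof eventually_elim
    case (elim \<omega>)
    define n where "n = Max {n. \<omega> \<in> R n}"
    have ne: "{n. \<omega> \<in> R n} \<noteq> {}" using R0 elim(2) by (metis (mono_tags) empty_iff mem_Collect_eq)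
    have "\<omega> \<in> R n" using Max_in[OF elim(1) ne] by (simp add: n_def)
    moreover have "\<omega> \<notin> R k" if "k > n" for k
      using Max_ge[OF elim(1), of k] that unfolding n_def by auto
    ultimately show ?case using Lalt[OF elim(2)] by auto
  qed
  then have "1 = emeasure \<Omega> (\<Union>n. L n)"
    by (subst P.emeasure_eq_1_AE) auto
  also have "\<dots> = (\<Sum>n. emeasure \<Omega> (L n))"
    using disj by (intro suminf_emeasure[symmetric]) auto
  also have "\<dots> = (\<Sum>n. emeasure \<Omega> (R n) * emeasure \<Omega> NR)"
    unfolding L_def using prob_split[OF R NR pR]
    by (simp add: P.emeasure_eq_measure ennreal_mult[symmetric])
  also have "\<dots> = (\<Sum>n. emeasure \<Omega> (R n)) * emeasure \<Omega> NR" by simp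
  finally have "(\<Sum>n. emeasure \<Omega> (R n)) * emeasure \<Omega> NR = 1" ..
  then show ?thesis
    by (cases "emeasure \<Omega> NR = 0") (auto simp: less_top[symmetric] ennreal_top_mult)
qed

definition visits :: "'a \<Rightarrow> nat \<Rightarrow> (nat \<Rightarrow> 'a) set" where
  "visits q n = {\<omega> \<in> space \<Omega>. pos \<omega> n = q}"

text \<open>The Green function at the identity; its finiteness is transience on the whole
  group.\<close>

definition Green :: ennreal where
  "Green = (\<Sum>n. emeasure \<Omega> (visits \<one> n))"

lemma sets_visits [measurable]: "visits q n \<in> sets \<Omega>"
proof -
  have "visits q n = (\<lambda>\<omega>. pos \<omega> n) -` ({q} \<inter> carrier G) \<inter> space \<Omega>"
    by (auto simp: visits_def)
  also have "\<dots> \<in> sets \<Omega>" by (rule measurable_sets[OF measurable_pos]) auto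
  finally show ?thesis .
qed

lemma past_visits: "past n (\<lambda>\<omega>. \<omega> \<in> visits q n)"
  unfolding past_def
proof (intro ballI impI)
  fix \<omega> \<omega>' assume *: "\<omega> \<in> space \<Omega>" "\<omega>' \<in> space \<Omega>" "\<forall>i<n. \<omega> i = \<omega>' i"
  have "pos \<omega> n = pos \<omega>' n" using pastD[OF past_pos[of n n] *(1,2)] *(3) by simp
  then show "(\<omega> \<in> visits q n) = (\<omega>' \<in> visits q n)" using * by (simp add: visits_def)
qed

lemma emeasure_visits_invariant:
  assumes A: "A \<in> invariant_events G" and "C \<in> sets \<Omega>" "past n (\<lambda>\<omega>. \<omega> \<in> C)" "C \<subseteq> visits q n"
    "q \<in> carrier G"
  shows "emeasure \<Omega> (C \<inter> ev A) = emeasure \<Omega> C * emeasure \<Omega> (ev (pull q A))"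
  using prob_past_invariant[OF A assms(2,3) _ assms(5)] assms(4)
  by (auto simp: P.emeasure_eq_measure ennreal_mult[symmetric] visits_def)

text \<open>By the Markov property an invariant event A has conditional probability
  P(\<open>ev (pull q A)\<close>) at every visit to q. This common value is the p of
  \<open>first_visit_bound\<close>.\<close>

lemma visits_bound:
  assumes A: "A \<in> invariant_events G" and q: "q \<in> carrier G"
  shows "(\<Sum>n. emeasure \<Omega> (visits q n \<inter> ev A)) \<le> Green * emeasure \<Omega> (ev A)"
  unfolding Green_def
proof (rule first_visit_bound)
  show "ev A \<in> sets \<Omega>" using A by (auto intro: invariant_sets)
  show "\<And>n C. C \<in> sets \<Omega> \<Longrightarrow> past n (\<lambda>\<omega>. \<omega> \<in> C) \<Longrightarrow> C \<subseteq> visits q n \<Longrightarrow>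
      emeasure \<Omega> (C \<inter> ev A) = emeasure \<Omega> C * emeasure \<Omega> (ev (pull q A))"
    by (rule emeasure_visits_invariant[OF A _ _ _ q])
  fix m k \<omega> assume "\<omega> \<in> visits q m"
  then have \<omega>: "\<omega> \<in> space \<Omega>" "pos \<omega> m = q" by (auto simp: visits_def)
  then show "\<omega> \<in> visits q (m + k) \<longleftrightarrow> shift m \<omega> \<in> visits \<one> k"
    using pos_shift[of \<omega> k m] q r_cancel_one[of q "pos (shift m \<omega>) k"]
    by (auto simp: visits_def add.commute)
qed (auto intro: past_visits)

end

section \<open>Conditioning on an invariant subalgebra\<close>

text \<open>Abstracts what the argument needs from the \<sigma>-algebra of the limit function. Its
  events are strictly invariant, so that \<open>ev_shift\<close> applies pointwise, and translation
  preserves it, so that conditioning can be restarted at any position.\<close>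

locale invariant_subalgebra = random_walk G \<mu>
  for G :: "('a, 'c) monoid_scheme" (structure) and \<mu> :: "'a measure" +
  fixes Bm :: "(nat \<Rightarrow> 'a) measure"
  assumes space_Bm: "space Bm = space T"
    and sets_Bm: "sets Bm \<subseteq> invariant_events G"
    and pull_Bm: "g \<in> carrier G \<Longrightarrow> B \<in> sets Bm \<Longrightarrow> pull g B \<in> sets Bm"
    and transient: "Green < \<top>"
begin

definition F :: "(nat \<Rightarrow> 'a) measure" where
  "F = vimage_algebra (space \<Omega>) path Bm"

lemma space_F [simp]: "space F = space \<Omega>"
  by (simp add: F_def)

lemma Bm_T: "B \<in> sets Bm \<Longrightarrow> B \<in> sets T"
  using sets_Bm invariant_sets by auto

lemma sets_F: "sets F = ev ` sets Bm"
proof -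
  have "path \<in> space \<Omega> \<rightarrow> space Bm" by (simp add: space_Bm)
  then have "sets F = {path -` A \<inter> space \<Omega> | A. A \<in> sets Bm}"
    unfolding F_def by (rule sets_vimage_algebra2)
  also have "\<dots> = ev ` sets Bm" unfolding ev_def by (auto simp: image_def vimage_def Int_def conj_commute)
  finally show ?thesis .
qed

lemma subalgebra_F: "subalgebra \<Omega> F"
  unfolding subalgebra_def by (auto simp: sets_F intro: Bm_T)

sublocale FS: finite_measure_subalgebra \<Omega> F
  by unfold_locales (rule subalgebra_F)

definition cp :: "(nat \<Rightarrow> 'a) set \<Rightarrow> (nat \<Rightarrow> 'a) \<Rightarrow> real" where
  "cp A = real_cond_exp \<Omega> F (indicator (ev A))"

text \<open>Conditional expected number of visits, rather than conditional probability of a visit: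
  it is additive over times, which turns the counting in \<open>sum_prob_small_U_le\<close> into an
  exchange of sums.\<close>

definition U :: "'a \<Rightarrow> (nat \<Rightarrow> 'a) \<Rightarrow> ennreal" where
  "U q = nn_cond_exp \<Omega> F (\<lambda>\<omega>. \<Sum>n. indicator (visits q n) \<omega>)"

lemma measurable_cp [measurable]: "cp A \<in> borel_measurable F" "cp A \<in> borel_measurable \<Omega>"
  by (simp_all add: cp_def)

lemma measurable_U [measurable]: "U q \<in> borel_measurable F" "U q \<in> borel_measurable \<Omega>"
  by (simp_all add: U_def)

lemma integrable_ind [simp]: "A \<in> sets T \<Longrightarrow> integrable \<Omega> (indicator (ev A) :: _ \<Rightarrow> real)"
  by (rule integrable_real_indicator) (auto simp: P.emeasure_eq_measure)

lemma cp_bounds: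
  assumes A [measurable]: "A \<in> sets T"
  shows "AE \<omega> in \<Omega>. 0 \<le> cp A \<omega> \<and> cp A \<omega> \<le> 1"
proof -
  have "AE \<omega> in \<Omega>. 0 \<le> cp A \<omega>"
    unfolding cp_def by (rule FS.real_cond_exp_pos) (simp_all add: A sets_ev borel_measurable_indicator)
  moreover have "AE \<omega> in \<Omega>. cp A \<omega> \<le> 1"
    unfolding cp_def using A by (intro FS.real_cond_exp_le_c integrable_ind) (auto split: split_indicator)
  ultimately show ?thesis by auto
qed

lemma integrable_bounded:
  assumes [measurable]: "f \<in> borel_measurable \<Omega>" and "AE \<omega> in \<Omega>. \<bar>f \<omega>\<bar> \<le> c"
  shows "integrable \<Omega> (f :: _ \<Rightarrow> real)"
  using assms(2) by (intro P.integrable_const_bound[where B = c]) auto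

lemma integrable_cp [simp]: "A \<in> sets T \<Longrightarrow> integrable \<Omega> (cp A)"
  unfolding cp_def by (intro FS.real_cond_exp_int integrable_ind)

lemma cp_int:
  assumes "A \<in> sets T" "D \<in> sets F"
  shows "(\<integral>\<omega>. indicator D \<omega> * cp A \<omega> \<partial>\<Omega>) = P.prob (ev A \<inter> D)"
proof -
  have D: "D \<in> sets \<Omega>" using assms(2) subalgebra_F by (auto simp: subalgebra_def)
  note [measurable] = D sets_ev[OF assms(1)]
  have "(\<integral>\<omega>. indicator D \<omega> * cp A \<omega> \<partial>\<Omega>) = (\<integral>\<omega>. indicator D \<omega> * indicator (ev A) \<omega> \<partial>\<Omega>)"
    unfolding cp_def
  proof (rule FS.real_cond_exp_intg(2))
    show "integrable \<Omega> (\<lambda>\<omega>. indicator D \<omega> * indicator (ev A) \<omega> :: real)"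
      using assms D by (intro integrable_bounded[where c = 1]) (auto split: split_indicator)
  qed (use assms in auto)
  also have "\<dots> = (\<integral>\<omega>. indicator (ev A \<inter> D) \<omega> \<partial>\<Omega>)"
    by (rule Bochner_Integration.integral_cong) (auto split: split_indicator)
  also have "\<dots> = P.prob (ev A \<inter> D)"
    using assms D by (subst Bochner_Integration.integral_indicator) (auto simp: P.emeasure_eq_measure)
  finally show ?thesis .
qed

lemma U_int:
  assumes [measurable]: "D \<in> sets F"
  shows "(\<integral>\<^sup>+\<omega>. indicator D \<omega> * U q \<omega> \<partial>\<Omega>) = (\<Sum>n. emeasure \<Omega> (visits q n \<inter> D))"
proof -
  have D [measurable]: "D \<in> sets \<Omega>" using assms subalgebra_F by (auto simp: subalgebra_def)
  have "(\<integral>\<^sup>+\<omega>. indicator D \<omega> * U q \<omega> \<partial>\<Omega>) =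
      (\<integral>\<^sup>+\<omega>. indicator D \<omega> * (\<Sum>n. indicator (visits q n) \<omega>) \<partial>\<Omega>)"
    unfolding U_def by (rule FS.nn_cond_exp_intg) auto
  also have "\<dots> = (\<integral>\<^sup>+\<omega>. (\<Sum>n. indicator (visits q n \<inter> D) \<omega>) \<partial>\<Omega>)"
    by (intro nn_integral_cong, subst ennreal_suminf_cmult[symmetric])
      (auto intro!: suminf_cong split: split_indicator)
  also have "\<dots> = (\<Sum>n. emeasure \<Omega> (visits q n \<inter> D))"
    by (subst nn_integral_suminf) auto
  finally show ?thesis .
qed

lemma space_T_invariant: "space T \<in> invariant_events G"
  by (rule invariant_eventI[OF sets.top]) (auto simp: space_T)

lemma ev_Int: "ev (A \<inter> B) = ev A \<inter> ev B"
  by (auto simp: ev_def)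

text \<open>Let V be the expected number of visits to q. On an invariant event D the expected number
  of visits is V P(pull q D), and it is at most Green P(D). For D = A \<inter> B this gives V P(pull
  q (A \<inter> B)) \<le> Green \<delta>' P(B), as \<open>cp A\<close> is at most \<delta>' on B.
  Integrating \<open>U q\<close> over B gives \<delta> P(B) \<le> V P(pull q B). Combine and cancel
  V, which is positive because q is visited with positive probability at time n.\<close>

lemma cond_small:
  assumes A: "A \<in> invariant_events G" and q: "q \<in> carrier G" and B: "B \<in> sets Bm"
    and \<delta>: "0 < \<delta>" "0 \<le> \<delta>'" "\<And>\<omega>. \<omega> \<in> ev B \<Longrightarrow> ennreal \<delta> \<le> U q \<omega>" "\<And>\<omega>. \<omega> \<in> ev B \<Longrightarrow> cp A \<omega> \<le> \<delta>'"
    and pos: "0 < emeasure \<Omega> (visits q n)"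
  shows "\<delta> * P.prob (ev (pull q (A \<inter> B))) \<le> enn2real Green * \<delta>' * P.prob (ev (pull q B))"
proof -
  have Binv: "B \<in> invariant_events G" using B sets_Bm by auto
  have AT: "A \<in> sets T" "B \<in> sets T" using A Binv by (auto intro: invariant_sets)
  have evB: "ev B \<in> sets F" using B by (simp add: sets_F)
  define V where "V = (\<Sum>n. emeasure \<Omega> (visits q n))"
  have sp: "ev (space T) = space \<Omega>" by (auto simp: ev_def)
  have vsp: "visits q n \<inter> space \<Omega> = visits q n" for n by (auto simp: visits_def)
  have "V \<le> Green" using visits_bound[OF space_T_invariant q]
    by (simp add: V_def sp vsp P.emeasure_space_1)
  then obtain v where v: "V = ennreal v" "0 \<le> v" using transient
    by (cases V) (auto simp: top_unique)
  have "emeasure \<Omega> (visits q n) \<le> V"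
    unfolding V_def using sum_le_suminf[OF summableI, of "{n}" "\<lambda>n. emeasure \<Omega> (visits q n)"] by simp
  with pos v have v0: "0 < v" by (metis ennreal_less_zero_iff less_le_trans not_less)
  define g where "g = enn2real Green"
  have g: "Green = ennreal g" using transient by (simp add: g_def)
  have g0: "0 \<le> g" by (simp add: g_def)
  have fact: "(\<Sum>n. emeasure \<Omega> (visits q n \<inter> ev D)) = V * emeasure \<Omega> (ev (pull q D))"
    if "D \<in> invariant_events G" for D
    using emeasure_visits_invariant[OF that sets_visits past_visits order_refl q] by (simp add: V_def)
  have "V * emeasure \<Omega> (ev (pull q (A \<inter> B))) \<le> Green * emeasure \<Omega> (ev (A \<inter> B))"
    using visits_bound[OF invariant_Int[OF A Binv] q] fact[OF invariant_Int[OF A Binv]] by simp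
  then have 1: "v * P.prob (ev (pull q (A \<inter> B))) \<le> g * P.prob (ev A \<inter> ev B)"
    using v0 by (simp add: v g P.emeasure_eq_measure ennreal_mult[symmetric] ev_Int g0)
  have 2: "P.prob (ev A \<inter> ev B) \<le> \<delta>' * P.prob (ev B)"
  proof -
    have "P.prob (ev A \<inter> ev B) = (\<integral>\<omega>. indicator (ev B) \<omega> * cp A \<omega> \<partial>\<Omega>)"
      using cp_int[OF AT(1) evB] by simp
    also have "\<dots> \<le> (\<integral>\<omega>. \<delta>' * indicator (ev B) \<omega> \<partial>\<Omega>)"
    proof (rule integral_mono)
      show "integrable \<Omega> (\<lambda>\<omega>. indicator (ev B) \<omega> * cp A \<omega>)"
        using integrable_mult_indicator[of "ev B" \<Omega> "cp A"] AT by auto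
    qed (use AT \<delta>(4) in \<open>auto split: split_indicator\<close>)
    also have "\<dots> = \<delta>' * P.prob (ev B)" using AT by (simp add: P.emeasure_eq_measure)
    finally show ?thesis .
  qed
  have 3: "\<delta> * P.prob (ev B) \<le> v * P.prob (ev (pull q B))"
  proof -
    have "ennreal \<delta> * emeasure \<Omega> (ev B) = (\<integral>\<^sup>+\<omega>. ennreal \<delta> * indicator (ev B) \<omega> \<partial>\<Omega>)"
      using AT by (simp add: nn_integral_cmult_indicator sets_ev)
    also have "\<dots> \<le> (\<integral>\<^sup>+\<omega>. indicator (ev B) \<omega> * U q \<omega> \<partial>\<Omega>)"
      by (intro nn_integral_mono) (auto split: split_indicator intro: \<delta>(3))
    also have "\<dots> = V * emeasure \<Omega> (ev (pull q B))"
      using U_int[OF evB] fact[OF Binv] by simp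
    finally show ?thesis
      using \<delta>(1) v0 by (simp add: v P.emeasure_eq_measure ennreal_mult[symmetric])
  qed
  have "v * (\<delta> * P.prob (ev (pull q (A \<inter> B)))) \<le> v * (g * \<delta>' * P.prob (ev (pull q B)))"
  proof -
    have "v * (\<delta> * P.prob (ev (pull q (A \<inter> B)))) = \<delta> * (v * P.prob (ev (pull q (A \<inter> B))))" by simp
    also have "\<dots> \<le> \<delta> * (g * (\<delta>' * P.prob (ev B)))"
      using order_trans[OF 1 mult_left_mono[OF 2 g0]] \<delta>(1) by (intro mult_left_mono) auto
    also have "\<dots> = g * \<delta>' * (\<delta> * P.prob (ev B))" by simp
    also have "\<dots> \<le> g * \<delta>' * (v * P.prob (ev (pull q B)))"
      using 3 g0 \<delta>(2) by (intro mult_left_mono) auto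
    finally show ?thesis by (simp add: ac_simps)
  qed
  then show ?thesis using v0 by (simp add: g_def)
qed

lemma emeasure_split_pos:
  assumes [measurable]: "Z \<in> sets \<Omega>"
  shows "emeasure \<Omega> Z = (\<integral>\<^sup>+q. emeasure \<Omega> (Z \<inter> visits q n) \<partial>count_space (carrier G))"
proof -
  have "Z = (\<Union>q\<in>carrier G. Z \<inter> visits q n)"
    using sets.sets_into_space[OF assms] by (auto simp: visits_def)
  then have "emeasure \<Omega> Z = emeasure \<Omega> (\<Union>q\<in>carrier G. Z \<inter> visits q n)" by simp
  also have "\<dots> = (\<integral>\<^sup>+q. emeasure \<Omega> (Z \<inter> visits q n) \<partial>count_space (carrier G))"
    by (intro emeasure_UN_countable countable_carrier)
      (auto simp: disjoint_family_on_def visits_def)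
  finally show ?thesis .
qed

lemma sets_pos_dep:
  assumes [measurable]: "\<And>q. q \<in> carrier G \<Longrightarrow> Z q \<in> sets \<Omega>"
  shows "{\<omega> \<in> space \<Omega>. \<omega> \<in> Z (pos \<omega> n)} \<in> sets \<Omega>"
proof -
  have "{\<omega> \<in> space \<Omega>. \<omega> \<in> Z (pos \<omega> n)} = (\<Union>q\<in>carrier G. Z q \<inter> visits q n)"
    by (auto simp: visits_def)
  also have "\<dots> \<in> sets \<Omega>"
    by (intro sets.countable_UN'' countable_carrier) auto
  finally show ?thesis .
qed

text \<open>Split C by the position q at time n. The sets where \<open>cp A\<close> is small and
  \<open>U q\<close> is large belong to \<open>F\<close>, so they come from events
  \<open>B q\<close> of \<open>Bm\<close> to which \<open>cond_small\<close> applies; once the walk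
  is at q, the event C has no further influence.\<close>

lemma small_given_past:
  assumes A: "A \<in> invariant_events G" and [measurable]: "C \<in> sets \<Omega>" and past: "past n (\<lambda>\<omega>. \<omega> \<in> C)"
    and \<delta>: "0 < \<delta>" "0 \<le> \<delta>'"
  shows "\<delta> * P.prob {\<omega> \<in> C. \<omega> \<in> ev A \<and> cp A \<omega> < \<delta>' \<and> ennreal \<delta> < U (pos \<omega> n) \<omega>}
    \<le> enn2real Green * \<delta>' * P.prob C"
proof -
  define g where "g = enn2real Green"
  define B where "B q = (SOME B. B \<in> sets Bm \<and> ev B = {\<omega> \<in> space \<Omega>. cp A \<omega> < \<delta>' \<and> ennreal \<delta> < U q \<omega>})" for q
  have B: "B q \<in> sets Bm \<and> ev (B q) = {\<omega> \<in> space \<Omega>. cp A \<omega> < \<delta>' \<and> ennreal \<delta> < U q \<omega>}" for q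
  proof -
    have "{\<omega> \<in> space F. cp A \<omega> < \<delta>' \<and> ennreal \<delta> < U q \<omega>} \<in> sets F" by measurable
    then have "\<exists>B. B \<in> sets Bm \<and> ev B = {\<omega> \<in> space \<Omega>. cp A \<omega> < \<delta>' \<and> ennreal \<delta> < U q \<omega>}"
      by (auto simp: sets_F)
    then show ?thesis unfolding B_def by (rule someI_ex)
  qed
  have AT [measurable]: "A \<in> sets T" "B q \<in> sets T" for q using A B by (auto intro: invariant_sets Bm_T)
  let ?S = "{\<omega> \<in> C. \<omega> \<in> ev A \<and> cp A \<omega> < \<delta>' \<and> ennreal \<delta> < U (pos \<omega> n) \<omega>}"
  have Csp: "C \<subseteq> space \<Omega>" using sets.sets_into_space[OF assms(2)] by auto
  have S_eq: "?S = {\<omega> \<in> space \<Omega>. \<omega> \<in> (C \<inter> ev (A \<inter> B (pos \<omega> n)))}"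
    unfolding ev_Int using B Csp by auto
  have Sm [measurable]: "?S \<in> sets \<Omega>"
    unfolding S_eq by (rule sets_pos_dep) auto
  have le: "ennreal \<delta> * emeasure \<Omega> (?S \<inter> visits q n) \<le> ennreal (g * \<delta>') * emeasure \<Omega> (C \<inter> visits q n)"
    if q: "q \<in> carrier G" for q
  \<comment> \<open>\<open>cond_small\<close> requires that q can be reached at time n; otherwise
    the left side vanishes.\<close>
  proof (cases "emeasure \<Omega> (visits q n) = 0")
    case True
    have "emeasure \<Omega> (?S \<inter> visits q n) \<le> emeasure \<Omega> (visits q n)" by (intro emeasure_mono) auto
    then show ?thesis using True by simp
  next
    case False
    have Binv: "A \<inter> B q \<in> invariant_events G" using A B sets_Bm by (intro invariant_Int) auto
    have pC: "past n (\<lambda>\<omega>. \<omega> \<in> C \<inter> visits q n)"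
      using past_compose2[OF past past_visits, of "(\<and>)" q] by simp
    have "\<delta> * P.prob (ev (pull q (A \<inter> B q))) \<le> g * \<delta>' * P.prob (ev (pull q (B q)))"
      unfolding g_def using B False by (intro cond_small[OF A q _ \<delta>, where n = n]) (auto simp: zero_less_iff_neq_zero)
    also have "\<dots> \<le> g * \<delta>' * 1" using \<delta>(2) by (intro mult_left_mono) (auto simp: g_def)
    finally have *: "\<delta> * P.prob (ev (pull q (A \<inter> B q))) \<le> g * \<delta>'" by simp
    have "?S \<inter> visits q n = (C \<inter> visits q n) \<inter> ev (A \<inter> B q)"
      unfolding S_eq by (auto simp: visits_def)
    then have "emeasure \<Omega> (?S \<inter> visits q n) = emeasure \<Omega> (C \<inter> visits q n) * emeasure \<Omega> (ev (pull q (A \<inter> B q)))"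
      using emeasure_visits_invariant[OF Binv _ pC _ q] by simp
    then have "ennreal \<delta> * emeasure \<Omega> (?S \<inter> visits q n) =
        ennreal (P.prob (C \<inter> visits q n) * (\<delta> * P.prob (ev (pull q (A \<inter> B q)))))"
      using \<delta>(1) by (simp add: P.emeasure_eq_measure ennreal_mult[symmetric] ac_simps)
    also have "\<dots> \<le> ennreal (P.prob (C \<inter> visits q n) * (g * \<delta>'))"
      using * by (intro ennreal_leI mult_left_mono) auto
    also have "\<dots> = ennreal (g * \<delta>') * emeasure \<Omega> (C \<inter> visits q n)"
      using \<delta>(2) by (simp add: P.emeasure_eq_measure ennreal_mult[symmetric] ac_simps g_def)
    finally show ?thesis .
  qed
  have "ennreal \<delta> * emeasure \<Omega> ?S = (\<integral>\<^sup>+q. ennreal \<delta> * emeasure \<Omega> (?S \<inter> visits q n) \<partial>count_space (carrier G))"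
    by (subst emeasure_split_pos[OF Sm, of n]) (simp add: nn_integral_cmult)
  also have "\<dots> \<le> (\<integral>\<^sup>+q. ennreal (g * \<delta>') * emeasure \<Omega> (C \<inter> visits q n) \<partial>count_space (carrier G))"
    by (intro nn_integral_mono le) simp
  also have "\<dots> = ennreal (g * \<delta>') * emeasure \<Omega> C"
    by (subst emeasure_split_pos[of C n]) (simp_all add: nn_integral_cmult)
  finally show ?thesis
    using \<delta> by (simp add: P.emeasure_eq_measure ennreal_mult[symmetric] g_def)
qed

text \<open>Exchange the sum over times with the sum over positions: the expected time spent at
  positions q of the strip with \<open>U q\<close> at most \<delta> is the integral of the sum of
  \<open>U q\<close> over these q, of which there are at most k.\<close>

lemma sum_prob_small_U_le:
  assumes Q: "\<And>q. q \<in> carrier G \<Longrightarrow> Q q \<in> sets Bm"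
    and fin: "\<And>x. x \<in> space T \<Longrightarrow> finite {q \<in> carrier G. x \<in> Q q}"
    and card: "\<And>x. x \<in> space T \<Longrightarrow> real (card {q \<in> carrier G. x \<in> Q q}) \<le> k"
    and \<delta>: "0 \<le> \<delta>"
  shows "(\<Sum>n<N. P.prob {\<omega> \<in> space \<Omega>. path \<omega> \<in> Q (pos \<omega> n) \<and> U (pos \<omega> n) \<omega> \<le> ennreal \<delta>}) \<le> \<delta> * k"
proof -
  define D where "D q = {\<omega> \<in> space \<Omega>. path \<omega> \<in> Q q \<and> U q \<omega> \<le> ennreal \<delta>}" for q
  have DF: "D q \<in> sets F" if q: "q \<in> carrier G" for q
  proof -
    have "ev (Q q) \<in> sets F" using Q[OF q] by (simp add: sets_F)
    moreover have "{\<omega> \<in> space F. U q \<omega> \<le> ennreal \<delta>} \<in> sets F" by measurable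
    moreover have "D q = ev (Q q) \<inter> {\<omega> \<in> space F. U q \<omega> \<le> ennreal \<delta>}"
      by (auto simp: D_def ev_def)
    ultimately show ?thesis by auto
  qed
  have D\<Omega>: "D q \<in> sets \<Omega>" if "q \<in> carrier G" for q
    using DF[OF that] subalgebra_F by (auto simp: subalgebra_def)
  have k: "0 \<le> k"
  proof -
    have "path (\<lambda>_. \<one>) \<in> space T" by (rule path_space) (simp add: space_\<Omega>)
    from card[OF this] show ?thesis using of_nat_0_le_iff order_trans by blast
  qed
  let ?E = "\<lambda>n. {\<omega> \<in> space \<Omega>. \<omega> \<in> D (pos \<omega> n)}"
  have E [measurable]: "?E n \<in> sets \<Omega>" for n by (rule sets_pos_dep[OF D\<Omega>])
  have "(\<Sum>n<N. emeasure \<Omega> (?E n)) \<le> (\<Sum>n. emeasure \<Omega> (?E n))"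
    by (rule sum_le_suminf) auto
  also have "\<dots> = (\<Sum>n. \<integral>\<^sup>+q. emeasure \<Omega> (visits q n \<inter> D q) \<partial>count_space (carrier G))"
  proof (intro suminf_cong)
    fix n
    have "emeasure \<Omega> (?E n) = (\<integral>\<^sup>+q. emeasure \<Omega> (?E n \<inter> visits q n) \<partial>count_space (carrier G))"
      by (rule emeasure_split_pos[OF E])
    also have "\<dots> = (\<integral>\<^sup>+q. emeasure \<Omega> (visits q n \<inter> D q) \<partial>count_space (carrier G))"
      by (intro nn_integral_cong arg_cong[where f = "emeasure \<Omega>"]) (auto simp: visits_def)
    finally show "emeasure \<Omega> (?E n) = (\<integral>\<^sup>+q. emeasure \<Omega> (visits q n \<inter> D q) \<partial>count_space (carrier G))" .
  qed
  also have "\<dots> = (\<integral>\<^sup>+q. (\<Sum>n. emeasure \<Omega> (visits q n \<inter> D q)) \<partial>count_space (carrier G))"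
    by (rule nn_integral_suminf[symmetric]) simp
  also have "\<dots> = (\<integral>\<^sup>+q. (\<integral>\<^sup>+\<omega>. indicator (D q) \<omega> * U q \<omega> \<partial>\<Omega>) \<partial>count_space (carrier G))"
    by (intro nn_integral_cong U_int[symmetric] DF) simp
  also have "\<dots> \<le> (\<integral>\<^sup>+q. (\<integral>\<^sup>+\<omega>. ennreal \<delta> * indicator (ev (Q q)) \<omega> \<partial>\<Omega>) \<partial>count_space (carrier G))"
    by (intro nn_integral_mono) (auto simp: D_def ev_def split: split_indicator)
  also have "\<dots> = (\<integral>\<^sup>+\<omega>. (\<integral>\<^sup>+q. ennreal \<delta> * indicator (ev (Q q)) \<omega> \<partial>count_space (carrier G)) \<partial>\<Omega>)"
    by (rule nn_integral_count_space_nn_integral[symmetric, OF countable_carrier])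
      (auto intro!: borel_measurable_times_ennreal borel_measurable_indicator sets_ev Bm_T Q)
  also have "\<dots> \<le> (\<integral>\<^sup>+\<omega>. ennreal (\<delta> * k) \<partial>\<Omega>)"
  proof (rule nn_integral_mono)
    fix \<omega> assume \<omega>: "\<omega> \<in> space \<Omega>"
    let ?J = "{q \<in> carrier G. path \<omega> \<in> Q q}"
    have "(\<integral>\<^sup>+q. ennreal \<delta> * indicator (ev (Q q)) \<omega> \<partial>count_space (carrier G)) =
        ennreal \<delta> * (\<integral>\<^sup>+q. indicator ?J q \<partial>count_space (carrier G))"
      by (subst nn_integral_cmult[symmetric], simp)
        (auto intro!: nn_integral_cong simp: ev_def \<omega> split: split_indicator)
    also have "(\<integral>\<^sup>+q. indicator ?J q \<partial>count_space (carrier G)) = emeasure (count_space (carrier G)) ?J"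
      by (rule nn_integral_indicator) auto
    also have "\<dots> = ennreal (real (card ?J))"
      using fin[of "path \<omega>"] \<omega> by (subst emeasure_count_space_finite) (auto simp: ennreal_of_nat_eq_real_of_nat)
    also have "ennreal \<delta> * \<dots> \<le> ennreal (\<delta> * k)"
      using card[of "path \<omega>"] \<omega> \<delta> by (subst ennreal_mult[symmetric]) (auto intro!: ennreal_leI mult_left_mono)
    finally show "(\<integral>\<^sup>+q. ennreal \<delta> * indicator (ev (Q q)) \<omega> \<partial>count_space (carrier G)) \<le> ennreal (\<delta> * k)" .
  qed
  also have "\<dots> = ennreal (\<delta> * k)" by (simp add: P.emeasure_space_1)
  finally have "ennreal (\<Sum>n<N. P.prob (?E n)) \<le> ennreal (\<delta> * k)"
    by (simp add: P.emeasure_eq_measure sum_ennreal)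
  then have "(\<Sum>n<N. P.prob (?E n)) \<le> \<delta> * k"
    using \<delta> k by (simp add: ennreal_le_iff)
  moreover have "?E n = {\<omega> \<in> space \<Omega>. path \<omega> \<in> Q (pos \<omega> n) \<and> U (pos \<omega> n) \<omega> \<le> ennreal \<delta>}" for n
    by (auto simp: D_def)
  ultimately show ?thesis by simp
qed

end

text \<open>The size of the strip is linear in the number of times considered, and this is what the
  visit count needs: N + 1 times spread over K (N + 1) elements leave a typical element a share
  bounded below. The strip may change with N.\<close>

locale strip = invariant_subalgebra G \<mu> Bm
  for G :: "('a, 'c) monoid_scheme" (structure) and \<mu> :: "'a measure" and Bm +
  assumes strip: "0 < \<epsilon> \<Longrightarrow> \<exists>K. \<forall>N. \<exists>Q. (\<forall>q\<in>carrier G. Q q \<in> sets Bm) \<and>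
    (\<forall>x\<in>space T. finite {q \<in> carrier G. x \<in> Q q} \<and> real (card {q \<in> carrier G. x \<in> Q q}) \<le> K * real (Suc N)) \<and>
    (\<Sum>n<Suc N. P.prob {\<omega> \<in> space \<Omega>. path \<omega> \<notin> Q (pos \<omega> n)}) \<le> \<epsilon> * real (Suc N)"
begin

lemma measurable_U_pos [measurable]: "(\<lambda>\<omega>. U (pos \<omega> n) \<omega>) \<in> borel_measurable \<Omega>"
  by (rule measurable_compose_countable'[where I = "carrier G"]) (auto simp: countable_carrier)

lemma average_U:
  assumes "0 < \<epsilon>"
  shows "\<exists>\<delta>>0. \<forall>N. (\<Sum>n<Suc N. P.prob {\<omega> \<in> space \<Omega>. U (pos \<omega> n) \<omega> \<le> ennreal \<delta>}) \<le> \<epsilon> * real (Suc N)"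
proof -
  obtain K where K: "\<forall>N. \<exists>Q. (\<forall>q\<in>carrier G. Q q \<in> sets Bm) \<and>
    (\<forall>x\<in>space T. finite {q \<in> carrier G. x \<in> Q q} \<and> real (card {q \<in> carrier G. x \<in> Q q}) \<le> K * real (Suc N)) \<and>
    (\<Sum>n<Suc N. P.prob {\<omega> \<in> space \<Omega>. path \<omega> \<notin> Q (pos \<omega> n)}) \<le> \<epsilon> / 2 * real (Suc N)"
    using strip[of "\<epsilon> / 2"] assms by auto
  \<comment> \<open>Makes \<delta> K at most half of \<epsilon>; the absolute value and the added 1
    keep \<delta> positive for every real K.\<close>
  define \<delta> where "\<delta> = \<epsilon> / (2 * (\<bar>K\<bar> + 1))"
  have \<delta>: "0 < \<delta>" using assms by (simp add: \<delta>_def)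
  have \<delta>K: "\<delta> * K \<le> \<epsilon> / 2"
  proof -
    have "\<delta> * K \<le> \<delta> * (\<bar>K\<bar> + 1)" using \<delta> by (intro mult_left_mono) auto
    also have "\<dots> = \<epsilon> / 2" by (simp add: \<delta>_def field_simps)
    finally show ?thesis .
  qed
  have "(\<Sum>n<Suc N. P.prob {\<omega> \<in> space \<Omega>. U (pos \<omega> n) \<omega> \<le> ennreal \<delta>}) \<le> \<epsilon> * real (Suc N)" for N
  proof -
    from spec[OF K, of N] obtain Q where Q0: "\<forall>q\<in>carrier G. Q q \<in> sets Bm"
      "\<forall>x\<in>space T. finite {q \<in> carrier G. x \<in> Q q} \<and> real (card {q \<in> carrier G. x \<in> Q q}) \<le> K * real (Suc N)"
      and Q4: "(\<Sum>n<Suc N. P.prob {\<omega> \<in> space \<Omega>. path \<omega> \<notin> Q (pos \<omega> n)}) \<le> \<epsilon> / 2 * real (Suc N)"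
      by (elim exE conjE)
    have Q: "\<And>q. q \<in> carrier G \<Longrightarrow> Q q \<in> sets Bm"
      "\<And>x. x \<in> space T \<Longrightarrow> finite {q \<in> carrier G. x \<in> Q q}"
      "\<And>x. x \<in> space T \<Longrightarrow> real (card {q \<in> carrier G. x \<in> Q q}) \<le> K * real (Suc N)"
      using Q0 by simp_all
    have Qev: "ev (Q q) \<in> sets \<Omega>" if "q \<in> carrier G" for q
      using Q(1)[OF that] by (intro sets_ev Bm_T)
    have [measurable]: "{\<omega> \<in> space \<Omega>. path \<omega> \<in> Q (pos \<omega> n)} \<in> sets \<Omega>" for n
    proof -
      have "{\<omega> \<in> space \<Omega>. path \<omega> \<in> Q (pos \<omega> n)} = {\<omega> \<in> space \<Omega>. \<omega> \<in> ev (Q (pos \<omega> n))}"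
        by (auto simp: ev_def)
      then show ?thesis using sets_pos_dep[OF Qev] by simp
    qed
    have "P.prob {\<omega> \<in> space \<Omega>. U (pos \<omega> n) \<omega> \<le> ennreal \<delta>} \<le>
        P.prob {\<omega> \<in> space \<Omega>. path \<omega> \<notin> Q (pos \<omega> n)} +
        P.prob {\<omega> \<in> space \<Omega>. path \<omega> \<in> Q (pos \<omega> n) \<and> U (pos \<omega> n) \<omega> \<le> ennreal \<delta>}" for n
    proof -
      have "P.prob {\<omega> \<in> space \<Omega>. U (pos \<omega> n) \<omega> \<le> ennreal \<delta>} \<le>
          P.prob ({\<omega> \<in> space \<Omega>. path \<omega> \<notin> Q (pos \<omega> n)} \<union>
            {\<omega> \<in> space \<Omega>. path \<omega> \<in> Q (pos \<omega> n) \<and> U (pos \<omega> n) \<omega> \<le> ennreal \<delta>})"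
        by (rule P.finite_measure_mono) auto
      also have "\<dots> \<le> P.prob {\<omega> \<in> space \<Omega>. path \<omega> \<notin> Q (pos \<omega> n)} +
          P.prob {\<omega> \<in> space \<Omega>. path \<omega> \<in> Q (pos \<omega> n) \<and> U (pos \<omega> n) \<omega> \<le> ennreal \<delta>}"
        by (rule measure_Un_le) auto
      finally show ?thesis .
    qed
    then have "(\<Sum>n<Suc N. P.prob {\<omega> \<in> space \<Omega>. U (pos \<omega> n) \<omega> \<le> ennreal \<delta>}) \<le>
        (\<Sum>n<Suc N. P.prob {\<omega> \<in> space \<Omega>. path \<omega> \<notin> Q (pos \<omega> n)} +
          P.prob {\<omega> \<in> space \<Omega>. path \<omega> \<in> Q (pos \<omega> n) \<and> U (pos \<omega> n) \<omega> \<le> ennreal \<delta>})"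
      by (intro sum_mono)
    also have "\<dots> \<le> \<epsilon> / 2 * real (Suc N) + \<delta> * (K * real (Suc N))"
      unfolding sum.distrib using Q4 sum_prob_small_U_le[OF Q(1,2,3), of \<delta> "Suc N"] \<delta>
      by (intro add_mono) auto
    also have "\<dots> \<le> \<epsilon> / 2 * real (Suc N) + \<epsilon> / 2 * real (Suc N)"
      unfolding mult.assoc[symmetric, of \<delta>]
      by (intro add_left_mono mult_right_mono[OF \<delta>K of_nat_0_le_iff])
    also have "\<dots> = \<epsilon> * real (Suc N)" by simp
    finally show ?thesis .
  qed
  then show ?thesis using \<delta> by blast
qed

text \<open>The bound is uniform over all finite partitions into invariant events: conditionally on the
  subalgebra, almost every trajectory lies in an atom of the invariant \<open>\<sigma>\<close>-algebra.\<close>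

lemma partition_atoms:
  assumes "0 < \<epsilon>"
  shows "\<exists>\<delta>>0. \<forall>A I. finite (I :: nat set) \<longrightarrow> (\<forall>i\<in>I. A i \<in> invariant_events G) \<longrightarrow>
    disjoint_family_on A I \<longrightarrow>
    (\<Sum>i\<in>I. P.prob {\<omega> \<in> ev (A i). cp (A i) \<omega> < \<delta>}) \<le> \<epsilon>"
proof -
  obtain \<delta> where \<delta>: "0 < \<delta>"
    "\<And>N. (\<Sum>n<Suc N. P.prob {\<omega> \<in> space \<Omega>. U (pos \<omega> n) \<omega> \<le> ennreal \<delta>}) \<le> \<epsilon> / 8 * real (Suc N)"
    using average_U[of "\<epsilon> / 8"] assms by auto
  define g where "g = enn2real Green"
  have g: "0 \<le> g" by (simp add: g_def)
  \<comment> \<open>The errors will add up to \<epsilon> / 4 + \<eta> + \<eta> (1 + \<eta>), which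
    this choice keeps below \<epsilon>.\<close>
  define \<eta> where "\<eta> = min 1 \<epsilon> / 4"
  have \<eta>: "0 < \<eta>" "\<eta> \<le> \<epsilon> / 4" "\<eta> \<le> 1 / 4" using assms by (auto simp: \<eta>_def)
  \<comment> \<open>Turns the bound of \<open>small_given_past\<close> into \<eta> P(C). It is fixed
    before the partition is given; only the approximation time n below depends on the
    partition.\<close>
  define \<delta>' where "\<delta>' = \<delta> * \<eta> / (g + 1)"
  have \<delta>': "0 < \<delta>'" using \<delta>(1) \<eta> g by (simp add: \<delta>'_def)
  have g\<delta>': "g * \<delta>' \<le> \<delta> * \<eta>"
  proof -
    have "g * \<delta>' \<le> (g + 1) * \<delta>'" using \<delta>' by (intro mult_right_mono) auto
    also have "\<dots> = \<delta> * \<eta>" using g by (simp add: \<delta>'_def)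
    finally show ?thesis .
  qed
  have "(\<Sum>i\<in>I. P.prob {\<omega> \<in> ev (A i). cp (A i) \<omega> < \<delta>'}) \<le> \<epsilon>"
    if I: "finite I" and A: "\<And>i. i \<in> I \<Longrightarrow> A i \<in> invariant_events G" and disj: "disjoint_family_on A I"
    for A and I :: "nat set"
  proof -
    have AT: "A i \<in> sets T" if "i \<in> I" for i using A[OF that] by (rule invariant_sets)
    have evA [measurable]: "ev (A i) \<in> sets \<Omega>" if "i \<in> I" for i using AT[OF that] by (rule sets_ev)
    \<comment> \<open>The approximation errors of all cells together are at most \<eta>.\<close>
    define e where "e = \<eta> / (real (card I) + 1)"
    have e: "0 < e" "real (card I) * e \<le> \<eta>" using \<eta> by (auto simp: e_def field_simps)
    have "\<forall>i\<in>I. \<exists>n C. C \<in> sets \<Omega> \<and> past n (\<lambda>\<omega>. \<omega> \<in> C) \<and> P.prob (sym_diff (ev (A i)) C) < e"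
      using past_approx[OF evA e(1)] by blast
    then obtain m C where C: "\<And>i. i \<in> I \<Longrightarrow> C i \<in> sets \<Omega>"
      "\<And>i. i \<in> I \<Longrightarrow> past (m i) (\<lambda>\<omega>. \<omega> \<in> C i)"
      "\<And>i. i \<in> I \<Longrightarrow> P.prob (sym_diff (ev (A i)) (C i)) < e"
      by metis
    define N0 where "N0 = Max (insert 0 (m ` I))"
    have N0: "past n (\<lambda>\<omega>. \<omega> \<in> C i)" if "i \<in> I" "N0 \<le> n" for i n
    proof -
      have "m i \<le> N0" using I that(1) by (auto simp: N0_def)
      then show ?thesis using past_mono[OF C(2)[OF that(1)]] that(2) by simp
    qed
    \<comment> \<open>If all N0 + 2 times from N0 to 2 N0 + 1 were bad with probability above
      \<epsilon> / 4, the average over the first 2 N0 + 2 times would exceed \<epsilon> / 8.\<close>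
    have "\<exists>n\<ge>N0. P.prob {\<omega> \<in> space \<Omega>. U (pos \<omega> n) \<omega> \<le> ennreal \<delta>} \<le> \<epsilon> / 4"
    proof (rule ccontr)
      assume "\<not> (\<exists>n\<ge>N0. P.prob {\<omega> \<in> space \<Omega>. U (pos \<omega> n) \<omega> \<le> ennreal \<delta>} \<le> \<epsilon> / 4)"
      then have *: "\<epsilon> / 4 \<le> P.prob {\<omega> \<in> space \<Omega>. U (pos \<omega> n) \<omega> \<le> ennreal \<delta>}" if "N0 \<le> n" for n
        using that by (meson linear)
      define N where "N = 2 * N0 + 1"
      have "(\<epsilon> / 4) * real (N0 + 2) = (\<Sum>n\<in>{N0..<Suc N}. \<epsilon> / 4)" by (simp add: N_def)
      also have "\<dots> \<le> (\<Sum>n\<in>{N0..<Suc N}. P.prob {\<omega> \<in> space \<Omega>. U (pos \<omega> n) \<omega> \<le> ennreal \<delta>})"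
        by (intro sum_mono *) simp
      also have "\<dots> \<le> (\<Sum>n<Suc N. P.prob {\<omega> \<in> space \<Omega>. U (pos \<omega> n) \<omega> \<le> ennreal \<delta>})"
        by (intro sum_mono2) auto
      also have "\<dots> \<le> \<epsilon> / 8 * real (Suc N)" by (rule \<delta>(2))
      finally have "(\<epsilon> / 4) * real (N0 + 2) \<le> \<epsilon> / 8 * real (2 * N0 + 2)" by (simp add: N_def)
      then show False using assms by (simp add: field_simps)
    qed
    then obtain n where n: "N0 \<le> n" "P.prob {\<omega> \<in> space \<Omega>. U (pos \<omega> n) \<omega> \<le> ennreal \<delta>} \<le> \<epsilon> / 4"
      by blast
    let ?bad = "{\<omega> \<in> space \<Omega>. U (pos \<omega> n) \<omega> \<le> ennreal \<delta>}"
    let ?good = "\<lambda>i. {\<omega> \<in> C i. \<omega> \<in> ev (A i) \<and> cp (A i) \<omega> < \<delta>' \<and> ennreal \<delta> < U (pos \<omega> n) \<omega>}"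
    \<comment> \<open>Either \<open>U\<close> is small at the position at time n, or the
      approximation C i of the cell fails, or the trajectory lies in the event bounded by
      \<open>small_given_past\<close>.\<close>
    have one: "P.prob {\<omega> \<in> ev (A i). cp (A i) \<omega> < \<delta>'} \<le>
        P.prob (ev (A i) \<inter> ?bad) + (e + \<eta> * (P.prob (ev (A i)) + e))" if i: "i \<in> I" for i
    proof -
      note [measurable] = C(1)[OF i] evA[OF i]
      have Csp: "C i \<subseteq> space \<Omega>" using sets.sets_into_space[OF C(1)[OF i]] .
      have goodm: "?good i \<in> sets \<Omega>"
      proof -
        have "?good i = {\<omega> \<in> space \<Omega>. \<omega> \<in> C i \<and> \<omega> \<in> ev (A i) \<and> cp (A i) \<omega> < \<delta>' \<and> ennreal \<delta> < U (pos \<omega> n) \<omega>}"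
          using Csp by auto
        also have "\<dots> \<in> sets \<Omega>" by measurable
        finally show ?thesis .
      qed
      have "P.prob {\<omega> \<in> ev (A i). cp (A i) \<omega> < \<delta>'} \<le>
          P.prob ((ev (A i) \<inter> ?bad) \<union> (sym_diff (ev (A i)) (C i) \<union> ?good i))"
      proof (rule P.finite_measure_mono)
        show "{\<omega> \<in> ev (A i). cp (A i) \<omega> < \<delta>'} \<subseteq>
            (ev (A i) \<inter> ?bad) \<union> (sym_diff (ev (A i)) (C i) \<union> ?good i)"
          using sets.sets_into_space[OF evA[OF i]] by (auto simp: not_le)
      qed (use goodm in auto)
      also have "\<dots> \<le> P.prob (ev (A i) \<inter> ?bad) + P.prob (sym_diff (ev (A i)) (C i) \<union> ?good i)"
        using goodm by (intro measure_Un_le) auto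
      also have "P.prob (sym_diff (ev (A i)) (C i) \<union> ?good i) \<le>
          P.prob (sym_diff (ev (A i)) (C i)) + P.prob (?good i)"
        using goodm by (intro measure_Un_le) auto
      also have "P.prob (sym_diff (ev (A i)) (C i)) \<le> e" using C(3)[OF i] by simp
      also have "P.prob (?good i) \<le> \<eta> * P.prob (C i)"
      proof -
        have "\<delta> * P.prob (?good i) \<le> g * \<delta>' * P.prob (C i)"
          unfolding g_def using small_given_past[OF A[OF i] C(1)[OF i] N0[OF i n(1)] \<delta>(1), of \<delta>'] \<delta>' by simp
        also have "\<dots> \<le> \<delta> * \<eta> * P.prob (C i)" by (intro mult_right_mono g\<delta>') simp
        finally show ?thesis using \<delta>(1) by (simp add: mult.assoc)
      qed
      also have "P.prob (C i) \<le> P.prob (ev (A i)) + e"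
      proof -
        have "P.prob (C i) \<le> P.prob (ev (A i) \<union> sym_diff (ev (A i)) (C i))"
          by (intro P.finite_measure_mono) auto
        also have "\<dots> \<le> P.prob (ev (A i)) + P.prob (sym_diff (ev (A i)) (C i))"
          by (intro measure_Un_le) auto
        finally show ?thesis using C(3)[OF i] by simp
      qed
      finally show ?thesis using \<eta>(1) by simp
    qed
    have disj_ev: "disjoint_family_on (\<lambda>i. ev (A i)) I"
      using disj by (auto simp: disjoint_family_on_def ev_def)
    have sum_bad: "(\<Sum>i\<in>I. P.prob (ev (A i) \<inter> ?bad)) \<le> \<epsilon> / 4"
    proof -
      have "(\<Sum>i\<in>I. P.prob (ev (A i) \<inter> ?bad)) = P.prob (\<Union>i\<in>I. ev (A i) \<inter> ?bad)"
        using disj_ev I evA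
        by (intro P.finite_measure_finite_Union[symmetric]) (auto simp: disjoint_family_on_def)
      also have "\<dots> \<le> P.prob ?bad" using evA I by (intro P.finite_measure_mono) auto
      finally show ?thesis using n(2) by simp
    qed
    have sum_A: "(\<Sum>i\<in>I. P.prob (ev (A i))) \<le> 1"
    proof -
      have "(\<Sum>i\<in>I. P.prob (ev (A i))) = P.prob (\<Union>i\<in>I. ev (A i))"
        using disj_ev I evA by (intro P.finite_measure_finite_Union[symmetric]) auto
      then show ?thesis by simp
    qed
    have "(\<Sum>i\<in>I. P.prob {\<omega> \<in> ev (A i). cp (A i) \<omega> < \<delta>'}) \<le>
        (\<Sum>i\<in>I. P.prob (ev (A i) \<inter> ?bad) + (e + \<eta> * (P.prob (ev (A i)) + e)))"
      by (intro sum_mono one)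
    also have "\<dots> = (\<Sum>i\<in>I. P.prob (ev (A i) \<inter> ?bad)) + (real (card I) * e +
        \<eta> * ((\<Sum>i\<in>I. P.prob (ev (A i))) + real (card I) * e))"
      by (simp add: sum.distrib flip: sum_distrib_left)
    also have "\<dots> \<le> \<epsilon> / 4 + (\<eta> + \<eta> * (1 + \<eta>))"
      using sum_bad sum_A e \<eta> by (intro add_mono mult_left_mono) auto
    also have "\<dots> \<le> \<epsilon>"
    proof -
      have "\<eta> * (1 + \<eta>) \<le> \<eta> * 2" using \<eta> by (intro mult_left_mono) auto
      then show ?thesis using \<eta> by linarith
    qed
    finally show ?thesis .
  qed
  then show ?thesis using \<delta>' by blast
qed

end

section \<open>Conditioning on the first n steps together with the subalgebra\<close>

context invariant_subalgebra
begin

text \<open>The Markov property for an integrand that also depends on the random position at time n;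
  joint measurability comes from the countability of the group.\<close>

lemma nn_integral_split_pos:
  assumes f: "\<And>g. g \<in> carrier G \<Longrightarrow> f g \<in> borel_measurable \<Omega>"
    and [measurable]: "C \<in> sets \<Omega>" and past: "past n (\<lambda>\<omega>. \<omega> \<in> C)"
  shows "(\<integral>\<^sup>+\<omega>. indicator C \<omega> * f (pos \<omega> n) (shift n \<omega>) \<partial>\<Omega>) =
    (\<integral>\<^sup>+\<omega>. indicator C \<omega> * (\<integral>\<^sup>+\<omega>'. f (pos \<omega> n) \<omega>' \<partial>\<Omega>) \<partial>\<Omega>)"
proof -
  have [measurable]: "(\<lambda>p. f (pos (fst p) n) (snd p)) \<in> borel_measurable (\<Omega> \<Otimes>\<^sub>M \<Omega>)"
    by (rule measurable_compose_countable'[where I = "carrier G" and g = "\<lambda>p. pos (fst p) n"])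
      (auto simp: countable_carrier intro: measurable_compose[OF measurable_snd f])
  have "(\<integral>\<^sup>+\<omega>. indicator C \<omega> * f (pos \<omega> n) (shift n \<omega>) \<partial>\<Omega>) =
      (\<integral>\<^sup>+\<omega>. \<integral>\<^sup>+\<omega>'. indicator C \<omega> * f (pos \<omega> n) \<omega>' \<partial>\<Omega> \<partial>\<Omega>)"
  proof (rule nn_integral_split)
    show "(\<lambda>(\<omega>, \<omega>'). indicator C \<omega> * f (pos \<omega> n) \<omega>') \<in> borel_measurable (\<Omega> \<Otimes>\<^sub>M \<Omega>)"
      unfolding split_beta' by measurable
    show "past n (\<lambda>\<omega>. indicator C \<omega> * f (pos \<omega> n) \<omega>')" for \<omega>'
      using past_compose2[OF past past_pos[of n n], of "\<lambda>c g. of_bool c * f g \<omega>'"]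
      by (simp add: indicator_def of_bool_def)
  qed
  also have "\<dots> = (\<integral>\<^sup>+\<omega>. indicator C \<omega> * (\<integral>\<^sup>+\<omega>'. f (pos \<omega> n) \<omega>' \<partial>\<Omega>) \<partial>\<Omega>)"
    by (intro nn_integral_cong nn_integral_cmult f) simp
  finally show ?thesis .
qed

text \<open>The conditional probability of \<open>A\<close> given the first \<open>n\<close> steps and the subalgebra.\<close>

definition cpn :: "nat \<Rightarrow> (nat \<Rightarrow> 'a) set \<Rightarrow> (nat \<Rightarrow> 'a) \<Rightarrow> real" where
  "cpn n A \<omega> = cp (pull (pos \<omega> n) A) (shift n \<omega>)"

lemma measurable_cpn [measurable]: "cpn n A \<in> borel_measurable \<Omega>"
proof -
  have "(\<lambda>\<omega>. cp (pull (pos \<omega> n) A) (shift n \<omega>)) \<in> borel_measurable \<Omega>"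
    by (rule measurable_compose_countable'[where I = "carrier G" and g = "\<lambda>\<omega>. pos \<omega> n"])
      (auto simp: countable_carrier)
  then show ?thesis by (simp add: cpn_def[abs_def])
qed

lemma AE_split_pos:
  assumes f: "\<And>g. g \<in> carrier G \<Longrightarrow> {\<omega> \<in> space \<Omega>. f g \<omega>} \<in> sets \<Omega>"
    and ae: "\<And>g. g \<in> carrier G \<Longrightarrow> AE \<omega> in \<Omega>. f g \<omega>"
  shows "AE \<omega> in \<Omega>. f (pos \<omega> n) (shift n \<omega>)"
proof -
  define D where "D g = {\<omega> \<in> space \<Omega>. \<not> f g \<omega>}" for g
  have D [measurable]: "D g \<in> sets \<Omega>" if "g \<in> carrier G" for g
    using sets.compl_sets[OF f[OF that]] by (simp add: D_def set_diff_eq Collect_conj_eq[symmetric] cong: conj_cong)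
  have D0: "emeasure \<Omega> (D g) = 0" if "g \<in> carrier G" for g
    using ae[OF that] D[OF that] by (simp add: D_def AE_iff_measurable[OF _ refl])
  have "(\<integral>\<^sup>+\<omega>. indicator (space \<Omega>) \<omega> * indicator (D (pos \<omega> n)) (shift n \<omega>) \<partial>\<Omega>) =
      (\<integral>\<^sup>+\<omega>. indicator (space \<Omega>) \<omega> * (\<integral>\<^sup>+\<omega>'. indicator (D (pos \<omega> n)) \<omega>' \<partial>\<Omega>) \<partial>\<Omega>)"
    by (rule nn_integral_split_pos) (auto simp: past_def)
  also have "\<dots> = (\<integral>\<^sup>+\<omega>. 0 \<partial>\<Omega>)"
    by (intro nn_integral_cong) (simp add: D0)
  finally have "(\<integral>\<^sup>+\<omega>. indicator (space \<Omega>) \<omega> * indicator (D (pos \<omega> n)) (shift n \<omega>) \<partial>\<Omega>) = 0" by simp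
  moreover have "(\<lambda>\<omega>. indicator (D (pos \<omega> n)) (shift n \<omega>) :: ennreal) \<in> borel_measurable \<Omega>"
    by (rule measurable_compose_countable'[where I = "carrier G" and g = "\<lambda>\<omega>. pos \<omega> n"])
      (auto simp: countable_carrier intro!: measurable_compose[OF measurable_shift])
  ultimately have "AE \<omega> in \<Omega>. indicator (space \<Omega>) \<omega> * indicator (D (pos \<omega> n)) (shift n \<omega>) = (0 :: ennreal)"
    by (subst (asm) nn_integral_0_iff_AE) auto
  then show ?thesis using AE_space
    by eventually_elim (auto simp: D_def split: split_indicator_asm)
qed

lemma cpn_bounds:
  assumes A: "A \<in> sets T"
  shows "AE \<omega> in \<Omega>. 0 \<le> cpn n A \<omega> \<and> cpn n A \<omega> \<le> 1"
  unfolding cpn_def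
proof (rule AE_split_pos)
  fix g assume g: "g \<in> carrier G"
  show "{\<omega> \<in> space \<Omega>. 0 \<le> cp (pull g A) \<omega> \<and> cp (pull g A) \<omega> \<le> 1} \<in> sets \<Omega>" by measurable
  show "AE \<omega> in \<Omega>. 0 \<le> cp (pull g A) \<omega> \<and> cp (pull g A) \<omega> \<le> 1"
    by (rule cp_bounds[OF sets_pull[OF g A]])
qed

text \<open>Justifies the name of \<open>cpn\<close> by testing it on intersections of a past event
  C with an event D of \<open>F\<close>. For D = \<open>ev B\<close>, \<open>ev_shift\<close> turns
  D into an event of the shifted sequence, namely \<open>ev (pull q B)\<close> with q the position
  at time n. As \<open>pull q B\<close> is again in \<open>Bm\<close>, the defining property of
  \<open>cp (pull q A)\<close> applies to it for each q.\<close>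

lemma cpn_int:
  assumes A: "A \<in> invariant_events G" and C [measurable]: "C \<in> sets \<Omega>" and past: "past n (\<lambda>\<omega>. \<omega> \<in> C)"
    and D: "D \<in> sets F"
  shows "(\<integral>\<omega>. indicator (C \<inter> D) \<omega> * cpn n A \<omega> \<partial>\<Omega>) = P.prob (C \<inter> ev A \<inter> D)"
proof -
  obtain B where B: "B \<in> sets Bm" "D = ev B" using D by (auto simp: sets_F)
  have AT [measurable]: "A \<in> sets T" "B \<in> sets T" using A B by (auto intro: invariant_sets Bm_T)
  have Binv: "B \<in> invariant_events G" using B sets_Bm by auto
  have D\<Omega> [measurable]: "D \<in> sets \<Omega>" using B by auto
  define f where "f g \<omega>' = ennreal (indicator (ev (pull g B)) \<omega>' * cp (pull g A) \<omega>')" for g \<omega>'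
  define h where "h g \<omega>' = (indicator (ev (pull g (A \<inter> B))) \<omega>' :: ennreal)" for g \<omega>'
  have same: "(\<integral>\<^sup>+\<omega>'. f g \<omega>' \<partial>\<Omega>) = (\<integral>\<^sup>+\<omega>'. h g \<omega>' \<partial>\<Omega>)" if g: "g \<in> carrier G" for g
  proof -
    have T: "pull g A \<in> sets T" "pull g B \<in> sets T" using AT g by auto
    have FB: "ev (pull g B) \<in> sets F" using pull_Bm[OF g B(1)] by (simp add: sets_F)
    have "(\<integral>\<^sup>+\<omega>'. f g \<omega>' \<partial>\<Omega>) = ennreal (\<integral>\<omega>'. indicator (ev (pull g B)) \<omega>' * cp (pull g A) \<omega>' \<partial>\<Omega>)"
      unfolding f_def
    proof (rule nn_integral_eq_integral)
      show "integrable \<Omega> (\<lambda>\<omega>'. indicator (ev (pull g B)) \<omega>' * cp (pull g A) \<omega>')"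
        using integrable_mult_indicator[OF sets_ev[OF T(2)] integrable_cp[OF T(1)]] by simp
      show "AE \<omega>' in \<Omega>. 0 \<le> indicator (ev (pull g B)) \<omega>' * cp (pull g A) \<omega>'"
        using cp_bounds[OF T(1)] by eventually_elim (auto split: split_indicator)
    qed
    also have "\<dots> = ennreal (P.prob (ev (pull g A) \<inter> ev (pull g B)))"
      by (simp add: cp_int[OF T(1) FB])
    also have "ev (pull g A) \<inter> ev (pull g B) = ev (pull g (A \<inter> B))"
      by (auto simp: ev_def pull_def)
    also have "ennreal (P.prob (ev (pull g (A \<inter> B)))) = (\<integral>\<^sup>+\<omega>'. h g \<omega>' \<partial>\<Omega>)"
      unfolding h_def using g AT
      by (subst nn_integral_indicator) (auto simp: P.emeasure_eq_measure intro!: sets_ev sets_pull)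
    finally show ?thesis .
  qed
  have "(\<integral>\<^sup>+\<omega>. ennreal (indicator (C \<inter> D) \<omega> * cpn n A \<omega>) \<partial>\<Omega>) =
      (\<integral>\<^sup>+\<omega>. indicator C \<omega> * f (pos \<omega> n) (shift n \<omega>) \<partial>\<Omega>)"
  proof (rule nn_integral_cong)
    fix \<omega> assume \<omega>: "\<omega> \<in> space \<Omega>"
    show "ennreal (indicator (C \<inter> D) \<omega> * cpn n A \<omega>) = indicator C \<omega> * f (pos \<omega> n) (shift n \<omega>)"
      using ev_shift[OF Binv \<omega>, of n] by (auto simp: f_def cpn_def B(2) split: split_indicator)
  qed
  also have "\<dots> = (\<integral>\<^sup>+\<omega>. indicator C \<omega> * (\<integral>\<^sup>+\<omega>'. f (pos \<omega> n) \<omega>' \<partial>\<Omega>) \<partial>\<Omega>)"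
    by (rule nn_integral_split_pos[OF _ C past])
      (use AT in \<open>auto simp: f_def intro!: measurable_compose[OF _ measurable_ennreal] borel_measurable_times borel_measurable_indicator sets_ev\<close>)
  also have "\<dots> = (\<integral>\<^sup>+\<omega>. indicator C \<omega> * (\<integral>\<^sup>+\<omega>'. h (pos \<omega> n) \<omega>' \<partial>\<Omega>) \<partial>\<Omega>)"
    by (intro nn_integral_cong) (simp add: same)
  also have "\<dots> = (\<integral>\<^sup>+\<omega>. indicator C \<omega> * h (pos \<omega> n) (shift n \<omega>) \<partial>\<Omega>)"
    by (rule nn_integral_split_pos[OF _ C past, symmetric])
      (use AT in \<open>auto simp: h_def intro!: borel_measurable_indicator sets_ev sets_pull\<close>)
  also have "\<dots> = (\<integral>\<^sup>+\<omega>. indicator (C \<inter> ev A \<inter> D) \<omega> \<partial>\<Omega>)"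
  proof (rule nn_integral_cong)
    fix \<omega> assume \<omega>: "\<omega> \<in> space \<Omega>"
    show "indicator C \<omega> * h (pos \<omega> n) (shift n \<omega>) = (indicator (C \<inter> ev A \<inter> D) \<omega> :: ennreal)"
      using ev_shift[OF invariant_Int[OF A Binv] \<omega>, of n]
      by (auto simp: h_def B(2) ev_Int split: split_indicator)
  qed
  also have "\<dots> = ennreal (P.prob (C \<inter> ev A \<inter> D))"
    by (subst nn_integral_indicator) (auto simp: P.emeasure_eq_measure)
  finally have *: "(\<integral>\<^sup>+\<omega>. ennreal (indicator (C \<inter> D) \<omega> * cpn n A \<omega>) \<partial>\<Omega>) = ennreal (P.prob (C \<inter> ev A \<inter> D))" .
  have "(\<integral>\<omega>. indicator (C \<inter> D) \<omega> * cpn n A \<omega> \<partial>\<Omega>) =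
      enn2real (\<integral>\<^sup>+\<omega>. ennreal (indicator (C \<inter> D) \<omega> * cpn n A \<omega>) \<partial>\<Omega>)"
    using cpn_bounds[OF AT(1), of n] by (intro integral_eq_nn_integral) (auto split: split_indicator elim!: eventually_mono)
  then show ?thesis by (simp add: *)
qed

lemma integrable_cpn [simp]: "A \<in> sets T \<Longrightarrow> integrable \<Omega> (cpn n A)"
  by (rule integrable_bounded[where c = 1], simp, rule eventually_mono[OF cpn_bounds[of A n]]) auto

lemma integrable_prods [simp]:
  assumes "A \<in> sets T"
  shows "integrable \<Omega> (\<lambda>\<omega>. cp A \<omega> * cpn n A \<omega>)" "integrable \<Omega> (\<lambda>\<omega>. (cp A \<omega>)\<^sup>2)"
    "integrable \<Omega> (\<lambda>\<omega>. (cpn n A \<omega>)\<^sup>2)"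
proof -
  have *: "AE \<omega> in \<Omega>. (0 \<le> cpn n A \<omega> \<and> cpn n A \<omega> \<le> 1) \<and> (0 \<le> cp A \<omega> \<and> cp A \<omega> \<le> 1)"
    using cpn_bounds[OF assms, of n] cp_bounds[OF assms] by auto
  have 1: "a \<le> 1 \<Longrightarrow> b \<le> 1 \<Longrightarrow> 0 \<le> a \<Longrightarrow> 0 \<le> b \<Longrightarrow> \<bar>a * b\<bar> \<le> 1" for a b :: real
    by (simp add: abs_mult mult_le_one)
  show "integrable \<Omega> (\<lambda>\<omega>. cp A \<omega> * cpn n A \<omega>)" "integrable \<Omega> (\<lambda>\<omega>. (cp A \<omega>)\<^sup>2)"
    "integrable \<Omega> (\<lambda>\<omega>. (cpn n A \<omega>)\<^sup>2)"
    unfolding power2_eq_square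
    by (rule integrable_bounded[where c = 1], measurable, rule eventually_mono[OF *], intro 1; simp)+
qed

text \<open>Pythagoras: \<open>cp A\<close> is the conditional expectation of \<open>cpn n A\<close>
  given \<open>F\<close>, hence orthogonal to the difference.\<close>

lemma cpn_cp_orthogonal:
  assumes A: "A \<in> invariant_events G"
  shows "(\<integral>\<omega>. (cpn n A \<omega> - cp A \<omega>)\<^sup>2 \<partial>\<Omega>) = (\<integral>\<omega>. (cpn n A \<omega>)\<^sup>2 \<partial>\<Omega>) - (\<integral>\<omega>. (cp A \<omega>)\<^sup>2 \<partial>\<Omega>)"
proof -
  have AT: "A \<in> sets T" using A by (rule invariant_sets)
  have ce: "AE \<omega> in \<Omega>. real_cond_exp \<Omega> F (cpn n A) \<omega> = cp A \<omega>"
  proof (rule FS.real_cond_exp_charact)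
    fix D assume D: "D \<in> sets F"
    then have D\<Omega>: "D \<in> sets \<Omega>" using subalgebra_F by (auto simp: subalgebra_def)
    have "(\<integral>\<omega>. indicator (space \<Omega> \<inter> D) \<omega> * cpn n A \<omega> \<partial>\<Omega>) = P.prob (space \<Omega> \<inter> ev A \<inter> D)"
      using D by (intro cpn_int A) (auto simp: past_def)
    moreover have "space \<Omega> \<inter> D = D" "space \<Omega> \<inter> ev A \<inter> D = ev A \<inter> D"
      using sets.sets_into_space[OF D\<Omega>] by auto
    ultimately show "(\<integral>\<omega>\<in>D. cpn n A \<omega> \<partial>\<Omega>) = (\<integral>\<omega>\<in>D. cp A \<omega> \<partial>\<Omega>)"
      using cp_int[OF AT D] by (simp add: set_lebesgue_integral_def)
  qed (use AT in auto)
  have "(\<integral>\<omega>. cp A \<omega> * cpn n A \<omega> \<partial>\<Omega>) = (\<integral>\<omega>. cp A \<omega> * real_cond_exp \<Omega> F (cpn n A) \<omega> \<partial>\<Omega>)"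
    using AT by (intro FS.real_cond_exp_intg(2)[symmetric]) auto
  also have "\<dots> = (\<integral>\<omega>. (cp A \<omega>)\<^sup>2 \<partial>\<Omega>)"
    using ce by (intro integral_cong_AE) (auto simp: power2_eq_square elim!: eventually_mono)
  finally have cross: "(\<integral>\<omega>. cp A \<omega> * cpn n A \<omega> \<partial>\<Omega>) = (\<integral>\<omega>. (cp A \<omega>)\<^sup>2 \<partial>\<Omega>)" .
  have "(\<integral>\<omega>. (cpn n A \<omega> - cp A \<omega>)\<^sup>2 \<partial>\<Omega>) =
      (\<integral>\<omega>. (cpn n A \<omega>)\<^sup>2 + (cp A \<omega>)\<^sup>2 - 2 * (cp A \<omega> * cpn n A \<omega>) \<partial>\<Omega>)"
    by (intro Bochner_Integration.integral_cong) (auto simp: power2_diff)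
  also have "\<dots> = (\<integral>\<omega>. (cpn n A \<omega>)\<^sup>2 \<partial>\<Omega>) + (\<integral>\<omega>. (cp A \<omega>)\<^sup>2 \<partial>\<Omega>) - 2 * (\<integral>\<omega>. cp A \<omega> * cpn n A \<omega> \<partial>\<Omega>)"
    using AT by simp
  finally show ?thesis using cross by simp
qed

end

section \<open>Finite invariant partitions, their translates and refinements\<close>

context random_walk
begin

definition level :: "((nat \<Rightarrow> 'a) \<Rightarrow> nat) \<Rightarrow> nat \<Rightarrow> (nat \<Rightarrow> 'a) set" where
  "level Y i = {x \<in> space T. Y x = i}"

text \<open>A finite partition into invariant events is encoded as the function naming the cell of a
  trajectory. Coarsening is then composition, joining two partitions is pairing by
  \<open>prod_encode\<close>, and translation is composition with \<open>lmult\<close>.\<close>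

definition inv_fun :: "((nat \<Rightarrow> 'a) \<Rightarrow> nat) \<Rightarrow> bool" where
  "inv_fun Y \<longleftrightarrow> finite (Y ` space T) \<and> (\<forall>i. level Y i \<in> invariant_events G)"

lemma inv_fun_of_bool:
  assumes "A \<in> invariant_events G"
  shows "inv_fun (\<lambda>x. of_bool (x \<in> A))"
  unfolding inv_fun_def
proof (intro conjI allI)
  show "finite ((\<lambda>x. of_bool (x \<in> A) :: nat) ` space T)"
    by (rule finite_subset[of _ "{0, 1}"]) auto
  fix i
  have AT: "A \<subseteq> space T" "A \<in> sets T" using sets.sets_into_space invariant_sets[OF assms] by auto
  show "level (\<lambda>x. of_bool (x \<in> A)) i \<in> invariant_events G"
  proof (rule invariant_eventI)
    have "level (\<lambda>x. of_bool (x \<in> A)) i = (if i = 1 then A else if i = 0 then space T - A else {})"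
      using AT by (auto simp: level_def)
    then show "level (\<lambda>x. of_bool (x \<in> A)) i \<in> sets T" using AT by auto
    show "(\<lambda>n. x (Suc n)) \<in> level (\<lambda>x. of_bool (x \<in> A)) i \<longleftrightarrow> x \<in> level (\<lambda>x. of_bool (x \<in> A)) i"
      if "x \<in> space T" for x
      using invariant_shift[OF assms that, of 1] that by (auto simp: level_def space_T)
  qed
qed

lemma inv_fun_pair:
  assumes "inv_fun Y" "inv_fun Z"
  shows "inv_fun (\<lambda>x. prod_encode (Y x, Z x))"
  unfolding inv_fun_def
proof (intro conjI allI)
  have "(\<lambda>x. prod_encode (Y x, Z x)) ` space T \<subseteq> prod_encode ` (Y ` space T \<times> Z ` space T)" by auto
  then show "finite ((\<lambda>x. prod_encode (Y x, Z x)) ` space T)"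
    by (rule finite_subset) (use assms in \<open>auto simp: inv_fun_def\<close>)
  fix i
  have "level (\<lambda>x. prod_encode (Y x, Z x)) i = level Y (fst (prod_decode i)) \<inter> level Z (snd (prod_decode i))"
    by (auto simp: level_def)
  then show "level (\<lambda>x. prod_encode (Y x, Z x)) i \<in> invariant_events G"
    using assms by (simp add: inv_fun_def invariant_Int)
qed

lemma lmult_lmult_inv [simp]:
  assumes "g \<in> carrier G" "x \<in> space T"
  shows "lmult g (lmult (inv g) x) = x" "lmult (inv g) (lmult g x) = x"
  using assms by (auto simp: lmult_def space_T m_assoc[symmetric])

lemma level_lmult: "g \<in> carrier G \<Longrightarrow> level (\<lambda>x. Y (lmult g x)) i = pull g (level Y i)"
  by (auto simp: level_def pull_def)

lemma image_lmult:
  assumes "g \<in> carrier G"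
  shows "(\<lambda>x. Y (lmult g x)) ` space T = Y ` space T"
proof -
  have "lmult g ` space T = space T"
  proof
    show "space T \<subseteq> lmult g ` space T"
    proof
      fix x assume "x \<in> space T"
      then show "x \<in> lmult g ` space T"
        using assms by (intro image_eqI[of _ _ "lmult (inv g) x"]) auto
    qed
  qed (use assms in auto)
  then show ?thesis by (metis image_image)
qed

lemma inv_fun_lmult: "inv_fun Y \<Longrightarrow> g \<in> carrier G \<Longrightarrow> inv_fun (\<lambda>x. Y (lmult g x))"
  by (auto simp: inv_fun_def image_lmult level_lmult intro: invariant_pull)

text \<open>Z collects the indicator of A and the translates of Y by the inverses of the elements of
  J; translating Z by g in J recovers Y from one component. Thus the partition met after n steps
  refines Y whenever the position lies in J, and A remains a union of cells of Z.\<close>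

lemma common_refinement:
  assumes "finite J" "J \<subseteq> carrier G" "inv_fun Y" "A \<in> invariant_events G"
  shows "\<exists>Z. inv_fun Z \<and> (\<exists>\<phi>. \<forall>x\<in>space T. x \<in> A \<longleftrightarrow> \<phi> (Z x)) \<and>
    (\<forall>g\<in>J. \<exists>\<phi>. \<forall>x\<in>space T. Y x = \<phi> (Z (lmult g x)))"
  using assms(1,2)
proof (induction J rule: finite_induct)
  case empty
  have "\<forall>x\<in>space T. x \<in> A \<longleftrightarrow> (of_bool (x \<in> A) :: nat) = 1" by simp
  then show ?case using inv_fun_of_bool[OF assms(4)]
    by (intro exI[of _ "\<lambda>x. of_bool (x \<in> A)"]) auto
next
  case (insert h J)
  then obtain Z \<phi> where Z: "inv_fun Z" "\<forall>x\<in>space T. x \<in> A \<longleftrightarrow> \<phi> (Z x)"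
    "\<forall>g\<in>J. \<exists>\<phi>. \<forall>x\<in>space T. Y x = \<phi> (Z (lmult g x))" by auto
  have h: "h \<in> carrier G" "inv h \<in> carrier G" using insert.prems by auto
  define W where "W x = prod_encode (Z x, Y (lmult (inv h) x))" for x
  have "inv_fun W"
    unfolding W_def by (rule inv_fun_pair[OF Z(1) inv_fun_lmult[OF assms(3) h(2)]])
  moreover have "\<forall>x\<in>space T. x \<in> A \<longleftrightarrow> \<phi> (fst (prod_decode (W x)))" using Z(2) by (simp add: W_def)
  moreover have "\<exists>\<phi>. \<forall>x\<in>space T. Y x = \<phi> (W (lmult g x))" if g: "g \<in> insert h J" for g
  proof (cases "g = h")
    case True
    then have "\<forall>x\<in>space T. Y x = snd (prod_decode (W (lmult g x)))" using h by (simp add: W_def)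
    then show ?thesis by (intro exI[of _ "\<lambda>w. snd (prod_decode w)"])
  next
    case False
    then obtain \<psi> where "\<forall>x\<in>space T. Y x = \<psi> (Z (lmult g x))" using Z(3) g by auto
    then have "\<forall>x\<in>space T. Y x = \<psi> (fst (prod_decode (W (lmult g x))))" by (simp add: W_def)
    then show ?thesis by (intro exI[of _ "\<lambda>w. \<psi> (fst (prod_decode w))"])
  qed
  ultimately show ?case
    by (intro exI[of _ W] conjI exI[of _ "\<lambda>w. \<phi> (fst (prod_decode w))"] ballI) auto
qed

lemma pos_concentrated:
  assumes "0 < e"
  shows "\<exists>J. finite J \<and> J \<subseteq> carrier G \<and> P.prob {\<omega> \<in> space \<Omega>. pos \<omega> n \<notin> J} < e"
proof -
  define f where "f = from_nat_into (carrier G)"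
  have ne: "carrier G \<noteq> {}" using one_closed by blast
  define E where "E k = {\<omega> \<in> space \<Omega>. pos \<omega> n \<in> f ` {..<k}}" for k :: nat
  have fc: "f ` {..<k} \<subseteq> carrier G" for k using from_nat_into[OF ne] by (auto simp: f_def)
  have E [measurable]: "E k \<in> sets \<Omega>" for k
  proof -
    have "E k = (\<Union>q\<in>f ` {..<k}. visits q n)" by (auto simp: E_def visits_def)
    then show ?thesis by auto
  qed
  have "(\<lambda>k. P.prob (E k)) \<longlonglongrightarrow> P.prob (\<Union>k. E k)"
    by (rule P.finite_Lim_measure_incseq) (use E in blast, auto simp: incseq_def E_def)
  moreover have "(\<Union>k. E k) = space \<Omega>"
  proof -
    have "\<exists>k. pos \<omega> n \<in> f ` {..<k}" if "\<omega> \<in> space \<Omega>" for \<omega>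
    proof -
      have "pos \<omega> n \<in> carrier G" using that by simp
      from from_nat_into_surj[OF countable_carrier this] obtain j where "f j = pos \<omega> n"
        by (auto simp: f_def)
      then show ?thesis by (intro exI[of _ "Suc j"]) (auto intro!: image_eqI[of _ _ j])
    qed
    then show ?thesis by (auto simp: E_def)
  qed
  ultimately have "(\<lambda>k. P.prob (E k)) \<longlonglongrightarrow> 1" by (simp add: P.prob_space)
  from LIMSEQ_D[OF this assms] obtain k where k: "\<bar>P.prob (E k) - 1\<bar> < e" by auto
  have "{\<omega> \<in> space \<Omega>. pos \<omega> n \<notin> f ` {..<k}} = space \<Omega> - E k" by (auto simp: E_def)
  then have "P.prob {\<omega> \<in> space \<Omega>. pos \<omega> n \<notin> f ` {..<k}} = 1 - P.prob (E k)"
    by (simp add: P.prob_compl)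
  then show ?thesis using k fc by (intro exI[of _ "f ` {..<k}"]) auto
qed

end

lemma sum_squares_le_square_sum:
  fixes f :: "'i \<Rightarrow> real"
  assumes "finite I" "\<And>i. i \<in> I \<Longrightarrow> 0 \<le> f i"
  shows "(\<Sum>i\<in>I. (f i)\<^sup>2) \<le> (\<Sum>i\<in>I. f i)\<^sup>2"
proof -
  have "(\<Sum>i\<in>I. (f i)\<^sup>2) \<le> (\<Sum>i\<in>I. f i * (\<Sum>j\<in>I. f j))"
    unfolding power2_eq_square using assms
    by (intro sum_mono mult_left_mono member_le_sum) auto
  then show ?thesis by (simp add: power2_eq_square sum_distrib_right)
qed

section \<open>The energy of a finite invariant partition\<close>

context invariant_subalgebra
begin

definition energy :: "((nat \<Rightarrow> 'a) \<Rightarrow> nat) \<Rightarrow> real" where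
  "energy Y = (\<Sum>i\<in>Y ` space T. \<integral>\<omega>. (cp (level Y i) \<omega>)\<^sup>2 \<partial>\<Omega>)"

lemma level_sets: "inv_fun Y \<Longrightarrow> level Y i \<in> sets T"
  by (auto simp: inv_fun_def intro: invariant_sets)

lemma disjoint_level: "disjoint_family_on (level Y) I"
  by (auto simp: disjoint_family_on_def level_def)

lemma sum_prob_level:
  assumes "inv_fun Y"
  shows "(\<Sum>i\<in>Y ` space T. P.prob (ev (level Y i))) = 1"
proof -
  have "(\<Sum>i\<in>Y ` space T. P.prob (ev (level Y i))) = P.prob (\<Union>i\<in>Y ` space T. ev (level Y i))"
    using assms level_sets[OF assms]
    by (intro P.finite_measure_finite_Union[symmetric])
      (auto simp: inv_fun_def disjoint_family_on_def level_def ev_def[abs_def] intro!: sets_ev[unfolded ev_def])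
  also have "(\<Union>i\<in>Y ` space T. ev (level Y i)) = space \<Omega>" by (auto simp: ev_def level_def)
  finally show ?thesis by (simp add: P.prob_space)
qed

lemma cp_integral: "A \<in> sets T \<Longrightarrow> (\<integral>\<omega>. cp A \<omega> \<partial>\<Omega>) = P.prob (ev A)"
  unfolding cp_def using FS.real_cond_exp_int(2)[OF integrable_ind, of A]
  by (simp add: P.emeasure_eq_measure sets_ev)

lemma energy_nonneg: "0 \<le> energy Y"
  unfolding energy_def by (intro sum_nonneg) simp

lemma energy_le_1:
  assumes "inv_fun Y"
  shows "energy Y \<le> 1"
proof -
  have "(\<integral>\<omega>. (cp (level Y i) \<omega>)\<^sup>2 \<partial>\<Omega>) \<le> (\<integral>\<omega>. cp (level Y i) \<omega> \<partial>\<Omega>)" for i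
  proof (rule integral_mono_AE)
    show "AE \<omega> in \<Omega>. (cp (level Y i) \<omega>)\<^sup>2 \<le> cp (level Y i) \<omega>"
      using cp_bounds[OF level_sets[OF assms]]
      by eventually_elim (auto simp: power2_eq_square intro: mult_left_le)
  qed (use level_sets[OF assms] in auto)
  then have "energy Y \<le> (\<Sum>i\<in>Y ` space T. P.prob (ev (level Y i)))"
    unfolding energy_def by (intro sum_mono) (simp add: cp_integral[OF level_sets[OF assms], symmetric])
  then show ?thesis using sum_prob_level[OF assms] by simp
qed

lemma cp_level_sum:
  assumes Z: "inv_fun Z" and "\<And>x. x \<in> space T \<Longrightarrow> x \<in> A \<longleftrightarrow> \<phi> (Z x)" "A \<subseteq> space T"
  shows "AE \<omega> in \<Omega>. cp A \<omega> = (\<Sum>j\<in>{j \<in> Z ` space T. \<phi> j}. cp (level Z j) \<omega>)"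
proof -
  have fin: "finite {j \<in> Z ` space T. \<phi> j}" using Z by (auto simp: inv_fun_def)
  have "indicator (ev A) = (\<lambda>\<omega>. \<Sum>j\<in>{j \<in> Z ` space T. \<phi> j}. indicator (ev (level Z j)) \<omega> :: real)"
  proof
    fix \<omega> show "indicator (ev A) \<omega> = (\<Sum>j\<in>{j \<in> Z ` space T. \<phi> j}. indicator (ev (level Z j)) \<omega> :: real)"
    proof (cases "\<omega> \<in> ev A")
      case True
      then have \<omega>: "\<omega> \<in> space \<Omega>" "path \<omega> \<in> space T" "\<phi> (Z (path \<omega>))" using assms(2,3) by (auto simp: ev_def)
      have "(\<Sum>j\<in>{j \<in> Z ` space T. \<phi> j}. indicator (ev (level Z j)) \<omega> :: real) =
          (\<Sum>j\<in>{Z (path \<omega>)}. indicator (ev (level Z j)) \<omega>)"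
        using fin \<omega> by (intro sum.mono_neutral_right) (auto simp: ev_def level_def)
      also have "\<dots> = 1" using \<omega> by (simp add: ev_def level_def)
      finally show ?thesis using True by simp
    next
      case False
      then have "\<omega> \<notin> ev (level Z j)" if "\<phi> j" for j
        using that assms(2)[of "path \<omega>"] by (auto simp: ev_def level_def)
      then show ?thesis using False by (simp add: sum.neutral)
    qed
  qed
  then have "cp A = real_cond_exp \<Omega> F (\<lambda>\<omega>. \<Sum>j\<in>{j \<in> Z ` space T. \<phi> j}. indicator (ev (level Z j)) \<omega>)"
    by (simp add: cp_def)
  then show ?thesis
    unfolding cp_def
    using FS.real_cond_exp_sum[of "\<lambda>j. indicator (ev (level Z j))" "{j \<in> Z ` space T. \<phi> j}"] level_sets[OF Z]
    by simp
qed

text \<open>Merging cells adds their conditional probabilities, and the square of a sum of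
  nonnegative numbers is at least the sum of the squares.\<close>

lemma energy_mono:
  assumes Y: "inv_fun Y" and Z: "inv_fun Z" and ref: "\<And>x. x \<in> space T \<Longrightarrow> Y x = \<phi> (Z x)"
  shows "energy Z \<le> energy Y"
proof -
  have fin: "finite (Y ` space T)" "finite (Z ` space T)" using Y Z by (auto simp: inv_fun_def)
  have "energy Z = (\<Sum>i\<in>Y ` space T. \<Sum>j\<in>{j \<in> Z ` space T. \<phi> j = i}. \<integral>\<omega>. (cp (level Z j) \<omega>)\<^sup>2 \<partial>\<Omega>)"
    unfolding energy_def using fin ref by (intro sum.group[symmetric]) auto
  also have "\<dots> \<le> energy Y"
    unfolding energy_def
  proof (rule sum_mono)
    fix i
    let ?J = "{j \<in> Z ` space T. \<phi> j = i}"
    have "(\<Sum>j\<in>?J. \<integral>\<omega>. (cp (level Z j) \<omega>)\<^sup>2 \<partial>\<Omega>) = (\<integral>\<omega>. (\<Sum>j\<in>?J. (cp (level Z j) \<omega>)\<^sup>2) \<partial>\<Omega>)"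
      using level_sets[OF Z] by (intro Bochner_Integration.integral_sum[symmetric]) auto
    also have "\<dots> \<le> (\<integral>\<omega>. (cp (level Y i) \<omega>)\<^sup>2 \<partial>\<Omega>)"
    proof (rule integral_mono_AE)
      have "AE \<omega> in \<Omega>. cp (level Y i) \<omega> = (\<Sum>j\<in>?J. cp (level Z j) \<omega>)"
        by (rule cp_level_sum[OF Z, where \<phi> = "\<lambda>j. \<phi> j = i"]) (auto simp: level_def ref)
      moreover have "AE \<omega> in \<Omega>. \<forall>j\<in>?J. 0 \<le> cp (level Z j) \<omega>"
        using fin(2) cp_bounds[OF level_sets[OF Z]] by (intro AE_finite_allI) auto
      ultimately show "AE \<omega> in \<Omega>. (\<Sum>j\<in>?J. (cp (level Z j) \<omega>)\<^sup>2) \<le> (cp (level Y i) \<omega>)\<^sup>2"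
      proof eventually_elim
        case (elim \<omega>)
        then show ?case using sum_squares_le_square_sum[of ?J "\<lambda>j. cp (level Z j) \<omega>"] fin(2) by simp
      qed
    qed (use level_sets[OF Y] level_sets[OF Z] in auto)
    finally show "(\<Sum>j\<in>?J. \<integral>\<omega>. (cp (level Z j) \<omega>)\<^sup>2 \<partial>\<Omega>) \<le> (\<integral>\<omega>. (cp (level Y i) \<omega>)\<^sup>2 \<partial>\<Omega>)" .
  qed
  finally show ?thesis .
qed

text \<open>\<open>cpn\<close> of a cell is \<open>cp\<close> of the translated cell, evaluated at
  increments independent of the position at time n. Translation permutes trajectories, so the
  translated partition has the same set of cell names and both sums range over it.\<close>

lemma energy_step:
  assumes Z: "inv_fun Z"
  shows "ennreal (\<Sum>i\<in>Z ` space T. \<integral>\<omega>. (cpn n (level Z i) \<omega>)\<^sup>2 \<partial>\<Omega>) =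
    (\<integral>\<^sup>+\<omega>. ennreal (energy (\<lambda>x. Z (lmult (pos \<omega> n) x))) \<partial>\<Omega>)"
proof -
  note lev [measurable] = level_sets[OF Z]
  have "ennreal (\<integral>\<omega>. (cpn n (level Z i) \<omega>)\<^sup>2 \<partial>\<Omega>) =
      (\<integral>\<^sup>+\<omega>. ennreal (\<integral>\<omega>'. (cp (pull (pos \<omega> n) (level Z i)) \<omega>')\<^sup>2 \<partial>\<Omega>) \<partial>\<Omega>)" for i
  proof -
    define f where "f g \<omega>' = ennreal ((cp (pull g (level Z i)) \<omega>')\<^sup>2)" for g \<omega>'
    have "ennreal (\<integral>\<omega>. (cpn n (level Z i) \<omega>)\<^sup>2 \<partial>\<Omega>) = (\<integral>\<^sup>+\<omega>. ennreal ((cpn n (level Z i) \<omega>)\<^sup>2) \<partial>\<Omega>)"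
      using lev by (intro nn_integral_eq_integral[symmetric]) auto
    also have "\<dots> = (\<integral>\<^sup>+\<omega>. indicator (space \<Omega>) \<omega> * f (pos \<omega> n) (shift n \<omega>) \<partial>\<Omega>)"
      by (intro nn_integral_cong) (simp add: f_def cpn_def)
    also have "\<dots> = (\<integral>\<^sup>+\<omega>. indicator (space \<Omega>) \<omega> * (\<integral>\<^sup>+\<omega>'. f (pos \<omega> n) \<omega>' \<partial>\<Omega>) \<partial>\<Omega>)"
      unfolding f_def by (rule nn_integral_split_pos) (auto simp: past_def)
    also have "\<dots> = (\<integral>\<^sup>+\<omega>. ennreal (\<integral>\<omega>'. (cp (pull (pos \<omega> n) (level Z i)) \<omega>')\<^sup>2 \<partial>\<Omega>) \<partial>\<Omega>)"
    proof (rule nn_integral_cong)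
      fix \<omega> assume "\<omega> \<in> space \<Omega>"
      then show "indicator (space \<Omega>) \<omega> * (\<integral>\<^sup>+\<omega>'. f (pos \<omega> n) \<omega>' \<partial>\<Omega>) =
          ennreal (\<integral>\<omega>'. (cp (pull (pos \<omega> n) (level Z i)) \<omega>')\<^sup>2 \<partial>\<Omega>)"
        unfolding f_def by (subst nn_integral_eq_integral) (auto intro!: integrable_prods sets_pull lev)
    qed
    finally show ?thesis .
  qed
  then have "ennreal (\<Sum>i\<in>Z ` space T. \<integral>\<omega>. (cpn n (level Z i) \<omega>)\<^sup>2 \<partial>\<Omega>) =
      (\<Sum>i\<in>Z ` space T. \<integral>\<^sup>+\<omega>. ennreal (\<integral>\<omega>'. (cp (pull (pos \<omega> n) (level Z i)) \<omega>')\<^sup>2 \<partial>\<Omega>) \<partial>\<Omega>)"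
    by (subst sum_ennreal[symmetric]) auto
  also have "\<dots> = (\<integral>\<^sup>+\<omega>. (\<Sum>i\<in>Z ` space T. ennreal (\<integral>\<omega>'. (cp (pull (pos \<omega> n) (level Z i)) \<omega>')\<^sup>2 \<partial>\<Omega>)) \<partial>\<Omega>)"
  proof (rule nn_integral_sum[symmetric])
    fix i
    show "(\<lambda>\<omega>. ennreal (\<integral>\<omega>'. (cp (pull (pos \<omega> n) (level Z i)) \<omega>')\<^sup>2 \<partial>\<Omega>)) \<in> borel_measurable \<Omega>"
      by (rule measurable_compose[OF measurable_pos]) simp
  qed
  also have "\<dots> = (\<integral>\<^sup>+\<omega>. ennreal (energy (\<lambda>x. Z (lmult (pos \<omega> n) x))) \<partial>\<Omega>)"
    by (intro nn_integral_cong) (simp add: energy_def image_lmult level_lmult sum_ennreal)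
  finally show ?thesis .
qed

end

text \<open>For p \<ge> \<delta> the inequality between arithmetic and geometric mean gives the
  square term plus l / 2. Replacing l / 2 by l p / (2 \<delta>) is essential: summed over cells, the
  p add up to 1 in expectation, whereas a constant would be multiplied by the number of cells. Below
  \<delta> the trivial bound k + p is used.\<close>

lemma abs_diff_split:
  fixes k p :: real
  assumes "0 \<le> k" "0 \<le> p" "0 < l" "0 < \<delta>"
  shows "\<bar>k - p\<bar> \<le> (k - p)\<^sup>2 / (2 * l) + l * p / (2 * \<delta>) + (if p < \<delta> then k + p else 0)"
proof (cases "p < \<delta>")
  case True
  have "0 \<le> (k - p)\<^sup>2 / (2 * l)" "0 \<le> l * p / (2 * \<delta>)" using assms by auto
  moreover have "\<bar>k - p\<bar> \<le> k + p" using assms by linarith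
  ultimately show ?thesis unfolding if_P[OF True] by linarith
next
  case False
  have "0 \<le> (\<bar>k - p\<bar> - l)\<^sup>2" by simp
  then have "2 * l * \<bar>k - p\<bar> \<le> (k - p)\<^sup>2 + l\<^sup>2" by (simp add: power2_diff algebra_simps)
  then have "\<bar>k - p\<bar> \<le> ((k - p)\<^sup>2 + l\<^sup>2) / (2 * l)" using assms by (simp add: field_simps)
  also have "\<dots> = (k - p)\<^sup>2 / (2 * l) + l / 2" using assms by (simp add: field_simps power2_eq_square)
  also have "l / 2 \<le> l * p / (2 * \<delta>)" using False assms by (simp add: field_simps)
  finally show ?thesis using False by simp
qed

section \<open>Conditional independence of invariant events from the past, and its
  consequence\<close>

context strip
begin

text \<open>Along a partition of nearly minimal energy, conditioning on the first \<open>n\<close> steps changes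
  the conditional probabilities of its cells only slightly in \<open>L\<^sup>2\<close>, because the energy of
  the translated partitions averages to at most the infimum. The \<open>L\<^sup>1\<close> bound uses that few
  trajectories lie in cells of small conditional probability.\<close>

lemma near_minimal_partition:
  assumes A: "A \<in> invariant_events G" and "0 < d"
  shows "\<exists>Z \<phi>. inv_fun Z \<and> (\<forall>x\<in>space T. x \<in> A \<longleftrightarrow> \<phi> (Z x)) \<and>
    (\<Sum>i\<in>Z ` space T. \<integral>\<omega>. (cpn n (level Z i) \<omega> - cp (level Z i) \<omega>)\<^sup>2 \<partial>\<Omega>) \<le> d"
proof -
  define m where "m = Inf (energy ` {Y. inv_fun Y})"
  have bdd: "bdd_below (energy ` {Y. inv_fun Y})" using energy_nonneg by (intro bdd_belowI[of _ 0]) auto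
  have ne: "energy ` {Y. inv_fun Y} \<noteq> {}" using inv_fun_of_bool[OF A] by auto
  have m_le: "m \<le> energy Y" if "inv_fun Y" for Y
    unfolding m_def using that by (intro cInf_lower bdd) auto
  have "m < m + d / 2" using \<open>0 < d\<close> by simp
  then obtain Y where Y: "inv_fun Y" "energy Y < m + d / 2"
    using cInf_lessD[OF ne, of "m + d / 2"] unfolding m_def by auto
  \<comment> \<open>For positions outside J the energy is only known to be at most 1, so they
    contribute at most d / 2; the other half of d is the distance of the energy of Y from the
    infimum.\<close>
  obtain J where J: "finite J" "J \<subseteq> carrier G" "P.prob {\<omega> \<in> space \<Omega>. pos \<omega> n \<notin> J} < d / 2"
    using pos_concentrated[of "d / 2" n] \<open>0 < d\<close> by auto
  obtain Z \<phi> where Z: "inv_fun Z" "\<forall>x\<in>space T. x \<in> A \<longleftrightarrow> \<phi> (Z x)"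
    and ref: "\<forall>g\<in>J. \<exists>\<psi>. \<forall>x\<in>space T. Y x = \<psi> (Z (lmult g x))"
    using common_refinement[OF J(1,2) Y(1) A] by auto
  have m0: "0 \<le> m" unfolding m_def using energy_nonneg by (intro cInf_greatest ne) auto
  have Jm: "{\<omega> \<in> space \<Omega>. pos \<omega> n \<notin> J} \<in> sets \<Omega>"
  proof -
    have "{\<omega> \<in> space \<Omega>. pos \<omega> n \<notin> J} = space \<Omega> - (\<Union>q\<in>J. visits q n)" by (auto simp: visits_def)
    moreover have "(\<Union>q\<in>J. visits q n) \<in> sets \<Omega>" using J(1) by (intro sets.finite_UN) auto
    ultimately show ?thesis by (simp add: sets.Diff sets.top)
  qed
  have pt: "energy (\<lambda>x. Z (lmult (pos \<omega> n) x)) \<le> (m + d / 2) + indicator {\<omega> \<in> space \<Omega>. pos \<omega> n \<notin> J} \<omega>"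
    if \<omega>: "\<omega> \<in> space \<Omega>" for \<omega>
  proof (cases "pos \<omega> n \<in> J")
    case True
    then obtain \<psi> where "\<forall>x\<in>space T. Y x = \<psi> (Z (lmult (pos \<omega> n) x))" using ref by blast
    then have "energy (\<lambda>x. Z (lmult (pos \<omega> n) x)) \<le> energy Y"
      using \<omega> by (intro energy_mono[OF Y(1) inv_fun_lmult[OF Z(1)], where \<phi> = \<psi>]) auto
    then show ?thesis using Y(2) by (simp split: split_indicator)
  next
    case False
    have "energy (\<lambda>x. Z (lmult (pos \<omega> n) x)) \<le> 1"
      using \<omega> by (intro energy_le_1 inv_fun_lmult Z(1)) auto
    then show ?thesis using False \<omega> m0 \<open>0 < d\<close> by simp
  qed
  let ?e = "\<Sum>i\<in>Z ` space T. \<integral>\<omega>. (cpn n (level Z i) \<omega>)\<^sup>2 \<partial>\<Omega>"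
  have "ennreal ?e \<le> (\<integral>\<^sup>+\<omega>. ennreal (m + d / 2) + indicator {\<omega> \<in> space \<Omega>. pos \<omega> n \<notin> J} \<omega> \<partial>\<Omega>)"
    unfolding energy_step[OF Z(1)]
  proof (rule nn_integral_mono)
    fix \<omega> assume "\<omega> \<in> space \<Omega>"
    have "ennreal (energy (\<lambda>x. Z (lmult (pos \<omega> n) x))) \<le>
        ennreal ((m + d / 2) + indicator {\<omega> \<in> space \<Omega>. pos \<omega> n \<notin> J} \<omega>)"
      by (rule ennreal_leI[OF pt[OF \<open>\<omega> \<in> space \<Omega>\<close>]])
    also have "\<dots> = ennreal (m + d / 2) + indicator {\<omega> \<in> space \<Omega>. pos \<omega> n \<notin> J} \<omega>"
      using m0 \<open>0 < d\<close> by (simp add: ennreal_plus split: split_indicator)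
    finally show "ennreal (energy (\<lambda>x. Z (lmult (pos \<omega> n) x))) \<le>
        ennreal (m + d / 2) + indicator {\<omega> \<in> space \<Omega>. pos \<omega> n \<notin> J} \<omega>" .
  qed
  also have "\<dots> = ennreal (m + d / 2) + emeasure \<Omega> {\<omega> \<in> space \<Omega>. pos \<omega> n \<notin> J}"
    using Jm by (subst nn_integral_add) (auto simp: P.emeasure_space_1)
  also have "\<dots> \<le> ennreal (m + d)"
  proof -
    have "emeasure \<Omega> {\<omega> \<in> space \<Omega>. pos \<omega> n \<notin> J} \<le> ennreal (d / 2)"
      using J(3) by (simp add: P.emeasure_eq_measure ennreal_leI)
    then have "ennreal (m + d / 2) + emeasure \<Omega> {\<omega> \<in> space \<Omega>. pos \<omega> n \<notin> J} \<le> ennreal (m + d / 2) + ennreal (d / 2)"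
      by (rule add_left_mono)
    also have "\<dots> = ennreal (m + d)"
      using m0 \<open>0 < d\<close> by (subst ennreal_plus[symmetric]) auto
    finally show ?thesis .
  qed
  finally have "?e \<le> m + d" using m0 \<open>0 < d\<close> by (subst (asm) ennreal_le_iff) auto
  moreover have "m \<le> (\<Sum>i\<in>Z ` space T. \<integral>\<omega>. (cp (level Z i) \<omega>)\<^sup>2 \<partial>\<Omega>)"
    using m_le[OF Z(1)] by (simp add: energy_def)
  moreover have "(\<Sum>i\<in>Z ` space T. \<integral>\<omega>. (cpn n (level Z i) \<omega> - cp (level Z i) \<omega>)\<^sup>2 \<partial>\<Omega>) =
      ?e - (\<Sum>i\<in>Z ` space T. \<integral>\<omega>. (cp (level Z i) \<omega>)\<^sup>2 \<partial>\<Omega>)"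
    using Z(1) by (subst sum_subtractf[symmetric], intro sum.cong refl cpn_cp_orthogonal) (auto simp: inv_fun_def)
  ultimately have "(\<Sum>i\<in>Z ` space T. \<integral>\<omega>. (cpn n (level Z i) \<omega> - cp (level Z i) \<omega>)\<^sup>2 \<partial>\<Omega>) \<le> d" by linarith
  then show ?thesis using Z by blast
qed

text \<open>A is a union of cells of the partition Z from \<open>near_minimal_partition\<close>, so
  the two sides differ by at most the sum over all cells of the mean absolute difference of
  \<open>cpn\<close> and \<open>cp\<close>. The three terms of \<open>abs_diff_split\<close> are
  summed using near minimality, total probability one, and \<open>partition_atoms\<close>.\<close>

lemma past_independent:
  assumes A: "A \<in> invariant_events G" and C [measurable]: "C \<in> sets \<Omega>" and past: "past n (\<lambda>\<omega>. \<omega> \<in> C)"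
  shows "P.prob (ev A \<inter> C) = (\<integral>\<omega>. indicator C \<omega> * cp A \<omega> \<partial>\<Omega>)"
proof -
  have AT: "A \<in> sets T" using A by (rule invariant_sets)
  have "\<bar>P.prob (ev A \<inter> C) - (\<integral>\<omega>. indicator C \<omega> * cp A \<omega> \<partial>\<Omega>)\<bar> \<le> 0 + \<epsilon>" if "0 < \<epsilon>" for \<epsilon> :: real
  proof -
    define e where "e = \<epsilon> / 4"
    have e: "0 < e" using that by (simp add: e_def)
    obtain \<delta> where \<delta>: "0 < \<delta>" and small: "\<And>A I. finite (I :: nat set) \<Longrightarrow> (\<forall>i\<in>I. A i \<in> invariant_events G) \<Longrightarrow>
      disjoint_family_on A I \<Longrightarrow> (\<Sum>i\<in>I. P.prob {\<omega> \<in> ev (A i). cp (A i) \<omega> < \<delta>}) \<le> e"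
      using partition_atoms[OF e] by blast
    \<comment> \<open>With this l the three sums are at most e / 2, e and 2 e, together at most
      \<epsilon> = 4 e.\<close>
    define l where "l = 2 * \<delta> * e"
    have l: "0 < l" using e \<delta> by (simp add: l_def)
    obtain Z \<phi> where Z: "inv_fun Z" "\<forall>x\<in>space T. x \<in> A \<longleftrightarrow> \<phi> (Z x)"
      and dz: "(\<Sum>i\<in>Z ` space T. \<integral>\<omega>. (cpn n (level Z i) \<omega> - cp (level Z i) \<omega>)\<^sup>2 \<partial>\<Omega>) \<le> l * e"
      using near_minimal_partition[OF A, of "l * e" n] l e by auto
    note levT [measurable] = level_sets[OF Z(1)]
    have levI: "level Z i \<in> invariant_events G" for i using Z(1) by (auto simp: inv_fun_def)
    have fin: "finite (Z ` space T)" using Z(1) by (simp add: inv_fun_def)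
    let ?I = "Z ` space T"
    let ?J = "{j \<in> ?I. \<phi> j}"
    have lhs: "P.prob (ev A \<inter> C) = (\<Sum>j\<in>?J. \<integral>\<omega>. indicator C \<omega> * cpn n (level Z j) \<omega> \<partial>\<Omega>)"
    proof -
      have "ev A \<inter> C = (\<Union>j\<in>?J. C \<inter> ev (level Z j) \<inter> space \<Omega>)"
        using Z(2) sets.sets_into_space[OF AT] by (auto simp: ev_def level_def)
      then have "P.prob (ev A \<inter> C) = P.prob (\<Union>j\<in>?J. C \<inter> ev (level Z j) \<inter> space \<Omega>)" by simp
      also have "\<dots> = (\<Sum>j\<in>?J. P.prob (C \<inter> ev (level Z j) \<inter> space \<Omega>))"
      proof (rule P.finite_measure_finite_Union)
        show "disjoint_family_on (\<lambda>j. C \<inter> ev (level Z j) \<inter> space \<Omega>) ?J"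
          by (auto simp: disjoint_family_on_def ev_def level_def)
        show "(\<lambda>j. C \<inter> ev (level Z j) \<inter> space \<Omega>) ` ?J \<subseteq> sets \<Omega>" using levT by auto
      qed (use fin in simp)
      also have "\<dots> = (\<Sum>j\<in>?J. \<integral>\<omega>. indicator (C \<inter> space \<Omega>) \<omega> * cpn n (level Z j) \<omega> \<partial>\<Omega>)"
        using sets.top[of F] by (intro sum.cong refl cpn_int[symmetric] levI C past) simp
      also have "C \<inter> space \<Omega> = C" using sets.sets_into_space[OF C] by auto
      finally show ?thesis .
    qed
    have rhs: "(\<integral>\<omega>. indicator C \<omega> * cp A \<omega> \<partial>\<Omega>) = (\<Sum>j\<in>?J. \<integral>\<omega>. indicator C \<omega> * cp (level Z j) \<omega> \<partial>\<Omega>)"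
    proof -
      have "AE \<omega> in \<Omega>. cp A \<omega> = (\<Sum>j\<in>?J. cp (level Z j) \<omega>)"
        using Z(2) sets.sets_into_space[OF AT] by (intro cp_level_sum[OF Z(1)]) auto
      then have "(\<integral>\<omega>. indicator C \<omega> * cp A \<omega> \<partial>\<Omega>) = (\<integral>\<omega>. (\<Sum>j\<in>?J. indicator C \<omega> * cp (level Z j) \<omega>) \<partial>\<Omega>)"
        by (intro integral_cong_AE) (auto simp: sum_distrib_left elim!: eventually_mono)
      also have "\<dots> = (\<Sum>j\<in>?J. \<integral>\<omega>. indicator C \<omega> * cp (level Z j) \<omega> \<partial>\<Omega>)"
        using integrable_mult_indicator[OF C integrable_cp[OF levT]]
        by (intro Bochner_Integration.integral_sum) simp
      finally show ?thesis .
    qed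
    have cell_bound: "\<bar>(\<integral>\<omega>. indicator C \<omega> * cpn n (level Z j) \<omega> \<partial>\<Omega>) - (\<integral>\<omega>. indicator C \<omega> * cp (level Z j) \<omega> \<partial>\<Omega>)\<bar>
        \<le> (\<integral>\<omega>. (cpn n (level Z j) \<omega> - cp (level Z j) \<omega>)\<^sup>2 \<partial>\<Omega>) / (2 * l) + l * P.prob (ev (level Z j)) / (2 * \<delta>) +
          2 * P.prob {\<omega> \<in> ev (level Z j). cp (level Z j) \<omega> < \<delta>}" for j
    proof -
      let ?k = "cpn n (level Z j)" and ?p = "cp (level Z j)"
      define D where "D = {\<omega> \<in> space \<Omega>. ?p \<omega> < \<delta>}"
      have DF: "D \<in> sets F"
      proof -
        have "{\<omega> \<in> space F. ?p \<omega> < \<delta>} \<in> sets F" by measurable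
        then show ?thesis by (simp add: D_def)
      qed
      then have D\<Omega> [measurable]: "D \<in> sets \<Omega>" using subalgebra_F by (auto simp: subalgebra_def)
      have int: "integrable \<Omega> ?k" "integrable \<Omega> ?p" using levT by auto
      have intC: "integrable \<Omega> (\<lambda>\<omega>. indicator E \<omega> * ?k \<omega>)" "integrable \<Omega> (\<lambda>\<omega>. indicator E \<omega> * ?p \<omega>)"
        if "E \<in> sets \<Omega>" for E
        using integrable_mult_indicator[OF that int(1)] integrable_mult_indicator[OF that int(2)] by auto
      have intsq: "integrable \<Omega> (\<lambda>\<omega>. (?k \<omega> - ?p \<omega>)\<^sup>2)"
      proof -
        have "integrable \<Omega> (\<lambda>\<omega>. (?k \<omega>)\<^sup>2 + (?p \<omega>)\<^sup>2 - 2 * (?p \<omega> * ?k \<omega>))" using levT by auto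
        then show ?thesis by (simp add: power2_diff mult.assoc mult.commute[of "?k _"])
      qed
      have Dev: "ev (level Z j) \<inter> D = {\<omega> \<in> ev (level Z j). ?p \<omega> < \<delta>}" by (auto simp: D_def ev_def)
      \<comment> \<open>As D belongs to \<open>F\<close>, \<open>cpn\<close> and \<open>cp\<close>
        have the same integral over it; this is the origin of the factor 2 in
        \<open>cell_bound\<close>.\<close>
      have kD: "(\<integral>\<omega>. indicator D \<omega> * ?k \<omega> \<partial>\<Omega>) = P.prob {\<omega> \<in> ev (level Z j). ?p \<omega> < \<delta>}"
      proof -
        have "(\<integral>\<omega>. indicator (space \<Omega> \<inter> D) \<omega> * ?k \<omega> \<partial>\<Omega>) = P.prob (space \<Omega> \<inter> ev (level Z j) \<inter> D)"
          by (intro cpn_int levI DF) (auto simp: past_def)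
        moreover have "space \<Omega> \<inter> D = D" "space \<Omega> \<inter> ev (level Z j) \<inter> D = ev (level Z j) \<inter> D"
          by (auto simp: D_def)
        ultimately show ?thesis by (simp add: Dev)
      qed
      have pD: "(\<integral>\<omega>. indicator D \<omega> * ?p \<omega> \<partial>\<Omega>) = P.prob {\<omega> \<in> ev (level Z j). ?p \<omega> < \<delta>}"
        using cp_int[OF levT DF] by (simp add: Dev)
      have "\<bar>(\<integral>\<omega>. indicator C \<omega> * ?k \<omega> \<partial>\<Omega>) - (\<integral>\<omega>. indicator C \<omega> * ?p \<omega> \<partial>\<Omega>)\<bar> =
          \<bar>\<integral>\<omega>. indicator C \<omega> * ?k \<omega> - indicator C \<omega> * ?p \<omega> \<partial>\<Omega>\<bar>"
        using intC[OF C] by simp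
      also have "\<dots> \<le> (\<integral>\<omega>. \<bar>indicator C \<omega> * ?k \<omega> - indicator C \<omega> * ?p \<omega>\<bar> \<partial>\<Omega>)"
        by (rule integral_abs_bound)
      also have "\<dots> \<le> (\<integral>\<omega>. (?k \<omega> - ?p \<omega>)\<^sup>2 / (2 * l) + l * ?p \<omega> / (2 * \<delta>) +
          (indicator D \<omega> * ?k \<omega> + indicator D \<omega> * ?p \<omega>) \<partial>\<Omega>)"
      proof (rule integral_mono_AE)
        show "AE \<omega> in \<Omega>. \<bar>indicator C \<omega> * ?k \<omega> - indicator C \<omega> * ?p \<omega>\<bar> \<le>
            (?k \<omega> - ?p \<omega>)\<^sup>2 / (2 * l) + l * ?p \<omega> / (2 * \<delta>) + (indicator D \<omega> * ?k \<omega> + indicator D \<omega> * ?p \<omega>)"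
          using cpn_bounds[OF levT, of n j] cp_bounds[OF levT, of j] AE_space
        proof eventually_elim
          case (elim \<omega>)
          have "\<bar>indicator C \<omega> * ?k \<omega> - indicator C \<omega> * ?p \<omega>\<bar> \<le> \<bar>?k \<omega> - ?p \<omega>\<bar>"
            by (simp split: split_indicator)
          also have "\<dots> \<le> (?k \<omega> - ?p \<omega>)\<^sup>2 / (2 * l) + l * ?p \<omega> / (2 * \<delta>) + (if ?p \<omega> < \<delta> then ?k \<omega> + ?p \<omega> else 0)"
            using elim l \<delta> by (intro abs_diff_split) auto
          also have "(if ?p \<omega> < \<delta> then ?k \<omega> + ?p \<omega> else 0) = indicator D \<omega> * ?k \<omega> + indicator D \<omega> * ?p \<omega>"
            using elim by (simp add: D_def)
          finally show ?case .
        qed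
      qed (use intC intsq int C D\<Omega> in auto)
      also have "\<dots> = (\<integral>\<omega>. (?k \<omega> - ?p \<omega>)\<^sup>2 \<partial>\<Omega>) / (2 * l) + l * (\<integral>\<omega>. ?p \<omega> \<partial>\<Omega>) / (2 * \<delta>) +
          ((\<integral>\<omega>. indicator D \<omega> * ?k \<omega> \<partial>\<Omega>) + (\<integral>\<omega>. indicator D \<omega> * ?p \<omega> \<partial>\<Omega>))"
        using intC[OF D\<Omega>] intsq int by simp
      also have "\<dots> = (\<integral>\<omega>. (?k \<omega> - ?p \<omega>)\<^sup>2 \<partial>\<Omega>) / (2 * l) + l * P.prob (ev (level Z j)) / (2 * \<delta>) +
          2 * P.prob {\<omega> \<in> ev (level Z j). ?p \<omega> < \<delta>}"
        by (simp add: kD pD cp_integral[OF levT])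
      finally show ?thesis .
    qed
    have "\<bar>P.prob (ev A \<inter> C) - (\<integral>\<omega>. indicator C \<omega> * cp A \<omega> \<partial>\<Omega>)\<bar> \<le>
        (\<Sum>j\<in>?J. \<bar>(\<integral>\<omega>. indicator C \<omega> * cpn n (level Z j) \<omega> \<partial>\<Omega>) - (\<integral>\<omega>. indicator C \<omega> * cp (level Z j) \<omega> \<partial>\<Omega>)\<bar>)"
      unfolding lhs rhs sum_subtractf[symmetric] by (rule sum_abs)
    also have "\<dots> \<le> (\<Sum>j\<in>?I. \<bar>(\<integral>\<omega>. indicator C \<omega> * cpn n (level Z j) \<omega> \<partial>\<Omega>) - (\<integral>\<omega>. indicator C \<omega> * cp (level Z j) \<omega> \<partial>\<Omega>)\<bar>)"
      using fin by (intro sum_mono2) auto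
    also have "\<dots> \<le> (\<Sum>j\<in>?I. (\<integral>\<omega>. (cpn n (level Z j) \<omega> - cp (level Z j) \<omega>)\<^sup>2 \<partial>\<Omega>) / (2 * l) +
        l * P.prob (ev (level Z j)) / (2 * \<delta>) + 2 * P.prob {\<omega> \<in> ev (level Z j). cp (level Z j) \<omega> < \<delta>})"
      by (intro sum_mono cell_bound)
    also have "\<dots> = (\<Sum>j\<in>?I. \<integral>\<omega>. (cpn n (level Z j) \<omega> - cp (level Z j) \<omega>)\<^sup>2 \<partial>\<Omega>) / (2 * l) +
        l * (\<Sum>j\<in>?I. P.prob (ev (level Z j))) / (2 * \<delta>) +
        2 * (\<Sum>j\<in>?I. P.prob {\<omega> \<in> ev (level Z j). cp (level Z j) \<omega> < \<delta>})"
      by (simp add: sum.distrib sum_divide_distrib sum_distrib_left)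
    also have "\<dots> \<le> l * e / (2 * l) + l * 1 / (2 * \<delta>) + 2 * e"
    proof (intro add_mono)
      show "(\<Sum>j\<in>?I. \<integral>\<omega>. (cpn n (level Z j) \<omega> - cp (level Z j) \<omega>)\<^sup>2 \<partial>\<Omega>) / (2 * l) \<le> l * e / (2 * l)"
        using dz l by (intro divide_right_mono) auto
      show "l * (\<Sum>j\<in>?I. P.prob (ev (level Z j))) / (2 * \<delta>) \<le> l * 1 / (2 * \<delta>)"
        by (simp only: sum_prob_level[OF Z(1)])
      show "2 * (\<Sum>j\<in>?I. P.prob {\<omega> \<in> ev (level Z j). cp (level Z j) \<omega> < \<delta>}) \<le> 2 * e"
        using small[OF fin, of "level Z"] levI disjoint_level by simp
    qed
    also have "\<dots> \<le> \<epsilon>" using l \<delta> e by (simp add: l_def e_def)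
    finally show ?thesis by simp
  qed
  then have "\<bar>P.prob (ev A \<inter> C) - (\<integral>\<omega>. indicator C \<omega> * cp A \<omega> \<partial>\<Omega>)\<bar> \<le> 0"
    by (rule field_le_epsilon)
  then show ?thesis by simp
qed

text \<open>Approximating \<open>ev A\<close> by events of finitely many steps extends
  \<open>past_independent\<close> to C = \<open>ev A\<close>: P(\<open>ev A\<close>) is the integral
  of \<open>cp A\<close> over \<open>ev A\<close>. Hence \<open>cp A\<close> = 1 almost everywhere
  on \<open>ev A\<close>. The event B = {cp A = 1} lies in the subalgebra, contains
  \<open>ev A\<close> up to a null set, and meets it in probability P(B), the integral of
  \<open>cp A\<close> over B.\<close>

theorem invariant_event_in_subalgebra:
  assumes A: "A \<in> invariant_events G"
  shows "\<exists>B\<in>sets Bm. P.prob (sym_diff (ev A) (ev B)) = 0"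
proof -
  have AT: "A \<in> sets T" using A by (rule invariant_sets)
  have evA [measurable]: "ev A \<in> sets \<Omega>" using AT by (rule sets_ev)
  have "\<bar>P.prob (ev A) - (\<integral>\<omega>. indicator (ev A) \<omega> * cp A \<omega> \<partial>\<Omega>)\<bar> \<le> 0 + \<epsilon>" if "0 < \<epsilon>" for \<epsilon> :: real
  proof -
    obtain n C where C: "C \<in> sets \<Omega>" "past n (\<lambda>\<omega>. \<omega> \<in> C)" "P.prob (sym_diff (ev A) C) < \<epsilon> / 2"
      using past_approx[OF evA, of "\<epsilon> / 2"] \<open>0 < \<epsilon>\<close> by (metis half_gt_zero)
    note [measurable] = C(1)
    have 1: "\<bar>P.prob (ev A) - P.prob (ev A \<inter> C)\<bar> \<le> \<epsilon> / 2"
    proof -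
      have "P.prob (ev A) - P.prob (ev A \<inter> C) = P.prob (ev A - ev A \<inter> C)"
        by (rule P.finite_measure_Diff[symmetric]) auto
      moreover have "P.prob (ev A - ev A \<inter> C) \<le> P.prob (sym_diff (ev A) C)"
        by (intro P.finite_measure_mono) auto
      ultimately show ?thesis using C(3) measure_nonneg[of \<Omega> "ev A - ev A \<inter> C"] by linarith
    qed
    have int: "integrable \<Omega> (\<lambda>\<omega>. indicator E \<omega> * cp A \<omega>)" if "E \<in> sets \<Omega>" for E
      using integrable_mult_indicator[OF that integrable_cp[OF AT]] by simp
    have 2: "\<bar>(\<integral>\<omega>. indicator C \<omega> * cp A \<omega> \<partial>\<Omega>) - (\<integral>\<omega>. indicator (ev A) \<omega> * cp A \<omega> \<partial>\<Omega>)\<bar> \<le> \<epsilon> / 2"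
    proof -
      have "\<bar>(\<integral>\<omega>. indicator C \<omega> * cp A \<omega> \<partial>\<Omega>) - (\<integral>\<omega>. indicator (ev A) \<omega> * cp A \<omega> \<partial>\<Omega>)\<bar> =
          \<bar>\<integral>\<omega>. indicator C \<omega> * cp A \<omega> - indicator (ev A) \<omega> * cp A \<omega> \<partial>\<Omega>\<bar>"
        using int by simp
      also have "\<dots> \<le> (\<integral>\<omega>. \<bar>indicator C \<omega> * cp A \<omega> - indicator (ev A) \<omega> * cp A \<omega>\<bar> \<partial>\<Omega>)"
        by (rule integral_abs_bound)
      also have "\<dots> \<le> (\<integral>\<omega>. indicator (sym_diff (ev A) C) \<omega> \<partial>\<Omega>)"
      proof (rule integral_mono_AE)
        show "AE \<omega> in \<Omega>. \<bar>indicator C \<omega> * cp A \<omega> - indicator (ev A) \<omega> * cp A \<omega>\<bar> \<le> indicator (sym_diff (ev A) C) \<omega>"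
          using cp_bounds[OF AT] by eventually_elim (auto split: split_indicator)
      qed (use int in \<open>auto simp: P.emeasure_eq_measure\<close>)
      also have "\<dots> = P.prob (sym_diff (ev A) C)"
        by (subst Bochner_Integration.integral_indicator) (auto simp: P.emeasure_eq_measure)
      finally show ?thesis using C(3) by simp
    qed
    show ?thesis using 1 2 past_independent[OF A C(1,2)] by linarith
  qed
  then have "\<bar>P.prob (ev A) - (\<integral>\<omega>. indicator (ev A) \<omega> * cp A \<omega> \<partial>\<Omega>)\<bar> \<le> 0"
    by (rule field_le_epsilon)
  then have eq: "P.prob (ev A) = (\<integral>\<omega>. indicator (ev A) \<omega> * cp A \<omega> \<partial>\<Omega>)" by simp
  have int: "integrable \<Omega> (\<lambda>\<omega>. indicator (ev A) \<omega> * cp A \<omega>)"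
    using integrable_mult_indicator[OF evA integrable_cp[OF AT]] by simp
  have "(\<integral>\<omega>. indicator (ev A) \<omega> - indicator (ev A) \<omega> * cp A \<omega> \<partial>\<Omega>) = 0"
    using eq int integrable_ind[OF AT] by (simp add: P.emeasure_eq_measure)
  then have "AE \<omega> in \<Omega>. indicator (ev A) \<omega> - indicator (ev A) \<omega> * cp A \<omega> = 0"
  proof (subst (asm) integral_nonneg_eq_0_iff_AE)
    show "integrable \<Omega> (\<lambda>\<omega>. indicator (ev A) \<omega> - indicator (ev A) \<omega> * cp A \<omega>)"
      using int integrable_ind[OF AT] by simp
    show "AE \<omega> in \<Omega>. 0 \<le> indicator (ev A) \<omega> - indicator (ev A) \<omega> * cp A \<omega>"
      using cp_bounds[OF AT] by eventually_elim (auto split: split_indicator)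
  qed
  then have one: "AE \<omega> in \<Omega>. \<omega> \<in> ev A \<longrightarrow> cp A \<omega> = 1"
    by eventually_elim (auto split: split_indicator_asm)
  have "{\<omega> \<in> space F. cp A \<omega> = 1} \<in> sets F" by measurable
  then obtain B where B: "B \<in> sets Bm" "ev B = {\<omega> \<in> space \<Omega>. cp A \<omega> = 1}" by (auto simp: sets_F)
  have BF: "ev B \<in> sets F" using B(1) by (simp add: sets_F)
  have [measurable]: "ev B \<in> sets \<Omega>" using B(1) by (intro sets_ev Bm_T)
  have "P.prob (ev A - ev B) = 0"
  proof -
    have "AE \<omega> in \<Omega>. \<omega> \<notin> ev A - ev B" using one AE_space by eventually_elim (auto simp: B(2))
    then show ?thesis by (subst P.prob_eq_0) auto
  qed
  moreover have "P.prob (ev B - ev A) = 0"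
  proof -
    have "P.prob (ev A \<inter> ev B) = (\<integral>\<omega>. indicator (ev B) \<omega> * cp A \<omega> \<partial>\<Omega>)"
      using cp_int[OF AT BF] by simp
    also have "\<dots> = (\<integral>\<omega>. indicator (ev B) \<omega> \<partial>\<Omega>)"
      by (rule Bochner_Integration.integral_cong) (auto simp: B(2) split: split_indicator)
    also have "\<dots> = P.prob (ev B)"
      by (subst Bochner_Integration.integral_indicator) (auto simp: P.emeasure_eq_measure)
    finally have "P.prob (ev B) - P.prob (ev B \<inter> ev A) = 0" by (simp add: Int_commute)
    moreover have "P.prob (ev B - ev B \<inter> ev A) = P.prob (ev B) - P.prob (ev B \<inter> ev A)"
      by (rule P.finite_measure_Diff) auto
    moreover have "ev B - ev B \<inter> ev A = ev B - ev A" by auto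
    ultimately show ?thesis by simp
  qed
  moreover have "P.prob (sym_diff (ev A) (ev B)) \<le> P.prob (ev A - ev B) + P.prob (ev B - ev A)"
    by (rule measure_Un_le) auto
  ultimately have "P.prob (sym_diff (ev A) (ev B)) = 0"
    using measure_nonneg[of \<Omega> "sym_diff (ev A) (ev B)"] by linarith
  then show ?thesis using B(1) by blast
qed

end

section \<open>Random walks on the integers\<close>

context random_walk
begin

lemma distr_shift: "distr \<Omega> \<Omega> (shift n) = \<Omega>"
proof (rule measure_eqI)
  fix A assume "A \<in> sets (distr \<Omega> \<Omega> (shift n))"
  then have A [measurable]: "A \<in> sets \<Omega>" by simp
  have "emeasure (distr \<Omega> \<Omega> (shift n)) A = (\<integral>\<^sup>+\<omega>. indicator A \<omega> \<partial>distr \<Omega> \<Omega> (shift n))" by simp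
  also have "\<dots> = (\<integral>\<^sup>+\<omega>. indicator A (shift n \<omega>) \<partial>\<Omega>)" by (rule nn_integral_distr) auto
  also have "\<dots> = (\<integral>\<^sup>+\<omega>. indicator A \<omega> \<partial>\<Omega>)" by (rule nn_integral_shift) auto
  finally show "emeasure (distr \<Omega> \<Omega> (shift n)) A = emeasure \<Omega> A" by simp
qed simp

lemma
  fixes f :: "(nat \<Rightarrow> 'a) \<Rightarrow> real"
  assumes "integrable \<Omega> f"
  shows integrable_shift: "integrable \<Omega> (\<lambda>\<omega>. f (shift n \<omega>))"
    and integral_shift: "(\<integral>\<omega>. f (shift n \<omega>) \<partial>\<Omega>) = (\<integral>\<omega>. f \<omega> \<partial>\<Omega>)"
proof -
  have [measurable]: "f \<in> borel_measurable \<Omega>" using assms by simp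
  show "integrable \<Omega> (\<lambda>\<omega>. f (shift n \<omega>))"
    using integrable_distr[OF measurable_shift, of n f] assms by (simp add: distr_shift)
  show "(\<integral>\<omega>. f (shift n \<omega>) \<partial>\<Omega>) = (\<integral>\<omega>. f \<omega> \<partial>\<Omega>)"
    using integral_distr[OF measurable_shift, of f n] by (simp add: distr_shift)
qed

lemma distr_coord: "distr \<Omega> \<mu> (\<lambda>\<omega>. \<omega> i) = \<mu>"
  by (rule distr_PiM_component) (simp_all add: prob_space)

lemma
  fixes h :: "'a \<Rightarrow> real"
  assumes "integrable \<mu> h"
  shows integrable_coord: "integrable \<Omega> (\<lambda>\<omega>. h (\<omega> i))"
    and integral_coord: "(\<integral>\<omega>. h (\<omega> i) \<partial>\<Omega>) = (\<integral>x. h x \<partial>\<mu>)"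
proof -
  have c: "(\<lambda>\<omega>. \<omega> i) \<in> measurable \<Omega> \<mu>" by measurable
  have [measurable]: "h \<in> borel_measurable \<mu>" using assms by simp
  show "integrable \<Omega> (\<lambda>\<omega>. h (\<omega> i))"
    using integrable_distr[OF c, of h] assms by (simp add: distr_coord)
  show "(\<integral>\<omega>. h (\<omega> i) \<partial>\<Omega>) = (\<integral>x. h x \<partial>\<mu>)"
    using integral_distr[OF c, of h] by (simp add: distr_coord)
qed

lemma integral_split_indicator:
  assumes f: "integrable \<Omega> f" and past: "past n f" and B [measurable]: "B \<in> sets \<Omega>"
  shows "(\<integral>\<omega>. f \<omega> * indicator B (shift n \<omega>) \<partial>\<Omega>) = (\<integral>\<omega>. f \<omega> \<partial>\<Omega>) * P.prob B"
proof -
  have [measurable]: "f \<in> borel_measurable \<Omega>" using f by simp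
  have ind: "integrable \<Omega> (\<lambda>\<omega>. f \<omega> * indicator B (shift n \<omega>))"
  proof (rule Bochner_Integration.integrable_bound[OF f])
    show "AE \<omega> in \<Omega>. norm (f \<omega> * indicator B (shift n \<omega>)) \<le> norm (f \<omega>)"
      by (auto split: split_indicator)
  qed measurable
  \<comment> \<open>Since \<open>ennreal\<close> truncates negative numbers to 0, s = 1 and s = -1
    give the positive and the negative part.\<close>
  have part: "enn2real (\<integral>\<^sup>+\<omega>. ennreal (s * (f \<omega> * indicator B (shift n \<omega>))) \<partial>\<Omega>) =
      enn2real (\<integral>\<^sup>+\<omega>. ennreal (s * f \<omega>) \<partial>\<Omega>) * P.prob B" for s :: real
  proof -
    have "(\<integral>\<^sup>+\<omega>. ennreal (s * (f \<omega> * indicator B (shift n \<omega>))) \<partial>\<Omega>) =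
        (\<integral>\<^sup>+\<omega>. ennreal (s * f \<omega>) * indicator B (shift n \<omega>) \<partial>\<Omega>)"
      by (intro nn_integral_cong) (auto split: split_indicator)
    also have "\<dots> = (\<integral>\<^sup>+\<omega>. ennreal (s * f \<omega>) \<partial>\<Omega>) * (\<integral>\<^sup>+\<omega>. indicator B \<omega> \<partial>\<Omega>)"
      by (intro nn_integral_split_mult past_compose[OF past]) measurable
    finally show ?thesis by (simp add: enn2real_mult P.emeasure_eq_measure)
  qed
  show ?thesis
    unfolding real_lebesgue_integral_def[OF ind] real_lebesgue_integral_def[OF f]
    using part[of 1] part[of "-1"] by (simp add: algebra_simps)
qed

text \<open>Garsia's proof of the maximal ergodic inequality.\<close>

primrec running_max :: "('a \<Rightarrow> real) \<Rightarrow> nat \<Rightarrow> (nat \<Rightarrow> 'a) \<Rightarrow> real" where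
  "running_max h 0 = (\<lambda>\<omega>. 0)"
| "running_max h (Suc n) = (\<lambda>\<omega>. max 0 (running_max h n (shift 1 \<omega>) - h (\<omega> 0)))"

lemma partial_sum_shift: "(\<Sum>i<Suc k. h (\<omega> i)) = h (\<omega> 0) + (\<Sum>i<k. h (shift 1 \<omega> i) :: real)"
  by (subst sum.lessThan_Suc_shift) (simp add: shift_def)

lemma running_max_nonneg: "0 \<le> running_max h n \<omega>"
  by (cases n) auto

lemma running_max_ge: "k \<le> n \<Longrightarrow> - (\<Sum>i<k. h (\<omega> i)) \<le> running_max h n \<omega>"
proof (induction n arbitrary: k \<omega>)
  case (Suc n)
  show ?case
  proof (cases k)
    case (Suc j)
    then have "- (\<Sum>i<j. h (shift 1 \<omega> i)) \<le> running_max h n (shift 1 \<omega>)"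
      using Suc.IH[of j "shift 1 \<omega>"] Suc.prems by simp
    then show ?thesis unfolding Suc partial_sum_shift by simp
  qed simp
qed simp

lemma running_max_mono: "running_max h n \<omega> \<le> running_max h (Suc n) \<omega>"
proof (induction n arbitrary: \<omega>)
  case (Suc n)
  show ?case using Suc[of "shift 1 \<omega>"] by simp
qed simp

lemma integrable_running_max: "integrable \<mu> h \<Longrightarrow> integrable \<Omega> (running_max h n)"
proof (induction n)
  case (Suc n)
  then have "integrable \<Omega> (\<lambda>\<omega>. running_max h n (shift 1 \<omega>) - h (\<omega> 0))"
    by (intro Bochner_Integration.integrable_diff integrable_shift integrable_coord) auto
  then show ?case by simp
qed simp

text \<open>The set Z of sequences with partial sums unbounded below is insensitive to the first
  increment. Garsia's inequality on Z therefore yields that the integral of h (\<omega> 0) over Z is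
  at most 0, while independence of Z from the first increment makes this integral equal to the
  positive mean times P(Z).\<close>

lemma partial_sums_bounded_below:
  fixes h :: "'a \<Rightarrow> real"
  assumes h: "integrable \<mu> h" and pos: "0 < (\<integral>x. h x \<partial>\<mu>)"
  shows "AE \<omega> in \<Omega>. \<exists>c. \<forall>n. c \<le> (\<Sum>i<n. h (\<omega> i))"
proof -
  have hm [measurable]: "h \<in> borel_measurable \<mu>" using h by simp
  have [measurable]: "(\<lambda>\<omega>. h (\<omega> i)) \<in> borel_measurable \<Omega>" for i
    using integrable_coord[OF h, of i] by simp
  have [measurable]: "running_max h n \<in> borel_measurable \<Omega>" for n
    using integrable_running_max[OF h, of n] by simp
  define Z where "Z = {\<omega> \<in> space \<Omega>. \<forall>c::nat. \<exists>n. (\<Sum>i<n. h (\<omega> i)) < - real c}"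
  have Z [measurable]: "Z \<in> sets \<Omega>" unfolding Z_def by measurable
  have Zshift: "shift 1 \<omega> \<in> Z \<longleftrightarrow> \<omega> \<in> Z" if \<omega>: "\<omega> \<in> space \<Omega>" for \<omega>
  proof -
    obtain c0 :: nat where c0: "\<bar>h (\<omega> 0)\<bar> \<le> real c0" using real_arch_simple by blast
    have "shift 1 \<omega> \<in> Z" if "\<omega> \<in> Z"
      unfolding Z_def
    proof (intro CollectI conjI allI)
      fix c :: nat
      obtain n where n: "(\<Sum>i<n. h (\<omega> i)) < - real (c + c0)" using \<open>\<omega> \<in> Z\<close> unfolding Z_def by blast
      then obtain k where "n = Suc k" by (cases n) auto
      then show "\<exists>n. (\<Sum>i<n. h (shift 1 \<omega> i)) < - real c"
        using n partial_sum_shift[of h \<omega> k] c0 by (intro exI[of _ k]) auto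
    qed (use \<omega> in auto)
    moreover have "\<omega> \<in> Z" if "shift 1 \<omega> \<in> Z"
      unfolding Z_def
    proof (intro CollectI conjI allI)
      fix c :: nat
      obtain n where n: "(\<Sum>i<n. h (shift 1 \<omega> i)) < - real (c + c0)"
        using \<open>shift 1 \<omega> \<in> Z\<close> unfolding Z_def by blast
      then show "\<exists>n. (\<Sum>i<n. h (\<omega> i)) < - real c"
        using partial_sum_shift[of h \<omega> n] c0 by (intro exI[of _ "Suc n"]) auto
    qed (use \<omega> in auto)
    ultimately show ?thesis by blast
  qed
  \<comment> \<open>Where the new maximum M' is positive, the recursion reads h (\<omega> 0) = M
    (shift 1 \<omega>) - M' \<omega>; elsewhere M' = 0 and M is nonnegative. By invariance of Z and
    of the law, M composed with the shift and M have equal integrals over Z, and M is at most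
    M'.\<close>
  have step: "(\<integral>\<omega>. indicator Z \<omega> * (if 0 < running_max h (Suc n) \<omega> then h (\<omega> 0) else 0) \<partial>\<Omega>) \<le> 0" for n
  proof -
    define M where "M = running_max h n"
    define M' where "M' = running_max h (Suc n)"
    have int: "integrable \<Omega> M" "integrable \<Omega> M'"
      unfolding M_def M'_def by (rule integrable_running_max[OF h])+
    have [measurable]: "M \<in> borel_measurable \<Omega>" "M' \<in> borel_measurable \<Omega>" using int by auto
    have intZ: "integrable \<Omega> (\<lambda>\<omega>. indicator Z \<omega> * f \<omega>)" if "integrable \<Omega> f" for f :: "_ \<Rightarrow> real"
      using integrable_mult_indicator[OF Z that] by simp
    have inth: "integrable \<Omega> (\<lambda>\<omega>. if 0 < M' \<omega> then h (\<omega> 0) else 0)"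
      by (rule Bochner_Integration.integrable_bound[OF integrable_coord[OF h, of 0]]) auto
    have M'_eq: "M' \<omega> = max 0 (M (shift 1 \<omega>) - h (\<omega> 0))" for \<omega>
      by (simp add: M_def M'_def)
    have "(\<integral>\<omega>. indicator Z \<omega> * (if 0 < M' \<omega> then h (\<omega> 0) else 0) \<partial>\<Omega>) \<le>
        (\<integral>\<omega>. indicator Z \<omega> * M (shift 1 \<omega>) - indicator Z \<omega> * M' \<omega> \<partial>\<Omega>)"
    proof (rule integral_mono)
      fix \<omega>
      have "0 \<le> M (shift 1 \<omega>)" unfolding M_def by (rule running_max_nonneg)
      then show "indicator Z \<omega> * (if 0 < M' \<omega> then h (\<omega> 0) else 0) \<le>
          indicator Z \<omega> * M (shift 1 \<omega>) - indicator Z \<omega> * M' \<omega>"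
        using M'_eq[of \<omega>] by (auto split: split_indicator)
    qed (intro Bochner_Integration.integrable_diff intZ inth int integrable_shift)+
    also have "\<dots> = (\<integral>\<omega>. indicator Z \<omega> * M (shift 1 \<omega>) \<partial>\<Omega>) - (\<integral>\<omega>. indicator Z \<omega> * M' \<omega> \<partial>\<Omega>)"
      by (intro Bochner_Integration.integral_diff intZ int integrable_shift)
    also have "(\<integral>\<omega>. indicator Z \<omega> * M (shift 1 \<omega>) \<partial>\<Omega>) = (\<integral>\<omega>. indicator Z (shift 1 \<omega>) * M (shift 1 \<omega>) \<partial>\<Omega>)"
      by (intro Bochner_Integration.integral_cong) (simp_all add: Zshift[unfolded One_nat_def] indicator_def)
    also have "\<dots> = (\<integral>\<omega>. indicator Z \<omega> * M \<omega> \<partial>\<Omega>)"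
      by (rule integral_shift[OF intZ[OF int(1)]])
    also have "\<dots> \<le> (\<integral>\<omega>. indicator Z \<omega> * M' \<omega> \<partial>\<Omega>)"
      by (intro integral_mono intZ int mult_left_mono) (auto simp: M_def M'_def running_max_mono simp del: running_max.simps)
    finally show ?thesis by (simp add: M'_def del: running_max.simps)
  qed
  have "(\<lambda>n. \<integral>\<omega>. indicator Z \<omega> * (if 0 < running_max h (Suc n) \<omega> then h (\<omega> 0) else 0) \<partial>\<Omega>)
      \<longlonglongrightarrow> (\<integral>\<omega>. indicator Z \<omega> * h (\<omega> 0) \<partial>\<Omega>)"
  proof (rule integral_dominated_convergence[where w = "\<lambda>\<omega>. \<bar>h (\<omega> 0)\<bar>"])
    show "integrable \<Omega> (\<lambda>\<omega>. \<bar>h (\<omega> 0)\<bar>)" using integrable_coord[OF h, of 0] by simp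
    show "AE \<omega> in \<Omega>. norm (indicator Z \<omega> * (if 0 < running_max h (Suc n) \<omega> then h (\<omega> 0) else 0)) \<le> \<bar>h (\<omega> 0)\<bar>" for n
      by (auto split: split_indicator)
    show "AE \<omega> in \<Omega>. (\<lambda>n. indicator Z \<omega> * (if 0 < running_max h (Suc n) \<omega> then h (\<omega> 0) else 0))
        \<longlonglongrightarrow> indicator Z \<omega> * h (\<omega> 0)"
    proof (rule AE_I2)
      fix \<omega>
      show "(\<lambda>n. indicator Z \<omega> * (if 0 < running_max h (Suc n) \<omega> then h (\<omega> 0) else 0))
        \<longlonglongrightarrow> indicator Z \<omega> * h (\<omega> 0)"
      proof (cases "\<omega> \<in> Z")
        case True
        \<comment> \<open>On Z some partial sum is negative, so the running maximum is positive from
          that index on.\<close>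
        then obtain k where k: "(\<Sum>i<k. h (\<omega> i)) < - real 0" unfolding Z_def by blast
        have "0 < running_max h (Suc n) \<omega>" if "k \<le> n" for n
          using running_max_ge[of k "Suc n" h \<omega>] k that by simp
        then have "\<forall>\<^sub>F n in sequentially. indicator Z \<omega> * (if 0 < running_max h (Suc n) \<omega> then h (\<omega> 0) else 0) =
            indicator Z \<omega> * h (\<omega> 0)"
          unfolding eventually_sequentially by (intro exI[of _ k]) (simp del: running_max.simps)
        then show ?thesis by (rule tendsto_eventually)
      qed simp
    qed
  qed (simp_all del: running_max.simps)
  then have "(\<integral>\<omega>. indicator Z \<omega> * h (\<omega> 0) \<partial>\<Omega>) \<le> 0"
    by (rule LIMSEQ_le_const2) (use step in blast)
  also have "(\<integral>\<omega>. indicator Z \<omega> * h (\<omega> 0) \<partial>\<Omega>) = (\<integral>\<omega>. h (\<omega> 0) * indicator Z (shift 1 \<omega>) \<partial>\<Omega>)"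
    by (intro Bochner_Integration.integral_cong) (simp_all add: Zshift[unfolded One_nat_def] indicator_def)
  also have "\<dots> = (\<integral>\<omega>. h (\<omega> 0) \<partial>\<Omega>) * P.prob Z"
    by (rule integral_split_indicator[OF integrable_coord[OF h] _ Z]) (auto simp: past_def)
  also have "\<dots> = (\<integral>x. h x \<partial>\<mu>) * P.prob Z" by (simp add: integral_coord[OF h])
  finally have "P.prob Z = 0"
    using pos by (metis measure_nonneg mult_le_0_iff not_le order_antisym_conv)
  then have "AE \<omega> in \<Omega>. \<omega> \<notin> Z" by (subst (asm) P.prob_eq_0[OF Z])
  then show ?thesis using AE_space
  proof eventually_elim
    case (elim \<omega>)
    then obtain c :: nat where "\<forall>n. \<not> (\<Sum>i<n. h (\<omega> i)) < - real c" unfolding Z_def by blast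
    then show ?case by (intro exI[of _ "- real c"]) (auto simp: not_less)
  qed
qed

end

section \<open>Homomorphisms to the integers with transient image walk\<close>

locale integer_projection = random_walk G \<mu>
  for G :: "('a, 'c) monoid_scheme" (structure) and \<mu> :: "'a measure" +
  fixes s :: "'a \<Rightarrow> int"
  assumes s_mult: "x \<in> carrier G \<Longrightarrow> y \<in> carrier G \<Longrightarrow> s (x \<otimes> y) = s x + s y"
    and s_integrable: "integrable \<mu> (\<lambda>x. real_of_int (s x))"
    and s_transient: "AE \<omega> in \<Omega>. finite {n. s (pos \<omega> n) = 0}"
begin

lemma s_one [simp]: "s \<one> = 0"
  using s_mult[of \<one> \<one>] by simp

lemma s_pos_sum: "\<omega> \<in> space \<Omega> \<Longrightarrow> s (pos \<omega> n) = (\<Sum>i<n. s (\<omega> i))"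
  by (induction n) (simp_all add: s_mult coord_carrier)

definition site :: "int \<Rightarrow> nat \<Rightarrow> (nat \<Rightarrow> 'a) set" where
  "site x n = {\<omega> \<in> space \<Omega>. s (pos \<omega> n) = x}"

lemma sets_site [measurable]: "site x n \<in> sets \<Omega>"
proof -
  have "site x n = (\<lambda>\<omega>. pos \<omega> n) -` {g \<in> carrier G. s g = x} \<inter> space \<Omega>"
    by (auto simp: site_def)
  also have "\<dots> \<in> sets \<Omega>" by (rule measurable_sets[OF measurable_pos]) auto
  finally show ?thesis .
qed

lemma past_site: "past n (\<lambda>\<omega>. \<omega> \<in> site x n)"
  unfolding past_def
proof (intro ballI impI)
  fix \<omega> \<omega>' assume *: "\<omega> \<in> space \<Omega>" "\<omega>' \<in> space \<Omega>" "\<forall>i<n. \<omega> i = \<omega>' i"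
  have "pos \<omega> n = pos \<omega>' n" using pastD[OF past_pos[of n n] *(1,2)] *(3) by simp
  then show "(\<omega> \<in> site x n) = (\<omega>' \<in> site x n)" using * by (simp add: site_def)
qed

lemma site_shift:
  assumes "\<omega> \<in> site x m"
  shows "\<omega> \<in> site x (m + k) \<longleftrightarrow> shift m \<omega> \<in> site 0 k"
  using assms pos_shift[of \<omega> k m] by (auto simp: site_def s_mult add.commute)

definition Returns :: ennreal where
  "Returns = (\<Sum>n. emeasure \<Omega> (site 0 n))"

lemma Returns_finite: "Returns < \<top>"
  unfolding Returns_def
proof (rule last_visit_finite)
  show "site 0 0 = space \<Omega>" by (auto simp: site_def)
  show "AE \<omega> in \<Omega>. finite {n. \<omega> \<in> site 0 n}"
    using s_transient by eventually_elim (auto simp: site_def elim: finite_subset[rotated])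
qed (auto intro: past_site simp: site_shift)

lemma site_bound: "(\<Sum>n. emeasure \<Omega> (site x n)) \<le> Returns"
proof -
  have "(\<Sum>n. emeasure \<Omega> (site x n \<inter> space \<Omega>)) \<le> (\<Sum>k. emeasure \<Omega> (site 0 k)) * emeasure \<Omega> (space \<Omega>)"
  proof (rule first_visit_bound[where p = 1])
    show "emeasure \<Omega> (C \<inter> space \<Omega>) = emeasure \<Omega> C * 1" if "C \<in> sets \<Omega>" for C
      using sets.Int_space_eq2[OF that] by simp
  qed (auto intro: past_site simp: site_shift)
  then show ?thesis by (simp add: P.emeasure_space_1 Returns_def)
qed

lemma Green_finite: "Green < \<top>"
proof -
  have "Green \<le> Returns"
    unfolding Green_def Returns_def
  proof (intro suminf_le summableI)
    show "emeasure \<Omega> (visits \<one> n) \<le> emeasure \<Omega> (site 0 n)" for n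
    proof (rule emeasure_mono[OF _ sets_site])
      show "visits \<one> n \<subseteq> site 0 n" by (auto simp: visits_def site_def)
    qed
  qed
  then show ?thesis using Returns_finite by (rule le_less_trans)
qed

text \<open>Without drift, the walk stays within distance \<open>\<eta> n + c\<close> of the origin up to time \<open>n\<close>, so some
  site in this range is visited more often than \<open>Returns\<close> allows.\<close>

lemma drift_nonzero: "(\<integral>x. real_of_int (s x) \<partial>\<mu>) \<noteq> 0"
proof
  assume zero: "(\<integral>x. real_of_int (s x) \<partial>\<mu>) = 0"
  define r where "r = enn2real Returns + 1"
  have r: "1 \<le> r" "Returns \<le> ennreal r"
    using Returns_finite by (auto simp: r_def)
  \<comment> \<open>About 2 \<eta> M sites, each with at most r expected visits, absorb 2 \<eta> r M
    = M / 4 visits, whereas the event \<open>E k\<close> of probability at least 1 / 2 forces M / 2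
    of them.\<close>
  define \<eta> where "\<eta> = 1 / (8 * r)"
  have \<eta>: "0 < \<eta>" "\<eta> * r = 1 / 8" using r by (auto simp: \<eta>_def)
  have intsq: "integrable \<mu> (\<lambda>x. \<eta> + a * real_of_int (s x))" for a :: real
    using s_integrable by simp
  have mean: "(\<integral>x. \<eta> + a * real_of_int (s x) \<partial>\<mu>) = \<eta>" for a :: real
    using s_integrable zero by (simp add: M.prob_space)
  \<comment> \<open>The cases a = 1 and a = -1 bound the walk from both sides by a line of slope
    \<eta>.\<close>
  have bd: "AE \<omega> in \<Omega>. \<exists>c. \<forall>n. c \<le> (\<Sum>i<n. \<eta> + a * real_of_int (s (\<omega> i)))" for a :: real
    by (rule partial_sums_bounded_below[OF intsq]) (simp only: mean \<eta>)
  define E where "E k = {\<omega> \<in> space \<Omega>. \<forall>n. \<bar>real_of_int (s (pos \<omega> n))\<bar> \<le> \<eta> * real n + real k}" for k :: nat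
  have [measurable]: "(\<lambda>\<omega>. real_of_int (s (pos \<omega> n))) \<in> borel_measurable \<Omega>" for n
    by (rule measurable_compose[OF measurable_pos]) simp
  have E [measurable]: "E k \<in> sets \<Omega>" for k unfolding E_def by measurable
  have "AE \<omega> in \<Omega>. \<omega> \<in> (\<Union>k. E k)"
    using bd[of 1] bd[of "-1"] AE_space
  proof eventually_elim
    case (elim \<omega>)
    have "0 < \<eta>" by (rule \<eta>)
    obtain c where c: "c \<le> (\<Sum>i<n. \<eta> + 1 * real_of_int (s (\<omega> i)))" for n using elim(1) by auto
    obtain d where d: "d \<le> (\<Sum>i<n. \<eta> + (-1) * real_of_int (s (\<omega> i)))" for n using elim(2) by auto
    obtain k :: nat where k: "max (- c) (- d) \<le> real k" using real_arch_simple by blast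
    have "\<bar>real_of_int (s (pos \<omega> n))\<bar> \<le> \<eta> * real n + real k" for n
      using c[of n] d[of n] k by (simp add: s_pos_sum[OF elim(3)] sum.distrib sum_negf sum_subtractf mult.commute abs_le_iff)
    then show ?case using elim(3) by (auto simp: E_def)
  qed
  then have "P.prob (\<Union>k. E k) = 1" by (subst P.prob_eq_1) auto
  moreover have "(\<lambda>k. P.prob (E k)) \<longlonglongrightarrow> P.prob (\<Union>k. E k)"
  proof (rule P.finite_Lim_measure_incseq)
    show "incseq E"
      unfolding incseq_def E_def using of_nat_mono by (fastforce intro: order_trans)
  qed auto
  ultimately have "(\<lambda>k. P.prob (E k)) \<longlonglongrightarrow> 1" by simp
  from LIMSEQ_D[OF this, of "1/2"] obtain k where "\<bar>P.prob (E k) - 1\<bar> < 1 / 2" by auto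
  then have k: "1 / 2 \<le> P.prob (E k)" by linarith
  \<comment> \<open>Large enough for M / 4 to exceed the contribution (2 k + 3) r of the sites not
    proportional to M.\<close>
  obtain M :: nat where M: "4 * (2 * real k + 3) * r < real M" using reals_Archimedean2 by blast
  define b where "b = \<lceil>\<eta> * real M + real k\<rceil>"
  have b: "real_of_int b \<le> \<eta> * real M + real k + 1" "\<eta> * real M + real k \<le> real_of_int b" unfolding b_def by linarith+
  have b0: "0 \<le> b" using b(2) \<eta> by (smt (verit) mult_nonneg_nonneg of_int_0_le_iff of_nat_0_le_iff)
  have "real M * (1 / 2) \<le> (\<Sum>n<M. P.prob (E k))" using mult_left_mono[OF k of_nat_0_le_iff[of M]] by (simp only: sum_constant card_lessThan)
  also have "\<dots> \<le> (\<Sum>n<M. \<Sum>x\<in>{-b..b}. P.prob (site x n))"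
  proof (rule sum_mono)
    fix n assume n: "n \<in> {..<M}"
    have "E k \<subseteq> (\<Union>x\<in>{-b..b}. site x n)"
    proof
      fix \<omega> assume \<omega>: "\<omega> \<in> E k"
      then have "\<bar>real_of_int (s (pos \<omega> n))\<bar> \<le> \<eta> * real n + real k" by (auto simp: E_def)
      also have "\<dots> \<le> \<eta> * real M + real k" using n \<eta> by simp
      also have "\<dots> \<le> real_of_int b" by (rule b)
      finally have "\<bar>s (pos \<omega> n)\<bar> \<le> b" by linarith
      then show "\<omega> \<in> (\<Union>x\<in>{-b..b}. site x n)" using \<omega> by (auto simp: E_def site_def)
    qed
    then have "P.prob (E k) \<le> P.prob (\<Union>x\<in>{-b..b}. site x n)" by (intro P.finite_measure_mono) auto
    also have "\<dots> \<le> (\<Sum>x\<in>{-b..b}. P.prob (site x n))" by (intro measure_UNION_le) auto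
    finally show "P.prob (E k) \<le> (\<Sum>x\<in>{-b..b}. P.prob (site x n))" .
  qed
  also have "\<dots> = (\<Sum>x\<in>{-b..b}. \<Sum>n<M. P.prob (site x n))" by (rule sum.swap)
  also have "\<dots> \<le> (\<Sum>x\<in>{-b..b}. r)"
  proof (rule sum_mono)
    fix x
    have "ennreal (\<Sum>n<M. P.prob (site x n)) = (\<Sum>n<M. emeasure \<Omega> (site x n))"
      by (simp add: P.emeasure_eq_measure sum_ennreal)
    also have "\<dots> \<le> (\<Sum>n. emeasure \<Omega> (site x n))" by (rule sum_le_suminf) auto
    also have "\<dots> \<le> ennreal r" using site_bound r(2) by (rule order_trans)
    finally show "(\<Sum>n<M. P.prob (site x n)) \<le> r" using r by (subst (asm) ennreal_le_iff) auto
  qed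
  also have "\<dots> = (2 * real_of_int b + 1) * r" using b0 by simp
  also have "\<dots> \<le> (2 * (\<eta> * real M + real k + 1) + 1) * r" using b r by (intro mult_right_mono) auto
  also have "\<dots> = 2 * (\<eta> * r) * real M + (2 * real k + 3) * r" by (simp add: algebra_simps)
  also have "\<dots> = real M / 4 + (2 * real k + 3) * r" by (simp add: \<eta>)
  finally show False using M by linarith
qed

end

section \<open>The lampshuffler group\<close>

lemma FSym_comp:
  assumes "f \<in> FSym" "g \<in> FSym"
  shows "f \<circ> g \<in> FSym"
proof -
  have "{h. (f \<circ> g) h \<noteq> h} \<subseteq> {h. f h \<noteq> h} \<union> {h. g h \<noteq> h}" by auto
  then show ?thesis using assms by (auto simp: FSym_def intro: bij_comp finite_subset)
qed

lemma FSym_id [simp]: "id \<in> FSym"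
  by (simp add: FSym_def)

lemma FSym_inv:
  assumes "f \<in> FSym"
  shows "inv_into UNIV f \<in> FSym"
proof -
  have f: "bij f" using assms by (simp add: FSym_def)
  have "{h. inv_into UNIV f h \<noteq> h} = {h. f h \<noteq> h}"
    using f by (metis bij_inv_eq_iff)
  then show ?thesis using assms f by (simp add: FSym_def bij_imp_bij_inv)
qed

lemma translate_comp: "translate x (f \<circ> g) = translate x f \<circ> translate x g"
  by (auto simp: translate_def add.assoc[symmetric])

lemma translate_add: "translate (x + y) f = translate x (translate y f)"
  by (auto simp: translate_def add.assoc minus_add diff_conv_add_uminus simp del: add_uminus_conv_diff)

lemma translate_0 [simp]: "translate 0 f = f"
  by (simp add: translate_def)

lemma translate_id [simp]: "translate x id = id"
  by (auto simp: translate_def add.assoc[symmetric])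

lemma bij_group_add: "bij (\<lambda>h. x + h :: 'h :: group_add)"
  by (rule o_bij[where g = "\<lambda>h. - x + h"]) (auto simp: add.assoc[symmetric])

lemma translate_conv: "translate x f = (\<lambda>h. x + h) \<circ> f \<circ> (\<lambda>h. - x + h)"
  by (auto simp: translate_def)

lemma translate_neq: "translate x f h \<noteq> h \<longleftrightarrow> f (- x + h) \<noteq> - x + h"
  unfolding translate_def by (metis add.assoc add.left_inverse add.right_inverse add_0)

lemma FSym_translate:
  assumes "f \<in> FSym"
  shows "translate x f \<in> FSym"
proof -
  have "bij (translate x f)"
    unfolding translate_conv using assms by (intro bij_comp bij_group_add) (simp add: FSym_def)
  moreover have "{h. translate x f h \<noteq> h} \<subseteq> (\<lambda>h. x + h) ` {h. f h \<noteq> h}"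
  proof
    fix h assume "h \<in> {h. translate x f h \<noteq> h}"
    then show "h \<in> (\<lambda>h. x + h) ` {h. f h \<noteq> h}"
      by (intro image_eqI[of _ _ "- x + h"]) (auto simp: translate_neq add.assoc[symmetric])
  qed
  ultimately show ?thesis
    using assms by (auto simp: FSym_def intro: finite_subset)
qed

lemma inj_translate: "inj F \<Longrightarrow> inj (translate x F)"
  unfolding translate_def inj_def by (metis add_left_imp_eq)

lemma carrier_shuffler [simp]: "carrier shuffler = FSym \<times> UNIV"
  by (simp add: shuffler_def)

lemma one_shuffler [simp]: "\<one>\<^bsub>shuffler\<^esub> = (id, 0)"
  by (simp add: shuffler_def)

lemma mult_shuffler: "a \<otimes>\<^bsub>shuffler\<^esub> b = (fst a \<circ> translate (snd a) (fst b), snd a + snd b)"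
  by (simp add: shuffler_def split_beta)

lemma group_shuffler: "group (shuffler :: (('h::group_add \<Rightarrow> 'h) \<times> 'h) monoid)"
proof (rule groupI)
  fix a b c :: "('h \<Rightarrow> 'h) \<times> 'h" assume a: "a \<in> carrier shuffler"
  show "a \<otimes>\<^bsub>shuffler\<^esub> b \<in> carrier shuffler" if "b \<in> carrier shuffler"
    using a that by (auto simp: mult_shuffler intro!: FSym_comp FSym_translate)
  show "a \<otimes>\<^bsub>shuffler\<^esub> b \<otimes>\<^bsub>shuffler\<^esub> c = a \<otimes>\<^bsub>shuffler\<^esub> (b \<otimes>\<^bsub>shuffler\<^esub> c)"
    by (simp add: mult_shuffler translate_comp translate_add add.assoc comp_assoc)
  show "\<one>\<^bsub>shuffler\<^esub> \<otimes>\<^bsub>shuffler\<^esub> a = a" by (simp add: mult_shuffler)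
  have bij: "bij (fst a)" using a by (auto simp: FSym_def)
  show "\<exists>b\<in>carrier shuffler. b \<otimes>\<^bsub>shuffler\<^esub> a = \<one>\<^bsub>shuffler\<^esub>"
  proof
    let ?b = "(translate (- snd a) (inv_into UNIV (fst a)), - snd a)"
    show "?b \<in> carrier shuffler" using a by (auto intro!: FSym_translate FSym_inv)
    show "?b \<otimes>\<^bsub>shuffler\<^esub> a = \<one>\<^bsub>shuffler\<^esub>"
      using bij by (simp add: mult_shuffler translate_comp[symmetric] bij_is_inj)
  qed
qed simp

text \<open>A finitary permutation is determined by its graph over the points it moves, a finite set
  of pairs.\<close>

lemma countable_FSym: "countable (FSym :: ('h::countable \<Rightarrow> 'h) set)"
proof -
  define gr where "gr f = {(h, f h) | h. f h \<noteq> h}" for f :: "'h \<Rightarrow> 'h"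
  have "inj gr"
  proof (rule injI, rule ext)
    fix f g :: "'h \<Rightarrow> 'h" and h assume "gr f = gr g"
    then have "(h, f h) \<in> gr g \<or> f h = h" "(h, g h) \<in> gr f \<or> g h = h" by (auto simp: gr_def)
    then show "f h = g h" by (auto simp: gr_def)
  qed
  moreover have "gr ` FSym \<subseteq> {A. finite A \<and> A \<subseteq> UNIV}"
  proof -
    have "finite (gr f)" if "f \<in> FSym" for f
    proof -
      have "gr f = (\<lambda>h. (h, f h)) ` {h. f h \<noteq> h}" by (auto simp: gr_def)
      then show ?thesis using that by (simp add: FSym_def)
    qed
    then show ?thesis by auto
  qed
  then have "countable (gr ` FSym)"
    using countable_subset countable_Collect_finite_subset[of "UNIV :: ('h \<times> 'h) set"] by blast
  ultimately show ?thesis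
    using countable_image_inj_on inj_on_subset by blast
qed

section \<open>Word length and the spatial range of a group element\<close>

lemma generate_word:
  assumes "group G" "S \<subseteq> carrier G" "g \<in> generate G S"
  shows "\<exists>ws. set ws \<subseteq> S \<union> (\<lambda>s. inv\<^bsub>G\<^esub> s) ` S \<and> foldr (\<lambda>a b. a \<otimes>\<^bsub>G\<^esub> b) ws \<one>\<^bsub>G\<^esub> = g"
  using assms(3)
proof (induction rule: generate.induct)
  interpret group G by fact
  case one
  show ?case by (intro exI[of _ "[]"]) simp
next
  interpret group G by fact
  case (incl h)
  then show ?case using assms(2) by (intro exI[of _ "[h]"]) auto
next
  interpret group G by fact
  case (inv h)
  then show ?case using assms(2) by (intro exI[of _ "[inv\<^bsub>G\<^esub> h]"]) auto
next
  interpret group G by fact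
  case (eng h1 h2)
  then obtain us ws where uw: "set us \<subseteq> S \<union> (\<lambda>s. inv\<^bsub>G\<^esub> s) ` S" "foldr (\<lambda>a b. a \<otimes>\<^bsub>G\<^esub> b) us \<one>\<^bsub>G\<^esub> = h1"
    "set ws \<subseteq> S \<union> (\<lambda>s. inv\<^bsub>G\<^esub> s) ` S" "foldr (\<lambda>a b. a \<otimes>\<^bsub>G\<^esub> b) ws \<one>\<^bsub>G\<^esub> = h2" by blast
  have S: "S \<union> (\<lambda>s. inv\<^bsub>G\<^esub> s) ` S \<subseteq> carrier G" using assms(2) by auto
  have fc: "set vs \<subseteq> carrier G \<Longrightarrow> x \<in> carrier G \<Longrightarrow> foldr (\<lambda>a b. a \<otimes>\<^bsub>G\<^esub> b) vs x \<in> carrier G" for vs x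
    by (induction vs) auto
  have mul: "set vs \<subseteq> carrier G \<Longrightarrow> x \<in> carrier G \<Longrightarrow>
      foldr (\<lambda>a b. a \<otimes>\<^bsub>G\<^esub> b) vs x = foldr (\<lambda>a b. a \<otimes>\<^bsub>G\<^esub> b) vs \<one>\<^bsub>G\<^esub> \<otimes>\<^bsub>G\<^esub> x" for vs x
    by (induction vs) (auto simp: m_assoc fc)
  have "foldr (\<lambda>a b. a \<otimes>\<^bsub>G\<^esub> b) (us @ ws) \<one>\<^bsub>G\<^esub> = h1 \<otimes>\<^bsub>G\<^esub> h2"
    using mul[of us h2] uw S fc[of ws "\<one>\<^bsub>G\<^esub>"] by auto
  then show ?case using uw by (intro exI[of _ "us @ ws"]) auto
qed

text \<open>Radius of the smallest interval around 0 containing both the position and the support of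
  the permutation. It is subadditive, hence at most linear in word length, and the moment hypothesis
  enters the argument only through it.\<close>

definition reach :: "(int \<Rightarrow> int) \<times> int \<Rightarrow> nat" where
  "reach a = (LEAST r. \<bar>snd a\<bar> \<le> int r \<and> (\<forall>h. fst a h \<noteq> h \<longrightarrow> \<bar>h\<bar> \<le> int r))"

lemma
  assumes "a \<in> carrier shuffler"
  shows reach_snd: "\<bar>snd a\<bar> \<le> int (reach a)"
    and reach_fst: "fst a h \<noteq> h \<Longrightarrow> \<bar>h\<bar> \<le> int (reach a)"
proof -
  let ?I = "insert \<bar>snd a\<bar> (abs ` {h. fst a h \<noteq> h})"
  have "finite ?I" using assms by (auto simp: FSym_def)
  then have b: "\<forall>y\<in>?I. y \<le> Max ?I" by (intro ballI Max_ge)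
  have "\<exists>r. \<bar>snd a\<bar> \<le> int r \<and> (\<forall>h. fst a h \<noteq> h \<longrightarrow> \<bar>h\<bar> \<le> int r)"
    using b by (intro exI[of _ "nat (Max ?I)"]) auto
  from LeastI_ex[OF this]
  have "\<bar>snd a\<bar> \<le> int (reach a) \<and> (\<forall>h. fst a h \<noteq> h \<longrightarrow> \<bar>h\<bar> \<le> int (reach a))"
    unfolding reach_def .
  then show "\<bar>snd a\<bar> \<le> int (reach a)" "fst a h \<noteq> h \<Longrightarrow> \<bar>h\<bar> \<le> int (reach a)" by auto
qed

lemma reach_le: "\<bar>snd a\<bar> \<le> int r \<Longrightarrow> (\<And>h. fst a h \<noteq> h \<Longrightarrow> \<bar>h\<bar> \<le> int r) \<Longrightarrow> reach a \<le> r"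
  unfolding reach_def by (rule Least_le) auto

text \<open>The support of the product lies in the union of the support of a and the support of b
  translated by the position of a.\<close>

lemma reach_mult:
  assumes a: "a \<in> carrier shuffler" and b: "b \<in> carrier shuffler"
  shows "reach (a \<otimes>\<^bsub>shuffler\<^esub> b) \<le> reach a + reach b"
proof (rule reach_le)
  show "\<bar>snd (a \<otimes>\<^bsub>shuffler\<^esub> b)\<bar> \<le> int (reach a + reach b)"
    using reach_snd[OF a] reach_snd[OF b] by (simp add: mult_shuffler)
  fix h assume h: "fst (a \<otimes>\<^bsub>shuffler\<^esub> b) h \<noteq> h"
  show "\<bar>h\<bar> \<le> int (reach a + reach b)"
  proof (cases "translate (snd a) (fst b) h = h")
    case True
    then have "fst a h \<noteq> h" using h by (simp add: mult_shuffler)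
    then show ?thesis using reach_fst[OF a] by force
  next
    case False
    then have "\<bar>- snd a + h\<bar> \<le> int (reach b)" using reach_fst[OF b] by (simp add: translate_neq)
    then show ?thesis using reach_snd[OF a] by simp
  qed
qed

lemma reach_word_length:
  assumes S: "finite S" "S \<subseteq> carrier shuffler" "generate shuffler S = carrier shuffler"
  shows "\<exists>C. \<forall>a\<in>carrier shuffler. reach a \<le> C * word_length shuffler S a"
proof -
  interpret group "shuffler :: ((int \<Rightarrow> int) \<times> int) monoid" by (rule group_shuffler)
  let ?S = "S \<union> (\<lambda>s. inv\<^bsub>shuffler\<^esub> s) ` S"
  define C where "C = Max (insert 0 (reach ` ?S))"
  have C: "reach s \<le> C" if "s \<in> ?S" for s
    using S(1) that unfolding C_def by (intro Max_ge) auto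
  have Sc: "?S \<subseteq> carrier shuffler" using S(2) inv_closed by blast
  let ?f = "\<lambda>ws. foldr (\<lambda>a b. a \<otimes>\<^bsub>shuffler\<^esub> b) ws \<one>\<^bsub>shuffler\<^esub>"
  have word: "set ws \<subseteq> ?S \<Longrightarrow> ?f ws \<in> carrier shuffler \<and> reach (?f ws) \<le> C * length ws" for ws
  proof (induction ws)
    case Nil
    show ?case using reach_le[of "\<one>\<^bsub>shuffler\<^esub>" 0] by simp
  next
    case (Cons w ws)
    then have w: "w \<in> ?S" and IH: "?f ws \<in> carrier shuffler" "reach (?f ws) \<le> C * length ws" by auto
    have wc: "w \<in> carrier shuffler" using w Sc by blast
    have "reach (w \<otimes>\<^bsub>shuffler\<^esub> ?f ws) \<le> reach w + reach (?f ws)" by (rule reach_mult[OF wc IH(1)])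
    also have "\<dots> \<le> C + C * length ws" using C[OF w] IH(2) by (rule add_mono)
    finally have "reach (?f (w # ws)) \<le> C * length (w # ws)" by simp
    moreover have "?f (w # ws) \<in> carrier shuffler" using m_closed[OF wc IH(1)] by simp
    ultimately show ?case by blast
  qed
  have "reach a \<le> C * word_length shuffler S a" if a: "a \<in> carrier shuffler" for a
  proof -
    have "\<exists>n. \<exists>ws. length ws = n \<and> set ws \<subseteq> ?S \<and> ?f ws = a"
      using generate_word[OF group_shuffler S(2), of a] a S(3) by auto
    from LeastI_ex[OF this] obtain ws
      where "length ws = word_length shuffler S a" "set ws \<subseteq> ?S" "?f ws = a"
      unfolding word_length_def by blast
    then show ?thesis using word[of ws] by simp
  qed
  then show ?thesis by blast
qed

section \<open>The action on injective functions\<close>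

lemma space_inj_space: "space inj_space = {F. inj F}"
  by (simp add: inj_space_def space_restrict_space space_PiM)

lemma shuffler_action_apply: "inj F \<Longrightarrow> shuffler_action a F = fst a \<circ> translate (snd a) F"
  by (simp add: shuffler_action_def split_beta)

lemma inj_shuffler_action: "a \<in> carrier shuffler \<Longrightarrow> inj F \<Longrightarrow> inj (shuffler_action a F)"
  by (auto simp: shuffler_action_apply FSym_def bij_is_inj intro: inj_compose inj_translate)

lemma group_action_shuffler:
  "group_action (shuffler :: (('h::group_add \<Rightarrow> 'h) \<times> 'h) monoid) {F. inj F} shuffler_action"
proof -
  interpret group "shuffler :: (('h \<Rightarrow> 'h) \<times> 'h) monoid" by (rule group_shuffler)
  let ?E = "{F :: 'h \<Rightarrow> 'h. inj F}"
  have mul: "shuffler_action (a \<otimes>\<^bsub>shuffler\<^esub> b) F = shuffler_action a (shuffler_action b F)"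
    if "b \<in> carrier shuffler" "inj F" for a b :: "('h \<Rightarrow> 'h) \<times> 'h" and F
    using that inj_shuffler_action[OF that]
    by (simp add: shuffler_action_apply mult_shuffler translate_comp translate_add comp_assoc)
  have one: "shuffler_action \<one>\<^bsub>shuffler\<^esub> F = F" if "inj F" for F :: "'h \<Rightarrow> 'h"
    using that by (simp add: shuffler_action_apply)
  have bij: "bij_betw (shuffler_action a) ?E ?E" if a: "a \<in> carrier shuffler" for a :: "('h \<Rightarrow> 'h) \<times> 'h"
  proof (rule bij_betw_byWitness[where f' = "shuffler_action (inv\<^bsub>shuffler\<^esub> a)"])
    have ia: "inv\<^bsub>shuffler\<^esub> a \<in> carrier shuffler" by (rule inv_closed[OF a])
    show "\<forall>F\<in>?E. shuffler_action (inv\<^bsub>shuffler\<^esub> a) (shuffler_action a F) = F"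
      using mul[OF a, of _ "inv\<^bsub>shuffler\<^esub> a"] one by (simp add: l_inv[OF a] del: one_shuffler)
    show "\<forall>F\<in>?E. shuffler_action a (shuffler_action (inv\<^bsub>shuffler\<^esub> a) F) = F"
      using mul[OF ia, of _ a] one by (simp add: r_inv[OF a] del: one_shuffler)
    show "shuffler_action a ` ?E \<subseteq> ?E" using inj_shuffler_action[OF a] by auto
    show "shuffler_action (inv\<^bsub>shuffler\<^esub> a) ` ?E \<subseteq> ?E" using inj_shuffler_action[OF ia] by auto
  qed
  have ext: "shuffler_action a \<in> extensional ?E" for a :: "('h \<Rightarrow> 'h) \<times> 'h"
    by (simp add: shuffler_action_def split_beta)
  have "shuffler_action \<in> hom shuffler (BijGroup ?E)"
  proof (rule homI)
    fix a b :: "('h \<Rightarrow> 'h) \<times> 'h" assume a: "a \<in> carrier shuffler" and b: "b \<in> carrier shuffler"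
    show *: "shuffler_action a \<in> carrier (BijGroup ?E)"
      using bij[OF a] ext by (simp add: BijGroup_def Bij_def)
    have **: "shuffler_action b \<in> Bij ?E" using bij[OF b] ext by (simp add: Bij_def)
    show "shuffler_action (a \<otimes>\<^bsub>shuffler\<^esub> b) =
        shuffler_action a \<otimes>\<^bsub>BijGroup ?E\<^esub> shuffler_action b"
    proof -
      have "shuffler_action (a \<otimes>\<^bsub>shuffler\<^esub> b) = compose ?E (shuffler_action a) (shuffler_action b)"
      proof (rule extensionalityI[OF ext])
        show "compose ?E (shuffler_action a) (shuffler_action b) \<in> extensional ?E" by simp
      qed (simp add: mul[OF b] compose_eq)
      then show ?thesis using * ** by (simp add: BijGroup_def)
    qed
  qed
  then show ?thesis
    unfolding group_action_def group_hom_def group_hom_axioms_def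
    using group_BijGroup group_axioms by blast
qed

lemma measurable_shuffler_action:
  fixes a :: "('h::{group_add, countable} \<Rightarrow> 'h) \<times> 'h"
  assumes a: "a \<in> carrier shuffler"
  shows "shuffler_action a \<in> measurable inj_space inj_space"
proof -
  have "(\<lambda>F h. fst a (snd a + F (- snd a + h))) \<in> measurable inj_space (PiM UNIV (\<lambda>_. count_space UNIV))"
  proof (rule measurable_PiM_single')
    fix h :: 'h
    have "(\<lambda>F. F (- snd a + h)) \<in> measurable inj_space (count_space UNIV)"
      unfolding inj_space_def by (intro measurable_restrict_space1) simp
    then show "(\<lambda>F. fst a (snd a + F (- snd a + h))) \<in> measurable inj_space (count_space UNIV)"
      by (rule measurable_compose) simp
  qed simp
  also have "?this \<longleftrightarrow> shuffler_action a \<in> measurable inj_space (PiM UNIV (\<lambda>_. count_space UNIV))"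
    by (rule measurable_cong) (auto simp: space_inj_space shuffler_action_apply translate_def)
  finally have *: "shuffler_action a \<in> measurable inj_space (PiM UNIV (\<lambda>_. count_space UNIV))" .
  have "shuffler_action a \<in> measurable inj_space (restrict_space (PiM UNIV (\<lambda>_. count_space UNIV)) {F. inj F})"
    using inj_shuffler_action[OF a] by (intro measurable_restrict_space2 *) (auto simp: space_inj_space)
  then show ?thesis by (simp add: inj_space_def[symmetric])
qed

section \<open>Random walks on the lampshuffler group of the integers\<close>

locale shuffler_walk = integer_projection "shuffler :: ((int \<Rightarrow> int) \<times> int) monoid" \<mu> snd
  for \<mu> +
  assumes reach_integrable: "integrable \<mu> (\<lambda>a. real (reach a))"
begin

section \<open>The limit function and its \<sigma>-algebra\<close>

definition good :: "(nat \<Rightarrow> (int \<Rightarrow> int) \<times> int) set" where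
  "good = {x \<in> space T. \<forall>h. \<exists>k. \<forall>\<^sub>F n in sequentially. fst (x n) h = k}"

lemma space_T_FSym: "x \<in> space T \<Longrightarrow> fst (x n) \<in> FSym"
  by (auto simp: space_T mem_Times_iff)

lemma eventually_limit: "x \<in> good \<Longrightarrow> \<forall>\<^sub>F n in sequentially. fst (x n) h = limit_function x h"
proof -
  assume x: "x \<in> good"
  then obtain k where k: "\<forall>\<^sub>F n in sequentially. fst (x n) h = k" unfolding good_def by blast
  have uniq: "j = k" if "\<forall>\<^sub>F n in sequentially. fst (x n) h = j" for j
    using eventually_happens'[OF sequentially_bot eventually_conj[OF that k]] by auto
  have "limit_function x h = (THE k. \<forall>\<^sub>F n in sequentially. fst (x n) h = k)"
    using x by (simp add: limit_function_def good_def)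
  also have "\<dots> = k" using k uniq by (rule the_equality)
  finally show ?thesis using k by simp
qed

lemma limit_eqI: "x \<in> good \<Longrightarrow> \<forall>\<^sub>F n in sequentially. fst (x n) h = k \<Longrightarrow> limit_function x h = k"
proof -
  assume x: "x \<in> good" and k: "\<forall>\<^sub>F n in sequentially. fst (x n) h = k"
  show ?thesis
    using eventually_happens'[OF sequentially_bot eventually_conj[OF eventually_limit[OF x, of h] k]] by auto
qed

lemma limit_not_good: "x \<in> space T \<Longrightarrow> x \<notin> good \<Longrightarrow> limit_function x = fst (x 0)"
  unfolding limit_function_def good_def by (rule if_not_P) blast

lemma inj_limit:
  assumes x: "x \<in> space T"
  shows "inj (limit_function x)"
proof (cases "x \<in> good")
  case True
  show ?thesis
  proof (rule injI)
    fix h h' assume eq: "limit_function x h = limit_function x h'"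
    obtain n where "fst (x n) h = limit_function x h" "fst (x n) h' = limit_function x h'"
      using eventually_happens'[OF sequentially_bot eventually_conj[OF eventually_limit[OF True] eventually_limit[OF True]]]
      by blast
    moreover have "inj (fst (x n))" using space_T_FSym[OF x, of n] by (simp add: FSym_def bij_is_inj)
    ultimately show "h = h'" using eq by (metis injD)
  qed
next
  case False
  then show ?thesis
    using space_T_FSym[OF x, of 0] by (simp add: limit_not_good[OF x] FSym_def bij_is_inj)
qed

lemma good_shift: "x \<in> space T \<Longrightarrow> (\<lambda>n. x (Suc n)) \<in> good \<longleftrightarrow> x \<in> good"
  unfolding good_def by (auto simp: space_T eventually_sequentially_Suc[of "\<lambda>n. fst (x n) _ = _"])

lemma limit_shift:
  assumes "x \<in> good"
  shows "limit_function (\<lambda>n. x (Suc n)) = limit_function x"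
proof
  fix h
  have "x \<in> space T" using assms by (simp add: good_def)
  then show "limit_function (\<lambda>n. x (Suc n)) h = limit_function x h"
    using assms eventually_limit[OF assms, of h]
    by (intro limit_eqI) (simp_all add: good_shift eventually_sequentially_Suc[of "\<lambda>n. fst (x n) h = _"])
qed

lemma lmult_fst: "fst (lmult g x n) h = fst g (snd g + fst (x n) (- snd g + h))"
  by (simp add: lmult_def mult_shuffler translate_def)

lemma eventually_lmult:
  assumes "g \<in> carrier shuffler"
  shows "(\<forall>\<^sub>F n in sequentially. fst (lmult g x n) h = fst g (snd g + k)) \<longleftrightarrow>
    (\<forall>\<^sub>F n in sequentially. fst (x n) (- snd g + h) = k)"
proof -
  have "inj (fst g)" using assms by (auto simp: FSym_def bij_is_inj)
  then show ?thesis by (simp add: lmult_fst inj_eq)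
qed

lemma good_lmult:
  assumes g: "g \<in> carrier shuffler" and x: "x \<in> space T"
  shows "lmult g x \<in> good \<longleftrightarrow> x \<in> good"
proof -
  have one: "lmult g x \<in> good" if g: "g \<in> carrier shuffler" and x: "x \<in> good" for g x
  proof -
    have xT: "x \<in> space T" using x by (simp add: good_def)
    have "\<exists>k. \<forall>\<^sub>F n in sequentially. fst (lmult g x n) h = k" for h
      using eventually_lmult[OF g, of x h] eventually_limit[OF x, of "- snd g + h"] by blast
    then show ?thesis using lmult_space[OF g xT] by (auto simp: good_def)
  qed
  show ?thesis
  proof
    assume "lmult g x \<in> good"
    then have "lmult (inv\<^bsub>shuffler\<^esub> g) (lmult g x) \<in> good" by (rule one[OF inv_closed[OF g]])
    then show "x \<in> good" by (simp only: lmult_lmult_inv(2)[OF g x])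
  qed (rule one[OF g])
qed

lemma limit_lmult:
  assumes g: "g \<in> carrier shuffler" and x: "x \<in> space T"
  shows "limit_function (lmult g x) = shuffler_action g (limit_function x)"
proof (cases "x \<in> good")
  case True
  show ?thesis
  proof
    fix h
    have "limit_function (lmult g x) h = fst g (snd g + limit_function x (- snd g + h))"
      using eventually_lmult[OF g] eventually_limit[OF True] good_lmult[OF g x] True
      by (intro limit_eqI) auto
    then show "limit_function (lmult g x) h = shuffler_action g (limit_function x) h"
      by (simp add: shuffler_action_apply inj_limit[OF x] translate_def)
  qed
next
  case False
  then have "limit_function (lmult g x) = fst (lmult g x 0)"
    using good_lmult[OF g x] lmult_space[OF g x] by (intro limit_not_good) auto
  then show ?thesis
    using False inj_limit[OF x] by (auto simp: limit_not_good[OF x] lmult_fst shuffler_action_apply translate_def)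
qed

lemma measurable_fst_coord [measurable]: "(\<lambda>x. fst (x n) h) \<in> measurable T (count_space UNIV)"
proof -
  have "(\<lambda>x. x n) \<in> measurable T (count_space (carrier shuffler))"
    unfolding trajectory_space_def by measurable
  then show ?thesis by (rule measurable_compose) simp
qed

lemma sets_good [measurable]: "good \<in> sets T"
  unfolding good_def eventually_sequentially by measurable

lemma measurable_limit_coord: "(\<lambda>x. limit_function x h) \<in> measurable T (count_space UNIV)"
proof (subst measurable_count_space_eq_countable, simp, intro conjI allI impI ballI)
  fix k :: int
  have "(\<lambda>x. limit_function x h) -` {k} \<inter> space T =
      {x \<in> space T. x \<in> good \<and> (\<exists>N. \<forall>n\<ge>N. fst (x n) h = k)} \<union>
      {x \<in> space T. x \<notin> good \<and> fst (x 0) h = k}"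
  proof (rule Set.set_eqI)
    fix x
    have "limit_function x h = k \<longleftrightarrow> (\<exists>N. \<forall>n\<ge>N. fst (x n) h = k)" if "x \<in> good"
      using limit_eqI[OF that, of h k] eventually_limit[OF that, of h]
      by (auto simp: eventually_sequentially)
    then show "x \<in> (\<lambda>x. limit_function x h) -` {k} \<inter> space T \<longleftrightarrow>
        x \<in> {x \<in> space T. x \<in> good \<and> (\<exists>N. \<forall>n\<ge>N. fst (x n) h = k)} \<union>
          {x \<in> space T. x \<notin> good \<and> fst (x 0) h = k}"
      using limit_not_good[of x] by (cases "x \<in> good") auto
  qed
  also have "\<dots> \<in> sets T" by measurable
  finally show "(\<lambda>x. limit_function x h) -` {k} \<inter> space T \<in> sets T" .
qed simp

lemma measurable_limit [measurable]: "limit_function \<in> measurable T inj_space"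
  unfolding inj_space_def
proof (rule measurable_restrict_space2)
  show "limit_function \<in> space T \<rightarrow> {F. inj F}" using inj_limit by auto
  show "limit_function \<in> measurable T (PiM UNIV (\<lambda>_. count_space UNIV))"
    using measurable_PiM_single'[of UNIV "\<lambda>h x. limit_function x h" T "\<lambda>_. count_space UNIV"] measurable_limit_coord
    by auto
qed

text \<open>Preimages under \<open>limit_function\<close> need not be invariant: off
  \<open>good\<close> the default value is the first permutation, which the shift changes. So
  invariance is demanded outright and the comparison with a preimage is made on \<open>good\<close>
  only, which \<open>AE_good\<close> shows to have full probability.\<close>

definition limit_events :: "(nat \<Rightarrow> (int \<Rightarrow> int) \<times> int) set set" where
  "limit_events = {B \<in> invariant_events shuffler.
    \<exists>B'\<in>sets inj_space. B \<inter> good = limit_function -` B' \<inter> good}"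

lemma sigma_algebra_limit_events: "sigma_algebra (space T) limit_events"
  unfolding sigma_algebra_iff2
proof (intro conjI ballI allI impI)
  have inv_sub: "B \<subseteq> space T" if "B \<in> invariant_events shuffler" for B
    using sets.sets_into_space[OF invariant_sets[OF that]] .
  show "limit_events \<subseteq> Pow (space T)" using inv_sub by (auto simp: limit_events_def)
  show "{} \<in> limit_events"
    by (auto simp: limit_events_def invariant_events_def intro!: bexI[of _ "{}"])
  fix B assume "B \<in> limit_events"
  then obtain B' where B: "B \<in> invariant_events shuffler" "B' \<in> sets inj_space"
    "B \<inter> good = limit_function -` B' \<inter> good" by (auto simp: limit_events_def)
  have "space T - B \<in> invariant_events shuffler"
  proof (rule invariant_eventI)
    show "(\<lambda>n. x (Suc n)) \<in> space T - B \<longleftrightarrow> x \<in> space T - B" if "x \<in> space T" for x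
      using invariant_shift[OF B(1) that, of 1] that by (auto simp: space_T)
  qed (use invariant_sets[OF B(1)] in auto)
  moreover have "(space T - B) \<inter> good = limit_function -` (space inj_space - B') \<inter> good"
  proof -
    have "x \<in> space T" "inj (limit_function x)" if "x \<in> good" for x
      using that inj_limit[of x] by (auto simp: good_def)
    then show ?thesis using B(3) by (auto simp: space_inj_space)
  qed
  ultimately show "space T - B \<in> limit_events" using B(2) unfolding limit_events_def by blast
next
  fix A :: "nat \<Rightarrow> _" assume "range A \<subseteq> limit_events"
  then have "\<forall>i. \<exists>B'. A i \<in> invariant_events shuffler \<and> B' \<in> sets inj_space \<and> A i \<inter> good = limit_function -` B' \<inter> good"
    unfolding limit_events_def by blast
  then obtain B' where A: "\<And>i. A i \<in> invariant_events shuffler" "\<And>i. B' i \<in> sets inj_space"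
    "\<And>i. A i \<inter> good = limit_function -` B' i \<inter> good" by metis
  have "(\<Union>i. A i) \<in> invariant_events shuffler"
  proof (rule invariant_eventI)
    show "(\<Union>i. A i) \<in> sets T" using invariant_sets[OF A(1)] by auto
    show "(\<lambda>n. x (Suc n)) \<in> (\<Union>i. A i) \<longleftrightarrow> x \<in> (\<Union>i. A i)" if "x \<in> space T" for x
      using invariant_shift[OF A(1) that, where n = 1] by (simp only: UN_iff UNIV_I bex_simps Suc_eq_plus1)
  qed
  moreover have "(\<Union>i. A i) \<inter> good = limit_function -` (\<Union>i. B' i) \<inter> good" using A(3) by blast
  moreover have "(\<Union>i. B' i) \<in> sets inj_space" using A(2) by auto
  ultimately show "(\<Union>i. A i) \<in> limit_events"
    unfolding limit_events_def by (intro CollectI conjI bexI[of _ "\<Union>i. B' i"])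
qed

definition Bm :: "(nat \<Rightarrow> (int \<Rightarrow> int) \<times> int) measure" where
  "Bm = sigma (space T) limit_events"

lemma space_Bm: "space Bm = space T"
  by (simp add: Bm_def space_measure_of_conv)

lemma sets_Bm: "sets Bm = limit_events"
proof -
  interpret sigma_algebra "space T" limit_events by (rule sigma_algebra_limit_events)
  show ?thesis unfolding Bm_def using space_closed by (simp add: sigma_sets_eq)
qed

lemma limit_event_invariant:
  assumes B': "B' \<in> sets inj_space"
  shows "limit_function -` B' \<inter> good \<in> invariant_events shuffler"
proof (rule invariant_eventI)
  have "limit_function -` B' \<inter> good = (limit_function -` B' \<inter> space T) \<inter> good" by (auto simp: good_def)
  also have "\<dots> \<in> sets T" using measurable_sets[OF measurable_limit B'] by auto
  finally show "limit_function -` B' \<inter> good \<in> sets T" .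
  show "(\<lambda>n. x (Suc n)) \<in> limit_function -` B' \<inter> good \<longleftrightarrow> x \<in> limit_function -` B' \<inter> good"
    if "x \<in> space T" for x
    using good_shift[OF that] limit_shift[of x] by auto
qed

lemma limit_eventI: "B' \<in> sets inj_space \<Longrightarrow> limit_function -` B' \<inter> good \<in> sets Bm"
  unfolding sets_Bm limit_events_def using limit_event_invariant by blast

lemma pull_Bm:
  assumes g: "g \<in> carrier shuffler" and B: "B \<in> sets Bm"
  shows "pull g B \<in> sets Bm"
proof -
  obtain B' where B': "B \<in> invariant_events shuffler" "B' \<in> sets inj_space"
    "B \<inter> good = limit_function -` B' \<inter> good" using B by (auto simp: sets_Bm limit_events_def)
  have "pull g B \<inter> good = limit_function -` (shuffler_action g -` B' \<inter> space inj_space) \<inter> good"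
  proof (rule Set.set_eqI)
    fix x
    show "x \<in> pull g B \<inter> good \<longleftrightarrow> x \<in> limit_function -` (shuffler_action g -` B' \<inter> space inj_space) \<inter> good"
    proof (cases "x \<in> good")
      case True
      then have x: "x \<in> space T" by (simp add: good_def)
      have "x \<in> pull g B \<longleftrightarrow> lmult g x \<in> B \<inter> good" using True x good_lmult[OF g x] by (simp add: pull_def)
      also have "\<dots> \<longleftrightarrow> limit_function (lmult g x) \<in> B'" using B'(3) True good_lmult[OF g x] by auto
      finally show ?thesis using True inj_limit[OF x] by (simp add: limit_lmult[OF g x] space_inj_space)
    qed simp
  qed
  moreover have "shuffler_action g -` B' \<inter> space inj_space \<in> sets inj_space"
    by (rule measurable_sets[OF measurable_shuffler_action[OF g] B'(2)])
  ultimately show ?thesis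
    unfolding sets_Bm limit_events_def using invariant_pull[OF B'(1) g] by blast
qed

sublocale invariant_subalgebra "shuffler :: ((int \<Rightarrow> int) \<times> int) monoid" \<mu> Bm
proof unfold_locales
  show "space Bm = space T" by (rule space_Bm)
  show "sets Bm \<subseteq> invariant_events shuffler" by (auto simp: sets_Bm limit_events_def)
  show "pull g B \<in> sets Bm" if "g \<in> carrier shuffler" "B \<in> sets Bm" for g B
    using that by (rule pull_Bm)
  show "Green < \<top>" by (rule Green_finite)
qed

end

section \<open>Reversal of the first n increments\<close>

context random_walk
begin

text \<open>The law of independent identically distributed increments is unaffected by this
  reordering, and the walk before time n, seen backwards from time n, becomes the beginning of a
  walk with the same law. This makes bounds on the past uniform in n.\<close>

definition reverse :: "nat \<Rightarrow> (nat \<Rightarrow> 'a) \<Rightarrow> nat \<Rightarrow> 'a" where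
  "reverse n \<omega> = (\<lambda>i. \<omega> (if i < n then n - Suc i else i))"

lemma distr_reverse: "distr \<Omega> \<Omega> (reverse n) = \<Omega>"
proof -
  define f where "f i = (if i < n then n - Suc i else i)" for i
  have "inj f" by (rule injI) (auto simp: f_def split: if_splits)
  then have "distr \<Omega> \<Omega> (\<lambda>\<omega>. \<lambda>i\<in>UNIV. \<omega> (f i)) = \<Omega>"
    using distr_PiM_reindex[of UNIV "\<lambda>_. \<mu>" f UNIV] by (simp add: prob_space)
  then show ?thesis by (simp add: reverse_def[abs_def] f_def restrict_def)
qed

lemma measurable_reverse [measurable]: "reverse n \<in> measurable \<Omega> \<Omega>"
  unfolding reverse_def by (rule measurable_PiM_single') (auto simp: space_mu)

lemma prob_reverse:
  assumes [measurable]: "A \<in> sets \<Omega>"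
  shows "P.prob {\<omega> \<in> space \<Omega>. reverse n \<omega> \<in> A} = P.prob A"
proof -
  have "P.prob A = measure (distr \<Omega> \<Omega> (reverse n)) A" by (simp add: distr_reverse)
  also have "\<dots> = P.prob (reverse n -` A \<inter> space \<Omega>)" by (rule measure_distr) auto
  also have "reverse n -` A \<inter> space \<Omega> = {\<omega> \<in> space \<Omega>. reverse n \<omega> \<in> A}" by auto
  finally show ?thesis ..
qed

lemma prob_shift:
  assumes [measurable]: "A \<in> sets \<Omega>"
  shows "P.prob {\<omega> \<in> space \<Omega>. shift n \<omega> \<in> A} = P.prob A"
proof -
  have "P.prob A = measure (distr \<Omega> \<Omega> (shift n)) A" by (simp add: distr_shift)
  also have "\<dots> = P.prob (shift n -` A \<inter> space \<Omega>)" by (rule measure_distr) auto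
  also have "shift n -` A \<inter> space \<Omega> = {\<omega> \<in> space \<Omega>. shift n \<omega> \<in> A}" by auto
  finally show ?thesis ..
qed

end

section \<open>Linear escape, stabilisation of the permutations, and the strip\<close>

context shuffler_walk
begin

definition drift :: real where
  "drift = (\<integral>a. real_of_int (snd a) \<partial>\<mu>)"

text \<open>The sign of the drift: positions multiplied by \<open>dir\<close> tend to the right, so
  both signs are treated at once.\<close>

definition dir :: int where
  "dir = (if 0 < drift then 1 else -1)"

lemma dir_cases: "dir = 1 \<or> dir = -1"
  by (simp add: dir_def)

lemma dir_drift: "real_of_int dir * drift = \<bar>drift\<bar>" "0 < \<bar>drift\<bar>"
  using drift_nonzero by (auto simp: dir_def drift_def)

lemma measurable_reach [measurable]: "(\<lambda>\<omega>. real (reach (\<omega> i))) \<in> borel_measurable \<Omega>"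
  using integrable_coord[OF reach_integrable, of i] by simp

lemma measurable_snd_pos [measurable]: "(\<lambda>\<omega>. real_of_int (snd (pos \<omega> n))) \<in> borel_measurable \<Omega>"
  by (rule measurable_compose[OF measurable_pos]) simp

text \<open>A single \<open>reach\<close> is controlled as a difference of two partial sums.
  \<open>h1\<close> bounds the walk plus twice the accumulated reach from below, \<open>h2\<close>
  bounds twice the accumulated reach from above; both have positive mean, |drift| / 2 and |drift| /
  4. The factor 2 leaves one \<open>reach\<close> in reserve for passing from the position before a
  step to the one after it, as \<open>past_rev\<close> requires.\<close>

lemma escape:
  "AE \<omega> in \<Omega>. \<exists>c. \<forall>n. real n * (\<bar>drift\<bar> / 4) + c \<le> real_of_int (dir * snd (pos \<omega> n)) - 2 * real (reach (\<omega> n))"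
proof -
  define r where "r = (\<integral>a. real (reach a) \<partial>\<mu>)"
  define h1 where "h1 a = real_of_int dir * real_of_int (snd a) + 2 * real (reach a) - (2 * r + \<bar>drift\<bar> / 2)" for a :: "(int \<Rightarrow> int) \<times> int"
  define h2 where "h2 a = (2 * r + \<bar>drift\<bar> / 4) - 2 * real (reach a)" for a :: "(int \<Rightarrow> int) \<times> int"
  have "(\<integral>a. h1 a \<partial>\<mu>) = real_of_int dir * drift + 2 * r - (2 * r + \<bar>drift\<bar> / 2)"
    unfolding h1_def using s_integrable reach_integrable by (simp add: drift_def r_def M.prob_space)
  then have m1: "0 < (\<integral>a. h1 a \<partial>\<mu>)" using dir_drift by simp
  have "(\<integral>a. h2 a \<partial>\<mu>) = (2 * r + \<bar>drift\<bar> / 4) - 2 * r"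
    unfolding h2_def using reach_integrable by (simp add: r_def M.prob_space)
  then have m2: "0 < (\<integral>a. h2 a \<partial>\<mu>)" using dir_drift by simp
  have i1: "integrable \<mu> h1" and i2: "integrable \<mu> h2"
    unfolding h1_def h2_def using s_integrable reach_integrable by auto
  show ?thesis
    using partial_sums_bounded_below[OF i1 m1] partial_sums_bounded_below[OF i2 m2] AE_space
  proof eventually_elim
    case (elim \<omega>)
    obtain c where c: "c \<le> (\<Sum>i<n. h1 (\<omega> i))" for n using elim(1) by auto
    obtain d where d: "d \<le> (\<Sum>i<n. h2 (\<omega> i))" for n using elim(2) by auto
    define R where "R n = (\<Sum>i<n. real (reach (\<omega> i)))" for n
    define D where "D = \<bar>drift\<bar> / 4"
    have H1: "(\<Sum>i<n. h1 (\<omega> i)) = real_of_int (dir * snd (pos \<omega> n)) + 2 * R n - (real n * (2 * r) + 2 * (real n * D))" for n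
      by (simp add: h1_def R_def D_def s_pos_sum[OF elim(3)] sum.distrib sum_subtractf sum_distrib_left algebra_simps)
    have H2: "(\<Sum>i<n. h2 (\<omega> i)) = real n * (2 * r) + real n * D - 2 * R n" for n
      by (simp add: h2_def R_def D_def sum_subtractf sum_distrib_left algebra_simps)
    have "real n * D + (c + d - (2 * r + D)) \<le> real_of_int (dir * snd (pos \<omega> n)) - 2 * real (reach (\<omega> n))" for n
    proof -
      have 1: "R (Suc n) = R n + real (reach (\<omega> n))" by (simp add: R_def)
      have 2: "real (Suc n) * (2 * r) = real n * (2 * r) + 2 * r" "real (Suc n) * D = real n * D + D"
        by (simp_all add: algebra_simps)
      \<comment> \<open>Using n for \<open>h1\<close> and n + 1 for \<open>h2\<close> leaves exactly
        the reach of step n, with factor 2.\<close>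
      from c[of n] d[of "Suc n"] show ?thesis unfolding H1 H2 1 2 by (simp add: algebra_simps)
    qed
    then have "\<exists>c. \<forall>n. real n * D + c \<le> real_of_int (dir * snd (pos \<omega> n)) - 2 * real (reach (\<omega> n))" by blast
    then show ?case by (simp only: D_def)
  qed
qed

text \<open>Increment i rearranges only sites within its reach of the current position.\<close>

lemma fst_pos_Suc:
  assumes "\<omega> \<in> space \<Omega>" "int (reach (\<omega> i)) < \<bar>h - snd (pos \<omega> i)\<bar>"
  shows "fst (pos \<omega> (Suc i)) h = fst (pos \<omega> i) h"
proof -
  have "translate (snd (pos \<omega> i)) (fst (\<omega> i)) h = h"
    using reach_fst[OF coord_carrier[OF assms(1)], of i "- snd (pos \<omega> i) + h"] assms(2)
      translate_neq[of "snd (pos \<omega> i)" "fst (\<omega> i)" h] by auto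
  then show ?thesis by (simp add: mult_shuffler)
qed

lemma AE_good: "AE \<omega> in \<Omega>. path \<omega> \<in> good"
  using escape AE_space
proof eventually_elim
  case (elim \<omega>)
  then obtain c where c: "\<And>n. real n * (\<bar>drift\<bar> / 4) + c \<le> real_of_int (dir * snd (pos \<omega> n)) - 2 * real (reach (\<omega> n))"
    by blast
  have "\<exists>k. \<forall>\<^sub>F n in sequentially. fst (path \<omega> n) h = k" for h
  proof -
    \<comment> \<open>From time N on the lower bound of \<open>escape\<close> exceeds |h|, so no
      further step can touch h.\<close>
    obtain N :: nat where N: "(\<bar>real_of_int h\<bar> - c) / (\<bar>drift\<bar> / 4) < real N" using reals_Archimedean2 by blast
    have far: "int (reach (\<omega> n)) < \<bar>h - snd (pos \<omega> n)\<bar>" if "N \<le> n" for n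
    proof -
      have "real N \<le> real n" using that by simp
      then have "(\<bar>real_of_int h\<bar> - c) / (\<bar>drift\<bar> / 4) < real n" using N by linarith
      then have "\<bar>real_of_int h\<bar> - c < real n * (\<bar>drift\<bar> / 4)"
        using dir_drift(2) by (simp add: pos_divide_less_eq)
      then have "\<bar>real_of_int h\<bar> < real_of_int (dir * snd (pos \<omega> n)) - real (reach (\<omega> n))"
        using c[of n] by linarith
      then have "\<bar>h\<bar> < dir * snd (pos \<omega> n) - int (reach (\<omega> n))" by linarith
      then show ?thesis using dir_cases by auto
    qed
    have "fst (pos \<omega> (N + j)) h = fst (pos \<omega> N) h" for j
      using fst_pos_Suc[OF elim(2) far] by (induction j) auto
    then have "\<forall>n\<ge>N. fst (path \<omega> n) h = fst (pos \<omega> N) h"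
      unfolding path_def by (metis add.commute add_Suc_right le_Suc_ex)
    then show ?thesis unfolding eventually_sequentially by blast
  qed
  then show ?case using elim(2) by (simp add: good_def)
qed

definition future :: "nat \<Rightarrow> (nat \<Rightarrow> (int \<Rightarrow> int) \<times> int) set" where
  "future L = {\<omega> \<in> space \<Omega>. \<forall>i. - real L \<le> real_of_int dir * real_of_int (snd (pos \<omega> i)) - real (reach (\<omega> i))}"

text \<open>\<open>future L\<close> is applied to the shifted sequence: after time n no step touches
  sites more than L behind \<open>S\<^sub>n\<close>. \<open>past_rev L\<close> is applied to the
  reversed sequence: before time n no step touched sites more than L ahead. There the reversed
  position with index \<open>Suc i\<close> is \<open>S\<^sub>n\<close> minus the position from which
  reversed increment i was made, hence the offset between the indices.\<close>

definition past_rev :: "nat \<Rightarrow> (nat \<Rightarrow> (int \<Rightarrow> int) \<times> int) set" where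
  "past_rev L = {\<omega> \<in> space \<Omega>. \<forall>i. - real L \<le> real_of_int dir * real_of_int (snd (pos \<omega> (Suc i))) - real (reach (\<omega> i))}"

lemma sets_future [measurable]: "future L \<in> sets \<Omega>" "past_rev L \<in> sets \<Omega>"
  unfolding future_def past_rev_def by measurable

lemma prob_future_past:
  assumes "0 < e"
  shows "\<exists>L. P.prob (space \<Omega> - future L) \<le> e \<and> P.prob (space \<Omega> - past_rev L) \<le> e"
proof -
  have "AE \<omega> in \<Omega>. \<omega> \<in> (\<Union>L. future L \<inter> past_rev L)"
    using escape AE_space
  proof eventually_elim
    case (elim \<omega>)
    then obtain c where c: "\<And>n. real n * (\<bar>drift\<bar> / 4) + c \<le> real_of_int (dir * snd (pos \<omega> n)) - 2 * real (reach (\<omega> n))"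
      by blast
    obtain L :: nat where L: "- c \<le> real L" using real_arch_simple by blast
    have f: "- real L \<le> real_of_int (dir * snd (pos \<omega> n)) - 2 * real (reach (\<omega> n))" for n
    proof -
      have "0 \<le> real n * (\<bar>drift\<bar> / 4)" by simp
      then show ?thesis using c[of n] L by linarith
    qed
    have p: "- real L \<le> real_of_int (dir * snd (pos \<omega> (Suc n))) - real (reach (\<omega> n))" for n
    proof -
      have "dir * snd (pos \<omega> (Suc n)) = dir * snd (pos \<omega> n) + dir * snd (\<omega> n)"
        using elim(2) by (simp add: mult_shuffler distrib_left)
      moreover have "\<bar>dir * snd (\<omega> n)\<bar> \<le> int (reach (\<omega> n))"
        using reach_snd[OF coord_carrier[OF elim(2)], of n] dir_cases by auto
      ultimately have "dir * snd (pos \<omega> n) - int (reach (\<omega> n)) \<le> dir * snd (pos \<omega> (Suc n))" by linarith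
      then have "real_of_int (dir * snd (pos \<omega> n)) - real (reach (\<omega> n)) \<le> real_of_int (dir * snd (pos \<omega> (Suc n)))"
        by linarith
      then show ?thesis using f[of n] by linarith
    qed
    have "\<omega> \<in> future L"
      unfolding future_def
    proof (intro CollectI conjI allI)
      show "- real L \<le> real_of_int dir * real_of_int (snd (pos \<omega> i)) - real (reach (\<omega> i))" for i
        using f[of i] by simp
    qed (rule elim(2))
    moreover have "\<omega> \<in> past_rev L"
      unfolding past_rev_def using p elim(2) by (simp del: pos.simps)
    ultimately show ?case by blast
  qed
  then have "P.prob (\<Union>L. future L \<inter> past_rev L) = 1" by (subst P.prob_eq_1) auto
  moreover have "(\<lambda>L. P.prob (future L \<inter> past_rev L)) \<longlonglongrightarrow> P.prob (\<Union>L. future L \<inter> past_rev L)"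
  proof (rule P.finite_Lim_measure_incseq)
    show "incseq (\<lambda>L. future L \<inter> past_rev L)"
    proof (rule monoI)
      fix L L' :: nat assume "L \<le> L'"
      then have "- real L' \<le> - real L" by simp
      then show "future L \<inter> past_rev L \<subseteq> future L' \<inter> past_rev L'"
        unfolding future_def past_rev_def by (blast intro: order_trans)
    qed
  qed auto
  ultimately have "(\<lambda>L. P.prob (future L \<inter> past_rev L)) \<longlonglongrightarrow> 1" by simp
  from LIMSEQ_D[OF this assms] obtain L where "\<bar>P.prob (future L \<inter> past_rev L) - 1\<bar> < e" by auto
  then have L: "1 - e \<le> P.prob (future L \<inter> past_rev L)" by linarith
  have "P.prob (future L \<inter> past_rev L) \<le> P.prob (future L)" "P.prob (future L \<inter> past_rev L) \<le> P.prob (past_rev L)"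
    by (rule P.finite_measure_mono; auto)+
  then have "P.prob (space \<Omega> - future L) \<le> e" "P.prob (space \<Omega> - past_rev L) \<le> e"
    using L by (simp_all add: P.prob_compl)
  then show ?thesis by blast
qed

definition window :: "nat \<Rightarrow> nat \<Rightarrow> (int \<Rightarrow> int) \<times> int \<Rightarrow> (int \<Rightarrow> int) set" where
  "window L c q = {F. \<bar>snd q\<bar> \<le> int c \<and> (\<forall>h. dir * h < dir * snd q - int L \<longrightarrow> F h = fst q h) \<and>
    (\<forall>h. dir * snd q + int L < dir * h \<longrightarrow> fst q h = h)}"

definition Q :: "nat \<Rightarrow> nat \<Rightarrow> (int \<Rightarrow> int) \<times> int \<Rightarrow> (nat \<Rightarrow> (int \<Rightarrow> int) \<times> int) set" where
  "Q L c q = limit_function -` (window L c q \<inter> space inj_space) \<inter> good"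

lemma sets_Q: "Q L c q \<in> sets Bm"
  unfolding Q_def
proof (rule limit_eventI)
  have [measurable]: "(\<lambda>F. F h) \<in> measurable inj_space (count_space UNIV)" for h :: int
    unfolding inj_space_def by (intro measurable_restrict_space1) simp
  have "window L c q \<inter> space inj_space = {F \<in> space inj_space. \<bar>snd q\<bar> \<le> int c \<and>
      (\<forall>h. dir * h < dir * snd q - int L \<longrightarrow> F h = fst q h) \<and> (\<forall>h. dir * snd q + int L < dir * h \<longrightarrow> fst q h = h)}"
    by (auto simp: window_def)
  also have "\<dots> \<in> sets inj_space" by measurable
  finally show "window L c q \<inter> space inj_space \<in> sets inj_space" .
qed

text \<open>Off the window W all candidates f coincide with one of them, f0. By injectivity, f0
  inverse after f maps W into itself, and this self-map of a set of 2 L + 1 points determines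
  f.\<close>

lemma window_fiber:
  "finite {f \<in> FSym. \<psi> \<in> window L c (f, y)} \<and> card {f \<in> FSym. \<psi> \<in> window L c (f, y)} \<le> (2 * L + 1) ^ (2 * L + 1)"
proof (cases "{f \<in> FSym. \<psi> \<in> window L c (f, y)} = {}")
  case False
  let ?A = "{f \<in> FSym. \<psi> \<in> window L c (f, y)}"
  let ?W = "{y - int L..y + int L}"
  obtain f0 where f0: "f0 \<in> ?A" using False by blast
  have b0: "bij f0" using f0 by (simp add: FSym_def)
  have agree: "f h = f0 h" if "f \<in> ?A" "h \<notin> ?W" for f h
  proof -
    have "dir * h < dir * y - int L \<or> dir * y + int L < dir * h" using that(2) dir_cases by auto
    then show ?thesis using that(1) f0 by (auto simp: window_def)
  qed
  define k where "k f = restrict (\<lambda>h. inv_into UNIV f0 (f h)) ?W" for f :: "int \<Rightarrow> int"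
  have maps: "k f \<in> ?W \<rightarrow>\<^sub>E ?W" if f: "f \<in> ?A" for f
  proof -
    have bf: "bij f" using f by (simp add: FSym_def)
    have "inv_into UNIV f0 (f h) \<in> ?W" if h: "h \<in> ?W" for h
    proof (rule ccontr)
      assume n: "inv_into UNIV f0 (f h) \<notin> ?W"
      have "f (inv_into UNIV f0 (f h)) = f0 (inv_into UNIV f0 (f h))" by (rule agree[OF f n])
      also have "\<dots> = f h" using b0 by (simp add: bij_is_surj surj_f_inv_f)
      finally have "inv_into UNIV f0 (f h) = h" using bf by (meson bij_is_inj injD)
      then show False using n h by simp
    qed
    then show ?thesis by (auto simp: k_def)
  qed
  have inj: "inj_on k ?A"
  proof (rule inj_onI, rule ext)
    fix f g h assume f: "f \<in> ?A" and g: "g \<in> ?A" and eq: "k f = k g"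
    show "f h = g h"
    proof (cases "h \<in> ?W")
      case True
      then have "inv_into UNIV f0 (f h) = inv_into UNIV f0 (g h)" using fun_cong[OF eq, of h] by (simp add: k_def)
      then have "f0 (inv_into UNIV f0 (f h)) = f0 (inv_into UNIV f0 (g h))" by simp
      then show ?thesis using b0 by (simp add: bij_is_surj surj_f_inv_f)
    next
      case False
      then show ?thesis using agree[OF f] agree[OF g] by metis
    qed
  qed
  have fin: "finite (?W \<rightarrow>\<^sub>E ?W)" by (rule finite_PiE) auto
  have sub: "k ` ?A \<subseteq> ?W \<rightarrow>\<^sub>E ?W" using maps by auto
  have "finite ?A" using inj finite_subset[OF sub fin] by (rule finite_imageD[rotated])
  moreover have "card ?A \<le> card (?W \<rightarrow>\<^sub>E ?W)" by (rule card_inj_on_le[OF inj sub fin])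
  moreover have "card (?W \<rightarrow>\<^sub>E ?W) = (2 * L + 1) ^ (2 * L + 1)"
  proof -
    have "card ?W = 2 * L + 1" by simp
    then show ?thesis by (simp add: card_PiE)
  qed
  ultimately show ?thesis by simp
next
  case True
  show ?thesis unfolding True by simp
qed

lemma card_Q:
  "finite {q \<in> carrier shuffler. x \<in> Q L c q} \<and>
    card {q \<in> carrier shuffler. x \<in> Q L c q} \<le> (2 * c + 1) * (2 * L + 1) ^ (2 * L + 1)"
proof -
  let ?A = "\<lambda>y. {f \<in> FSym. limit_function x \<in> window L c (f, y)}"
  let ?S = "SIGMA y:{- int c..int c}. ?A y"
  have fin: "finite ?S" using window_fiber by (intro finite_SigmaI) auto
  have sub: "{q \<in> carrier shuffler. x \<in> Q L c q} \<subseteq> prod.swap ` ?S"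
  proof
    fix q assume q: "q \<in> {q \<in> carrier shuffler. x \<in> Q L c q}"
    then have w: "limit_function x \<in> window L c (fst q, snd q)" "fst q \<in> FSym" by (auto simp: Q_def)
    then have "snd q \<in> {- int c..int c}" by (auto simp: window_def)
    then show "q \<in> prod.swap ` ?S" using w by (intro image_eqI[of _ _ "(snd q, fst q)"]) auto
  qed
  have "card ?S = (\<Sum>y\<in>{- int c..int c}. card (?A y))" using window_fiber by (intro card_SigmaI) auto
  also have "\<dots> \<le> (\<Sum>y\<in>{- int c..int c}. (2 * L + 1) ^ (2 * L + 1))" using window_fiber by (intro sum_mono) auto
  also have "\<dots> = (2 * c + 1) * (2 * L + 1) ^ (2 * L + 1)" by (simp add: nat_add_distrib)
  finally have "card ?S \<le> (2 * c + 1) * (2 * L + 1) ^ (2 * L + 1)" .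
  moreover have "card {q \<in> carrier shuffler. x \<in> Q L c q} \<le> card (prod.swap ` ?S)"
    by (rule card_mono[OF finite_imageI[OF fin] sub])
  moreover have "card (prod.swap ` ?S) \<le> card ?S" by (rule card_image_le[OF fin])
  ultimately show ?thesis using finite_subset[OF sub finite_imageI[OF fin]] by linarith
qed

text \<open>Sites behind the window already have their final value at time n because later steps
  stay away from them; sites ahead of it are still fixed because no earlier step came near.\<close>

lemma path_in_Q:
  assumes \<omega>: "\<omega> \<in> space \<Omega>" and good: "path \<omega> \<in> good"
    and fut: "shift n \<omega> \<in> future L" and past: "reverse n \<omega> \<in> past_rev L" and c: "\<bar>snd (pos \<omega> n)\<bar> \<le> int c"
  shows "path \<omega> \<in> Q L c (pos \<omega> n)"
proof -
  have fut': "dir * snd (pos \<omega> n) - int L \<le> dir * snd (pos \<omega> (n + j)) - int (reach (\<omega> (n + j)))" for j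
  proof -
    have "- real L \<le> real_of_int dir * real_of_int (snd (pos (shift n \<omega>) j)) - real (reach (shift n \<omega> j))"
      using fut unfolding future_def by blast
    then have "- int L \<le> dir * snd (pos (shift n \<omega>) j) - int (reach (shift n \<omega> j))"
      by (simp flip: of_int_mult)
    moreover have "snd (pos \<omega> (n + j)) = snd (pos \<omega> n) + snd (pos (shift n \<omega>) j)"
      using pos_shift[OF \<omega>, of j n] by (simp add: mult_shuffler add.commute)
    ultimately show ?thesis by (simp add: shift_def distrib_left add.commute)
  qed
  \<comment> \<open>With j = n - 1 - i the reversed walk has position \<open>S\<^sub>n\<close> -
    \<open>S\<^sub>i\<close> at index j + 1, and its increment j is the original increment
    i.\<close>
  have past': "dir * snd (pos \<omega> i) + int (reach (\<omega> i)) \<le> dir * snd (pos \<omega> n) + int L" if i: "i < n" for i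
  proof -
    define j where "j = n - Suc i"
    have ji: "n - Suc j = i" "j < n" using i by (auto simp: j_def)
    have rs: "reverse n \<omega> \<in> space \<Omega>" using measurable_space[OF measurable_reverse \<omega>] .
    have "- real L \<le> real_of_int dir * real_of_int (snd (pos (reverse n \<omega>) (Suc j))) - real (reach (reverse n \<omega> j))"
      using past unfolding past_rev_def by blast
    then have 1: "- int L \<le> dir * snd (pos (reverse n \<omega>) (Suc j)) - int (reach (reverse n \<omega> j))"
      by (simp del: pos.simps flip: of_int_mult)
    have "snd (pos (reverse n \<omega>) (Suc j)) = (\<Sum>k<Suc j. snd (\<omega> (n - Suc k)))"
      unfolding s_pos_sum[OF rs] using ji by (intro sum.cong) (auto simp: reverse_def)
    also have "\<dots> = (\<Sum>k\<in>{i..<n}. snd (\<omega> k))"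
      using ji i by (intro sum.reindex_bij_witness[of _ "\<lambda>k. n - Suc k" "\<lambda>k. n - Suc k"]) auto
    also have "\<dots> = snd (pos \<omega> n) - snd (pos \<omega> i)"
      unfolding s_pos_sum[OF \<omega>] using i sum.atLeastLessThan_concat[of 0 i n "\<lambda>k. snd (\<omega> k)"]
      by (simp add: lessThan_atLeast0)
    finally have "snd (pos (reverse n \<omega>) (Suc j)) = snd (pos \<omega> n) - snd (pos \<omega> i)" .
    moreover have "reverse n \<omega> j = \<omega> i" using ji by (simp add: reverse_def)
    ultimately show ?thesis using 1 by (simp add: right_diff_distrib)
  qed
  have "limit_function (path \<omega>) h = fst (pos \<omega> n) h" if h: "dir * h < dir * snd (pos \<omega> n) - int L" for h
  proof -
    have far: "int (reach (\<omega> (n + j))) < \<bar>h - snd (pos \<omega> (n + j))\<bar>" for j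
      using fut'[of j] h dir_cases by auto
    have "fst (pos \<omega> (n + j)) h = fst (pos \<omega> n) h" for j
      using fst_pos_Suc[OF \<omega> far] by (induction j) auto
    then have "\<forall>m\<ge>n. fst (path \<omega> m) h = fst (pos \<omega> n) h"
      unfolding path_def by (metis add.commute add_Suc_right le_Suc_ex)
    then show ?thesis by (intro limit_eqI[OF good]) (auto simp: eventually_sequentially)
  qed
  moreover have "fst (pos \<omega> n) h = h" if h: "dir * snd (pos \<omega> n) + int L < dir * h" for h
  proof -
    have "i \<le> n \<Longrightarrow> fst (pos \<omega> i) h = h" for i
    proof (induction i)
      case (Suc i)
      have "int (reach (\<omega> i)) < \<bar>h - snd (pos \<omega> i)\<bar>"
        using past'[of i] Suc.prems h dir_cases by auto
      then show ?case using fst_pos_Suc[OF \<omega>] Suc by (simp del: pos.simps)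
    qed simp
    then show ?thesis by simp
  qed
  ultimately show ?thesis
    using good inj_limit[of "path \<omega>"] \<omega> c by (auto simp: Q_def window_def space_inj_space)
qed

text \<open>Markov's inequality for the accumulated reach, which dominates the distance from 0 and
  has mean at most r (N + 1).\<close>

lemma prob_far:
  assumes "0 < e"
  shows "\<exists>c::nat. \<forall>N. \<forall>n<Suc N. P.prob {\<omega> \<in> space \<Omega>. int (c * Suc N) < \<bar>snd (pos \<omega> n)\<bar>} \<le> e"
proof -
  define r where "r = (\<integral>a. real (reach a) \<partial>\<mu>)"
  have r: "0 \<le> r" unfolding r_def by simp
  obtain c0 :: nat where c0: "r / e < real c0" using reals_Archimedean2 by blast
  \<comment> \<open>Ensures r < e c; the successor makes c positive, as the division in Markov's
    inequality requires.\<close>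
  define c where "c = Suc c0"
  have c: "r < e * real c" "0 < real c"
    using c0 assms by (auto simp: c_def pos_divide_less_eq algebra_simps)
  have "P.prob {\<omega> \<in> space \<Omega>. int (c * Suc N) < \<bar>snd (pos \<omega> n)\<bar>} \<le> e" if n: "n < Suc N" for n N
  proof -
    have cN: "0 < real (c * Suc N)" unfolding of_nat_0_less_iff using c(2) by simp
    define u where "u \<omega> = (\<Sum>i<n. real (reach (\<omega> i)))" for \<omega>
    have ui: "integrable \<Omega> u" unfolding u_def by (intro Bochner_Integration.integrable_sum integrable_coord reach_integrable)
    then have [measurable]: "u \<in> borel_measurable \<Omega>" by simp
    have Eu: "(\<integral>\<omega>. u \<omega> \<partial>\<Omega>) = real n * r"
      unfolding u_def
      by (subst Bochner_Integration.integral_sum)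
        (simp_all add: integrable_coord[OF reach_integrable] integral_coord[OF reach_integrable] r_def)
    have "P.prob {\<omega> \<in> space \<Omega>. int (c * Suc N) < \<bar>snd (pos \<omega> n)\<bar>} \<le>
        P.prob {\<omega> \<in> space \<Omega>. real (c * Suc N) \<le> u \<omega>}"
    proof (rule P.finite_measure_mono)
      show "{\<omega> \<in> space \<Omega>. int (c * Suc N) < \<bar>snd (pos \<omega> n)\<bar>} \<subseteq> {\<omega> \<in> space \<Omega>. real (c * Suc N) \<le> u \<omega>}"
      proof safe
        fix \<omega> assume \<omega>: "\<omega> \<in> space \<Omega>" and big: "int (c * Suc N) < \<bar>snd (pos \<omega> n)\<bar>"
        have "\<bar>snd (pos \<omega> n)\<bar> \<le> (\<Sum>i<n. \<bar>snd (\<omega> i)\<bar>)" unfolding s_pos_sum[OF \<omega>] by (rule sum_abs)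
        also have "\<dots> \<le> (\<Sum>i<n. int (reach (\<omega> i)))" by (intro sum_mono reach_snd coord_carrier \<omega>)
        finally have "int (c * Suc N) \<le> (\<Sum>i<n. int (reach (\<omega> i)))" using big by linarith
        then have "c * Suc N \<le> (\<Sum>i<n. reach (\<omega> i))" by (simp only: flip: of_nat_sum)
        then show "real (c * Suc N) \<le> u \<omega>" unfolding u_def of_nat_sum[symmetric] by (rule of_nat_mono)
      qed
    qed measurable
    also have "\<dots> \<le> (\<integral>\<omega>. u \<omega> \<partial>\<Omega>) / real (c * Suc N)"
      by (rule integral_Markov_inequality_measure[OF ui sets.top _ cN]) (simp add: u_def sum_nonneg)
    also have "\<dots> \<le> e"
    proof -
      have "real n * r \<le> real (Suc N) * (e * real c)" using n c r by (intro mult_mono) auto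
      then show ?thesis unfolding Eu pos_divide_le_eq[OF cN] by (simp add: algebra_simps)
    qed
    finally show ?thesis .
  qed
  then show ?thesis by blast
qed

sublocale strip "shuffler :: ((int \<Rightarrow> int) \<times> int) monoid" \<mu> Bm
proof
  fix \<epsilon> :: real assume \<epsilon>: "0 < \<epsilon>"
  obtain L where L: "P.prob (space \<Omega> - future L) \<le> \<epsilon> / 3" "P.prob (space \<Omega> - past_rev L) \<le> \<epsilon> / 3"
    using prob_future_past[of "\<epsilon> / 3"] \<epsilon> by auto
  obtain c :: nat where c: "\<forall>N. \<forall>n<Suc N. P.prob {\<omega> \<in> space \<Omega>. int (c * Suc N) < \<bar>snd (pos \<omega> n)\<bar>} \<le> \<epsilon> / 3"
    using prob_far[of "\<epsilon> / 3"] \<epsilon> by auto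
  \<comment> \<open>The strip has at most (2 c (N + 1) + 1) W elements: admissible positions times
    permutations per position. The walk misses it only through a bad future, a bad past or a
    distance above c (N + 1), each of probability at most \<epsilon> / 3.\<close>
  define W where "W = (2 * L + 1) ^ (2 * L + 1)"
  have "\<exists>Q. (\<forall>q\<in>carrier shuffler. Q q \<in> sets Bm) \<and>
      (\<forall>x\<in>space T. finite {q \<in> carrier shuffler. x \<in> Q q} \<and>
        real (card {q \<in> carrier shuffler. x \<in> Q q}) \<le> real ((2 * c + 1) * W) * real (Suc N)) \<and>
      (\<Sum>n<Suc N. P.prob {\<omega> \<in> space \<Omega>. path \<omega> \<notin> Q (pos \<omega> n)}) \<le> \<epsilon> * real (Suc N)" for N
  proof (intro exI[of _ "Q L (c * Suc N)"] conjI ballI)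
    fix x
    show "finite {q \<in> carrier shuffler. x \<in> Q L (c * Suc N) q}" using card_Q by blast
    have "card {q \<in> carrier shuffler. x \<in> Q L (c * Suc N) q} \<le> (2 * (c * Suc N) + 1) * W"
      unfolding W_def using card_Q by blast
    also have "\<dots> \<le> ((2 * c + 1) * Suc N) * W" by (intro mult_right_mono) auto
    finally have "card {q \<in> carrier shuffler. x \<in> Q L (c * Suc N) q} \<le> ((2 * c + 1) * W) * Suc N"
      by (simp only: ac_simps)
    then show "real (card {q \<in> carrier shuffler. x \<in> Q L (c * Suc N) q}) \<le> real ((2 * c + 1) * W) * real (Suc N)"
      unfolding of_nat_mult[symmetric] by (rule of_nat_mono)
  next
    have "P.prob {\<omega> \<in> space \<Omega>. path \<omega> \<notin> Q L (c * Suc N) (pos \<omega> n)} \<le> \<epsilon>" if n: "n < Suc N" for n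
    proof -
      let ?A = "{\<omega> \<in> space \<Omega>. shift n \<omega> \<in> space \<Omega> - future L}"
      let ?B = "{\<omega> \<in> space \<Omega>. reverse n \<omega> \<in> space \<Omega> - past_rev L}"
      let ?C = "{\<omega> \<in> space \<Omega>. int (c * Suc N) < \<bar>snd (pos \<omega> n)\<bar>}"
      have Cm: "?C \<in> sets \<Omega>"
      proof -
        have "?C = {\<omega> \<in> space \<Omega>. real (c * Suc N) < \<bar>real_of_int (snd (pos \<omega> n))\<bar>}"
          by (intro Collect_cong conj_cong refl) linarith
        also have "\<dots> \<in> sets \<Omega>" by measurable
        finally show ?thesis .
      qed
      have ABm: "?A \<in> sets \<Omega>" "?B \<in> sets \<Omega>" by measurable
      have "P.prob {\<omega> \<in> space \<Omega>. path \<omega> \<notin> Q L (c * Suc N) (pos \<omega> n)} \<le> P.prob (?A \<union> (?B \<union> ?C))"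
      proof (rule P.finite_measure_mono_AE)
        show "AE \<omega> in \<Omega>. \<omega> \<in> {\<omega> \<in> space \<Omega>. path \<omega> \<notin> Q L (c * Suc N) (pos \<omega> n)} \<longrightarrow> \<omega> \<in> ?A \<union> (?B \<union> ?C)"
          using AE_good AE_space
        proof eventually_elim
          case (elim \<omega>)
          have "shift n \<omega> \<in> space \<Omega>" "reverse n \<omega> \<in> space \<Omega>"
            using measurable_space[OF measurable_shift elim(2)] measurable_space[OF measurable_reverse elim(2)] by auto
          moreover have "\<not> (shift n \<omega> \<in> future L \<and> reverse n \<omega> \<in> past_rev L \<and> \<bar>snd (pos \<omega> n)\<bar> \<le> int (c * Suc N))"
            if "path \<omega> \<notin> Q L (c * Suc N) (pos \<omega> n)"
            using path_in_Q[OF elim(2,1)] that by blast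
          ultimately show ?case using elim(2) unfolding not_le[symmetric] by blast
        qed
      qed (use ABm Cm in auto)
      also have "\<dots> \<le> P.prob ?A + (P.prob ?B + P.prob ?C)"
        using ABm Cm by (intro order_trans[OF measure_Un_le] add_left_mono measure_Un_le) auto
      also have "\<dots> \<le> \<epsilon> / 3 + (\<epsilon> / 3 + \<epsilon> / 3)"
      proof (intro add_mono)
        show "P.prob ?A \<le> \<epsilon> / 3" using L(1) by (subst prob_shift) auto
        show "P.prob ?B \<le> \<epsilon> / 3" using L(2) by (subst prob_reverse) auto
        show "P.prob ?C \<le> \<epsilon> / 3" using c n by blast
      qed
      finally show ?thesis by simp
    qed
    then have "(\<Sum>n<Suc N. P.prob {\<omega> \<in> space \<Omega>. path \<omega> \<notin> Q L (c * Suc N) (pos \<omega> n)}) \<le> (\<Sum>n<Suc N. \<epsilon>)"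
      by (intro sum_mono) simp
    then show "(\<Sum>n<Suc N. P.prob {\<omega> \<in> space \<Omega>. path \<omega> \<notin> Q L (c * Suc N) (pos \<omega> n)}) \<le> \<epsilon> * real (Suc N)"
      by (simp only: sum_constant card_lessThan mult.commute)
  qed (rule sets_Q)
  then show "\<exists>K. \<forall>N. \<exists>Q. (\<forall>q\<in>carrier shuffler. Q q \<in> sets Bm) \<and>
      (\<forall>x\<in>space T. finite {q \<in> carrier shuffler. x \<in> Q q} \<and>
        real (card {q \<in> carrier shuffler. x \<in> Q q}) \<le> K * real (Suc N)) \<and>
      (\<Sum>n<Suc N. P.prob {\<omega> \<in> space \<Omega>. path \<omega> \<notin> Q (pos \<omega> n)}) \<le> \<epsilon> * real (Suc N)"
    by blast
qed

section \<open>Identification of the Poisson boundary\<close>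

lemma AE_walk_law_good: "AE x in walk_law shuffler \<mu>. x \<in> good"
  unfolding walk_law_eq
  using AE_good sets_good sets.sets_into_space[OF sets_good]
  by (subst AE_distr_iff) (auto simp: Int_absorb1 Collect_conj_eq[symmetric] Int_def[symmetric])

lemma null_sets_walk_law:
  "X \<in> sets T \<Longrightarrow> P.prob (ev X) = 0 \<Longrightarrow> X \<in> null_sets (walk_law shuffler \<mu>)"
proof (rule null_setsI)
  assume X: "X \<in> sets T" "P.prob (ev X) = 0"
  have "path -` X \<inter> space \<Omega> = ev X" by (auto simp: ev_def)
  then show "emeasure (walk_law shuffler \<mu>) X = 0"
    using X by (simp add: walk_law_eq emeasure_distr P.emeasure_eq_measure)
qed (simp add: walk_law_eq)

lemma not_good_null: "space T - good \<in> null_sets (walk_law shuffler \<mu>)"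
proof (rule null_sets_walk_law)
  have "AE \<omega> in \<Omega>. \<omega> \<notin> ev (space T - good)" using AE_good by eventually_elim (auto simp: ev_def)
  then show "P.prob (ev (space T - good)) = 0" by (subst P.prob_eq_0) auto
qed auto

lemma sets_limit_algebra:
  "sets (vimage_algebra (space T) limit_function (hitting_measure \<mu>)) =
    {limit_function -` B \<inter> space T | B. B \<in> sets inj_space}"
proof -
  have "limit_function \<in> space T \<rightarrow> space (hitting_measure \<mu>)"
    using inj_limit by (auto simp: hitting_measure_def space_inj_space)
  from sets_vimage_algebra2[OF this] show ?thesis by (simp add: hitting_measure_def)
qed

text \<open>The events of \<open>Bm\<close> agree with preimages of the limit function on
  \<open>good\<close>, so one direction is \<open>invariant_event_in_subalgebra\<close> up to the
  null set off \<open>good\<close>. For the other, a preimage need not be invariant itself, but its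
  intersection with \<open>good\<close> is.\<close>

lemma invariant_events_eq_limit_algebra:
  "equal_mod_null (walk_law shuffler \<mu>) (invariant_events (shuffler :: ((int \<Rightarrow> int) \<times> int) monoid))
    (sets (vimage_algebra (space T) limit_function (hitting_measure \<mu>)))"
  unfolding equal_mod_null_def
proof (intro conjI ballI)
  fix A :: "(nat \<Rightarrow> (int \<Rightarrow> int) \<times> int) set" assume A: "A \<in> invariant_events shuffler"
  then obtain B where B: "B \<in> sets Bm" "P.prob (sym_diff (ev A) (ev B)) = 0"
    using invariant_event_in_subalgebra by blast
  then obtain B' where B': "B' \<in> sets inj_space" "B \<inter> good = limit_function -` B' \<inter> good"
    by (auto simp: sets_Bm limit_events_def)
  have AB: "A \<in> sets T" "B \<in> sets T" using A B by (auto intro: invariant_sets Bm_T)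
  have C: "limit_function -` B' \<inter> space T \<in> sets T" by (rule measurable_sets[OF measurable_limit B'(1)])
  have "sym_diff (ev A) (ev B) = ev (sym_diff A B)" by (auto simp: ev_def)
  then have "sym_diff A B \<in> null_sets (walk_law shuffler \<mu>)"
    using B(2) AB by (intro null_sets_walk_law) auto
  then have "sym_diff A B \<union> (space T - good) \<in> null_sets (walk_law shuffler \<mu>)"
    using not_good_null by (rule null_sets.Un)
  moreover have "sym_diff A (limit_function -` B' \<inter> space T) \<subseteq> sym_diff A B \<union> (space T - good)"
    using B'(2) sets.sets_into_space[OF AB(1)] by blast
  moreover have "sym_diff A (limit_function -` B' \<inter> space T) \<in> sets (walk_law shuffler \<mu>)"
    using AB(1) C by (simp add: walk_law_eq sets.Diff sets.Un)
  ultimately have "sym_diff A (limit_function -` B' \<inter> space T) \<in> null_sets (walk_law shuffler \<mu>)"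
    using null_sets_subset by blast
  then show "\<exists>B\<in>sets (vimage_algebra (space T) limit_function (hitting_measure \<mu>)). sym_diff A B \<in> null_sets (walk_law shuffler \<mu>)"
    unfolding sets_limit_algebra using B'(1) by blast
next
  fix B assume "B \<in> sets (vimage_algebra (space T) limit_function (hitting_measure \<mu>))"
  then obtain B' where B': "B' \<in> sets inj_space" "B = limit_function -` B' \<inter> space T"
    by (auto simp: sets_limit_algebra)
  have BT: "B \<in> sets T" unfolding B'(2) by (rule measurable_sets[OF measurable_limit B'(1)])
  have "sym_diff (limit_function -` B' \<inter> good) B \<subseteq> space T - good"
    by (auto simp: B'(2) good_def)
  moreover have "limit_function -` B' \<inter> good \<in> invariant_events shuffler"
    by (rule limit_event_invariant[OF B'(1)])
  moreover have "sym_diff (limit_function -` B' \<inter> good) B \<in> sets (walk_law shuffler \<mu>)"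
    using BT invariant_sets[OF limit_event_invariant[OF B'(1)]] by (simp add: walk_law_eq sets.Diff sets.Un)
  ultimately show "\<exists>A\<in>invariant_events shuffler. sym_diff A B \<in> null_sets (walk_law shuffler \<mu>)"
    using null_sets_subset[OF not_good_null] by blast
qed

lemma hitting_measure_eq: "hitting_measure \<mu> = distr \<Omega> inj_space (\<lambda>\<omega>. limit_function (path \<omega>))"
  unfolding hitting_measure_def walk_law_eq
  by (subst distr_distr) (auto simp: comp_def)

lemma measurable_limit_path: "(\<lambda>\<omega>. limit_function (path \<omega>)) \<in> measurable \<Omega> inj_space"
  by (rule measurable_compose[OF measurable_path measurable_limit])

text \<open>On \<open>good\<close> the limit ignores the first position, and the remaining
  trajectory is the translate by the first increment of the trajectory of the shifted
  increments.\<close>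

lemma limit_first_step:
  "AE \<omega> in \<Omega>. limit_function (path \<omega>) = shuffler_action (\<omega> 0) (limit_function (path (shift 1 \<omega>)))"
  using AE_good AE_space
proof eventually_elim
  case (elim \<omega>)
  have "\<omega> 0 \<in> carrier shuffler" by (rule coord_carrier[OF elim(2)])
  then have "pos \<omega> 1 = \<omega> 0" using l_one by (simp del: one_shuffler carrier_shuffler)
  then have "(\<lambda>n. path \<omega> (Suc n)) = lmult (\<omega> 0) (path (shift 1 \<omega>))"
    using path_shift[OF elim(2), of 1] by simp
  then have "limit_function (path \<omega>) = limit_function (lmult (\<omega> 0) (path (shift 1 \<omega>)))"
    using limit_shift[OF elim(1)] by simp
  also have "\<dots> = shuffler_action (\<omega> 0) (limit_function (path (shift 1 \<omega>)))"
    by (rule limit_lmult[OF coord_carrier[OF elim(2)] path_space[OF shift_space[OF elim(2)]]])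
  finally show ?case .
qed

text \<open>In \<open>limit_first_step\<close> the limit of the shifted sequence has law
  \<open>hitting_measure \<mu>\<close> and is independent of the first increment, which has law
  \<mu>.\<close>

lemma hitting_measure_stationary: "stationary_measure \<mu> shuffler_action (hitting_measure \<mu>)"
  unfolding stationary_measure_def
proof
  let ?\<nu> = "hitting_measure \<mu>"
  let ?X = "\<lambda>\<omega>. limit_function (path \<omega>)"
  fix A assume "A \<in> sets ?\<nu>"
  then have A: "A \<in> sets inj_space" by (simp add: hitting_measure_def)
  define f where "f g \<omega> = (indicator A (shuffler_action g (?X \<omega>)) :: ennreal)" for g \<omega>
  have act: "(\<lambda>\<omega>. shuffler_action g (?X \<omega>)) \<in> measurable \<Omega> inj_space" if "g \<in> carrier shuffler" for g
    by (rule measurable_compose[OF measurable_limit_path measurable_shuffler_action[OF that]])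
  have fm: "f g \<in> borel_measurable \<Omega>" if "g \<in> carrier shuffler" for g
    unfolding f_def by (rule measurable_compose[OF act[OF that]]) (use A in simp)
  have fint: "(\<integral>\<^sup>+\<omega>. f g \<omega> \<partial>\<Omega>) = emeasure (distr ?\<nu> ?\<nu> (shuffler_action g)) A" if g: "g \<in> carrier shuffler" for g
  proof -
    have "distr ?\<nu> ?\<nu> (shuffler_action g) = distr \<Omega> inj_space (\<lambda>\<omega>. shuffler_action g (?X \<omega>))"
      unfolding hitting_measure_eq
      using distr_distr[OF measurable_shuffler_action[OF g] measurable_limit_path]
      by (simp add: comp_def cong: distr_cong)
    then have "emeasure (distr ?\<nu> ?\<nu> (shuffler_action g)) A = (\<integral>\<^sup>+F. indicator A F \<partial>distr \<Omega> inj_space (\<lambda>\<omega>. shuffler_action g (?X \<omega>)))"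
      using A by simp
    also have "\<dots> = (\<integral>\<^sup>+\<omega>. f g \<omega> \<partial>\<Omega>)"
      unfolding f_def using A by (intro nn_integral_distr act g) simp
    finally show ?thesis ..
  qed
  have one: "pos \<omega> 1 = \<omega> 0" if "\<omega> \<in> space \<Omega>" for \<omega>
    using l_one[OF coord_carrier[OF that, of 0]] by (simp del: one_shuffler carrier_shuffler)
  have "emeasure ?\<nu> A = (\<integral>\<^sup>+F. indicator A F \<partial>distr \<Omega> inj_space ?X)"
    using A by (simp add: hitting_measure_eq)
  also have "\<dots> = (\<integral>\<^sup>+\<omega>. indicator A (?X \<omega>) \<partial>\<Omega>)"
    using A by (intro nn_integral_distr measurable_limit_path) simp
  also have "\<dots> = (\<integral>\<^sup>+\<omega>. indicator (space \<Omega>) \<omega> * f (pos \<omega> 1) (shift 1 \<omega>) \<partial>\<Omega>)"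
  proof (rule nn_integral_cong_AE)
    show "AE \<omega> in \<Omega>. indicator A (?X \<omega>) = indicator (space \<Omega>) \<omega> * f (pos \<omega> 1) (shift 1 \<omega>)"
      using limit_first_step AE_space
    proof eventually_elim
      case (elim \<omega>)
      have "f (pos \<omega> 1) (shift 1 \<omega>) = indicator A (?X \<omega>)"
        unfolding f_def one[OF elim(2)] elim(1)[symmetric] ..
      then show ?case using elim(2) by simp
    qed
  qed
  also have "\<dots> = (\<integral>\<^sup>+\<omega>. indicator (space \<Omega>) \<omega> * (\<integral>\<^sup>+\<omega>'. f (pos \<omega> 1) \<omega>' \<partial>\<Omega>) \<partial>\<Omega>)"
    by (rule nn_integral_split_pos[OF fm]) (auto simp: past_def)
  also have "\<dots> = (\<integral>\<^sup>+\<omega>. emeasure (distr ?\<nu> ?\<nu> (shuffler_action (\<omega> 0))) A \<partial>\<Omega>)"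
  proof (rule nn_integral_cong)
    fix \<omega> assume \<omega>: "\<omega> \<in> space \<Omega>"
    show "indicator (space \<Omega>) \<omega> * (\<integral>\<^sup>+\<omega>'. f (pos \<omega> 1) \<omega>' \<partial>\<Omega>) = emeasure (distr ?\<nu> ?\<nu> (shuffler_action (\<omega> 0))) A"
      unfolding one[OF \<omega>] fint[OF coord_carrier[OF \<omega>]] using \<omega> by simp
  qed
  also have "\<dots> = (\<integral>\<^sup>+g. emeasure (distr ?\<nu> ?\<nu> (shuffler_action g)) A \<partial>distr \<Omega> \<mu> (\<lambda>\<omega>. \<omega> 0))"
  proof (rule nn_integral_distr[symmetric])
    show "(\<lambda>\<omega>. \<omega> 0) \<in> measurable \<Omega> \<mu>" by measurable
    have "(\<lambda>g. emeasure (distr ?\<nu> ?\<nu> (shuffler_action g)) A) \<in> borel_measurable (count_space (carrier shuffler))" by simp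
    then show "(\<lambda>g. emeasure (distr ?\<nu> ?\<nu> (shuffler_action g)) A) \<in> borel_measurable (distr \<Omega> \<mu> (\<lambda>\<omega>. \<omega> 0))"
      unfolding distr_coord using measurable_cong_sets[OF sets_mu_count refl] by blast
  qed
  also have "\<dots> = (\<integral>\<^sup>+g. emeasure (distr ?\<nu> ?\<nu> (shuffler_action g)) A \<partial>\<mu>)" by (simp only: distr_coord)
  finally show "emeasure ?\<nu> A = (\<integral>\<^sup>+g. emeasure (distr ?\<nu> ?\<nu> (shuffler_action g)) A \<partial>\<mu>)" .
qed

lemma poisson_boundary_limit_functions:
  "poisson_boundary shuffler \<mu> (hitting_measure \<mu>) shuffler_action limit_function"
proof -
  have sp: "space (hitting_measure \<mu>) = {F. inj F}" by (simp add: hitting_measure_def space_inj_space)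
  have se: "sets (hitting_measure \<mu>) = sets inj_space" by (simp add: hitting_measure_def)
  show ?thesis
    unfolding poisson_boundary_def
  proof (intro conjI ballI)
    show "group_action shuffler (space (hitting_measure \<mu>)) shuffler_action"
      unfolding sp by (rule group_action_shuffler)
    show "shuffler_action g \<in> measurable (hitting_measure \<mu>) (hitting_measure \<mu>)" if "g \<in> carrier shuffler" for g
      using measurable_shuffler_action[OF that] measurable_cong_sets[OF se se] by blast
    show "limit_function \<in> measurable T (hitting_measure \<mu>)"
      using measurable_limit measurable_cong_sets[OF refl se] by blast
    show "limit_function (\<lambda>n. g \<otimes>\<^bsub>shuffler\<^esub> x n) = shuffler_action g (limit_function x)"
      if "g \<in> carrier shuffler" "x \<in> space T" for g x
      using limit_lmult[OF that] by (simp add: lmult_def)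
    show "equal_mod_null (walk_law shuffler \<mu>) (invariant_events shuffler)
        (sets (vimage_algebra (space T) limit_function (hitting_measure \<mu>)))"
      by (rule invariant_events_eq_limit_algebra)
    show "hitting_measure \<mu> = distr (walk_law shuffler \<mu>) (hitting_measure \<mu>) limit_function"
      by (subst (1) hitting_measure_def) (rule distr_cong, simp_all add: se)
    show "stationary_measure \<mu> shuffler_action (hitting_measure \<mu>)" by (rule hitting_measure_stationary)
  qed
qed

end

section \<open>Passage from the moment and transience hypotheses to the locale\<close>

lemma integrable_reach:
  assumes sets: "sets \<mu> = Pow (carrier shuffler)" and moment: "finite_first_moment shuffler \<mu>"
  shows "integrable \<mu> (\<lambda>a. real (reach a))"
proof -
  obtain S where S: "finite S" "S \<subseteq> carrier shuffler" "generate shuffler S = carrier shuffler"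
    and int: "integrable \<mu> (\<lambda>g. real (word_length shuffler S g))"
    using moment unfolding finite_first_moment_def by blast
  obtain C where C: "\<forall>a\<in>carrier shuffler. reach a \<le> C * word_length shuffler S a"
    using reach_word_length[OF S] by blast
  have sc: "sets \<mu> = sets (count_space (carrier shuffler))" by (simp add: sets)
  have sp: "space \<mu> = carrier shuffler" using sets_eq_imp_space_eq[OF sc] by simp
  have "integrable \<mu> (\<lambda>g. real C * real (word_length shuffler S g))" using int by simp
  then show ?thesis
  proof (rule Bochner_Integration.integrable_bound)
    have "(\<lambda>a. real (reach a)) \<in> borel_measurable (count_space (carrier shuffler))" by simp
    then show "(\<lambda>a. real (reach a)) \<in> borel_measurable \<mu>"
      using measurable_cong_sets[OF sc refl] by blast
    show "AE a in \<mu>. norm (real (reach a)) \<le> norm (real C * real (word_length shuffler S a))"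
    proof (rule AE_I2)
      fix a assume "a \<in> space \<mu>"
      then have "reach a \<le> C * word_length shuffler S a" using C sp by blast
      then have "real (reach a) \<le> real (C * word_length shuffler S a)" by (rule of_nat_mono)
      then show "norm (real (reach a)) \<le> norm (real C * real (word_length shuffler S a))" by simp
    qed
  qed
qed

theorem theorem1p2:
  fixes \<mu> :: "((int \<Rightarrow> int) \<times> int) measure"
  assumes "prob_space \<mu>" and "sets \<mu> = Pow (carrier shuffler)"
    and "finite_first_moment shuffler \<mu>"
    and transient: "AE x in walk_law shuffler \<mu>. finite {n. snd (x n) = 0}"
  shows "(AE x in walk_law shuffler \<mu>. \<forall>h. \<forall>\<^sub>F n in sequentially. fst (x n) h = limit_function x h) \<and>
    poisson_boundary shuffler \<mu> (hitting_measure \<mu>) shuffler_action limit_function"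
proof -
  interpret prob_space \<mu> by fact
  interpret group "shuffler :: ((int \<Rightarrow> int) \<times> int) monoid" by (rule group_shuffler)
  interpret random_walk "shuffler :: ((int \<Rightarrow> int) \<times> int) monoid" \<mu>
  proof unfold_locales
    show "countable (carrier (shuffler :: ((int \<Rightarrow> int) \<times> int) monoid))"
      unfolding carrier_shuffler by (intro countable_SIGMA countable_FSym) simp
  qed (rule assms(2))
  have reach: "integrable \<mu> (\<lambda>a. real (reach a))" by (rule integrable_reach[OF assms(2,3)])
  have walk: "shuffler_walk \<mu>"
  proof unfold_locales
    show "snd (x \<otimes>\<^bsub>shuffler\<^esub> y) = snd x + snd y" for x y :: "(int \<Rightarrow> int) \<times> int"
      by (simp add: mult_shuffler)
    show "integrable \<mu> (\<lambda>x. real_of_int (snd x))"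
    proof (rule Bochner_Integration.integrable_bound[OF reach])
      have "(\<lambda>x. real_of_int (snd x)) \<in> borel_measurable (count_space (carrier (shuffler :: ((int \<Rightarrow> int) \<times> int) monoid)))" by simp
      then show "(\<lambda>x. real_of_int (snd x)) \<in> borel_measurable \<mu>"
        using measurable_cong_sets[OF sets_mu_count refl] by blast
      show "AE x in \<mu>. norm (real_of_int (snd x)) \<le> norm (real (reach x))"
      proof (rule AE_I2)
        fix x assume "x \<in> space \<mu>"
        then have "\<bar>snd x\<bar> \<le> int (reach x)" by (intro reach_snd) (simp only: space_mu)
        then show "norm (real_of_int (snd x)) \<le> norm (real (reach x))" by simp
      qed
    qed
    show "AE \<omega> in \<Omega>. finite {n. snd (pos \<omega> n) = 0}"
    proof -
      have "AE \<omega> in \<Omega>. finite {n. snd (path \<omega> n) = 0}"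
        using transient unfolding walk_law_eq by (rule AE_distrD[OF measurable_path])
      then show ?thesis
      proof eventually_elim
        case (elim \<omega>)
        \<comment> \<open>The starting point, absent from trajectories, contributes the extra index
          0 and shifts the others by one.\<close>
        have "{n. snd (pos \<omega> n) = 0} \<subseteq> insert 0 (Suc ` {n. snd (path \<omega> n) = 0})"
        proof
          fix n assume "n \<in> {n. snd (pos \<omega> n) = 0}"
          then show "n \<in> insert 0 (Suc ` {n. snd (path \<omega> n) = 0})" by (cases n) (auto simp: path_def)
        qed
        then show ?case by (rule finite_subset) (use elim in simp)
      qed
    qed
    show "integrable \<mu> (\<lambda>a. real (reach a))" by (rule reach)
  qed
  interpret shuffler_walk \<mu> by (rule walk)
  have "AE x in walk_law shuffler \<mu>. \<forall>h. \<forall>\<^sub>F n in sequentially. fst (x n) h = limit_function x h"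
    using AE_walk_law_good by eventually_elim (simp add: eventually_limit)
  then show ?thesis using poisson_boundary_limit_functions by blast
qed

end
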